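(* For the sub-Riemannian structure on $SL(2)=SL(2,\mathbb{R})$ defined by the right invariant orthonormal frame corresponding to $\{A_1,A_2\}$, the critical locus and the cut locus (for geodesics starting from the identity $\mathbf 1$) coincide, and are given by the inverse image under the natural projection $\pi$ of the union of the unit circle and the semi-infinite segment $y\equiv 0$, $-\infty<x<-1$: $$\pi^{-1}\Big(\{(x,y): x^2+y^2=1\}\ \cup\ \{(x,0): -\infty<x<-1\}\Big).$$ These are the matrices of the form $$X=\begin{pmatrix} x & y\\ -y & x\end{pmatrix},\quad x^2+y^2=1,$$ together with the matrices in $SL(2)$ of the form $$X=\begin{pmatrix} a & b\\ b& d\end{pmatrix},\quad \text{with } \frac{a+d}{2}\le -1 .$$
   Context: $SL(2)$ is the group of real $2\times2$ matrices of determinant $1$, with Lie algebra $sl(2)$ and basis $A_0=\frac12\begin{pmatrix}0&-1\\1&0\end{pmatrix}$, $A_1=\frac12\begin{pmatrix}0&1\\1&0\end{pmatrix}$, $A_2=\frac12\begin{pmatrix}1&0\\0&-1\end{pmatrix}$. The sub-Riemannian structure: the distribution is $\Delta_X=\mathrm{span}\{A_1X,A_2X\}\subset T_XSL(2)$, with the metric for which $A_1X,A_2X$ are orthonormal at every $X$ (equivalently, the right invariant metric induced by $g(B,C)=2\,\mathrm{Tr}(BC^T)$ on $\mathrm{span}\{A_1,A_2\}$). Horizontal curves are Lipschitz curves tangent to $\Delta$ almost everywhere; the sub-Riemannian distance between two points is the minimum of the lengths of horizontal curves joining them; a horizontal curve is minimizing (optimal) if its length equals the distance between its endpoints. The sub-Riemannian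 geodesics from the identity $\mathbf 1$, parametrized by arclength, are the curves $X(t)=e^{(cA_0+P)t}e^{-cA_0t}$, $t\ge0$, with $c\in\mathbb{R}$ and $P\in\mathrm{span}\{A_1,A_2\}$ of unit norm. Critical locus: the locus of points where sub-Riemannian geodesics starting from $\mathbf 1$ cease to be optimal. Cut locus: the locus of points that are reached simultaneously (at the same, minimum, time) by two different optimal sub-Riemannian geodesics starting from $\mathbf 1$. The map $\pi:SL(2)\to\{(x,y)\in\mathbb{R}^2:x^2+y^2\ge1\}$ is $\pi\begin{pmatrix}a&b\\c&d\end{pmatrix}=\left(\frac{a+d}{2},\frac{b-c}{2}\right)$; it is the natural projection onto the quotient $SL(2)/SO(2)$ for the action of $SO(2)$ on $SL(2)$ by conjugation, the quotient being identified with $\{(x,y):x^2+y^2\ge 1\}$.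
   Formalization: The identity is removed from the preimage in the locus equality, as no geodesic ceases to be optimal there; and the geodesics are taken as e^{-cA_0t}e^{(cA_0+P)t}, since the printed factor order is not tangent to span{A_1X, A_2X} when c≠0. *)

theory Defs
  imports "HOL-Analysis.Analysis"
begin

definition A0 :: "real^2^2" where
  "A0 = (1/2) *\<^sub>R vector [vector [0, -1], vector [1, 0]]"

definition A1 :: "real^2^2" where
  "A1 = (1/2) *\<^sub>R vector [vector [0, 1], vector [1, 0]]"

definition A2 :: "real^2^2" where
  "A2 = (1/2) *\<^sub>R vector [vector [1, 0], vector [0, -1]]"

definition SL2 :: "(real^2^2) set" where
  "SL2 = {X. det X = 1}"

definition distribution :: "real^2^2 \<Rightarrow> (real^2^2) set" where
  "distribution X = span {A1 ** X, A2 ** X}"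

text \<open>Right translation carries \<open>B X, C X\<close> back to \<open>B, C\<close>; the vectors
  \<open>A1 X, A2 X\<close> are orthonormal for this form.\<close>

definition sr_metric :: "real^2^2 \<Rightarrow> real^2^2 \<Rightarrow> real^2^2 \<Rightarrow> real" where
  "sr_metric X V W = 2 * trace ((V ** matrix_inv X) ** transpose (W ** matrix_inv X))"

text \<open>All curves are parametrized on an interval \<open>[0, T]\<close>. One-sided derivatives at
  the end points are immaterial, as these form a null set.\<close>

definition horizontal_curve :: "(real \<Rightarrow> real^2^2) \<Rightarrow> real \<Rightarrow> bool" where
  "horizontal_curve \<gamma> T \<longleftrightarrow>
     0 \<le> T \<and> \<gamma> ` {0..T} \<subseteq> SL2 \<and> (\<exists>L. L-lipschitz_on {0..T} \<gamma>) \<and>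
     (AE t in lebesgue_on {0..T}.
        \<exists>V\<in>distribution (\<gamma> t). (\<gamma> has_vector_derivative V) (at t within {0..T}))"

definition sr_length :: "(real \<Rightarrow> real^2^2) \<Rightarrow> real \<Rightarrow> real" where
  "sr_length \<gamma> T =
     integral {0..T} (\<lambda>t. let V = vector_derivative \<gamma> (at t within {0..T})
                          in sqrt (sr_metric (\<gamma> t) V V))"

definition sr_dist :: "real^2^2 \<Rightarrow> real^2^2 \<Rightarrow> real" where
  "sr_dist X Y =
     Inf {sr_length \<gamma> T |\<gamma> T. horizontal_curve \<gamma> T \<and> \<gamma> 0 = X \<and> \<gamma> T = Y}"

definition minimizing :: "(real \<Rightarrow> real^2^2) \<Rightarrow> real \<Rightarrow> bool" where
  "minimizing \<gamma> T \<longleftrightarrow> horizontal_curve \<gamma> T \<and> sr_length \<gamma> T = sr_dist (\<gamma> 0) (\<gamma> T)"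

definition matrix_exp :: "real^2^2 \<Rightarrow> real^2^2" where
  "matrix_exp A = (\<Sum>n. (1 / fact n) *\<^sub>R (((**) A) ^^ n) (mat 1))"

text \<open>The order of the two factors is the one that belongs to the right invariant
  distribution: for \<open>X = exp (-c t A0) exp (t (c A0 + P))\<close> one has
  \<open>X' = (exp (-c t A0) P exp (c t A0)) X\<close>, and conjugation by the rotation
  \<open>exp (-c t A0)\<close> is an isometry of \<open>span {A1, A2}\<close>. In the opposite order
  \<open>exp (t (c A0 + P)) exp (-c t A0)\<close> (which is the inverse of the curve above with
  \<open>(c, P)\<close> replaced by \<open>(-c, -P)\<close>) one obtains the geodesics of the left invariant
  structure \<open>span {X A1, X A2}\<close>; these are not tangent to \<open>distribution X\<close> unless
  \<open>c = 0\<close>.\<close>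

definition geodesic_curve :: "real \<Rightarrow> real^2^2 \<Rightarrow> real \<Rightarrow> real^2^2" where
  "geodesic_curve c P t = matrix_exp (-(c * t) *\<^sub>R A0) ** matrix_exp (t *\<^sub>R (c *\<^sub>R A0 + P))"

definition geodesics :: "(real \<Rightarrow> real^2^2) set" where
  "geodesics = {geodesic_curve c P |c P. P \<in> span {A1, A2} \<and> sr_metric (mat 1) P P = 1}"

definition critical_locus :: "(real^2^2) set" where
  "critical_locus =
     {\<gamma> T |\<gamma> T. \<gamma> \<in> geodesics \<and> 0 \<le> T \<and> minimizing \<gamma> T \<and> (\<forall>t>T. \<not> minimizing \<gamma> t)}"

text \<open>The two geodesics are compared as minimizing curves, i.e. on \<open>[0, T]\<close>. Hence the
  starting point is not a cut point merely because all geodesics emanate from it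
  at time \<open>0\<close>.\<close>

definition cut_locus :: "(real^2^2) set" where
  "cut_locus =
     {X. \<exists>\<gamma>\<in>geodesics. \<exists>\<delta>\<in>geodesics. \<exists>T\<ge>0.
        minimizing \<gamma> T \<and> minimizing \<delta> T \<and> \<gamma> T = X \<and> \<delta> T = X \<and>
        (\<exists>t\<in>{0..T}. \<gamma> t \<noteq> \<delta> t)}"

text \<open>Relevant on \<open>SL2\<close> only; see the intersection with \<open>SL2\<close> where preimages are taken.\<close>

definition quotient_proj :: "real^2^2 \<Rightarrow> real \<times> real" where
  "quotient_proj X = ((X $ 1 $ 1 + X $ 2 $ 2) / 2, (X $ 1 $ 2 - X $ 2 $ 1) / 2)"

end

(* In the coordinates z = (a + d)/2 + i (b - c)/2, w = (a - d)/2 + i (b + c)/2 the group is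
   |z|^2 - |w|^2 = 1, quotient_proj is z, and a horizontal curve satisfies z' = cnj q w, w' = q z
   with speed 2 |q|. The quotient therefore carries the metric 4 |dz|^2 / (|z|^2 - 1), and in polar
   coordinates its eikonal equation has the solutions p arg z +- F_p(|w|), p constant.
   Running up with + and, after the maximum R of |w|, down with -, every curve from 1 has length at
   least 2 (p |Arg z| + 2 F_p(R) - F_p(|w|)) for every p with (p^2 - 1) R^2 <= 1; a suitable p shows that
   a geodesic is minimizing until it returns to |z| = 1 or its argument reaches pi, whichever comes
   first. Past that moment an intermediate value argument on the geodesics arriving at the same |w|
   yields a strictly shorter one with the same endpoint. *)
theory Submission
  imports Defs
begin

section \<open>Generalised sine and cosine\<close>

text \<open>The constant p is the angular momentum of the rotation invariant quotient metric; along
  the geodesic with parameter \<open>c\<close> it equals \<open>c\<close>. For p > 1 the root in F_p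
  is real only up to the turning radius 1 / sqrt (p^2 - 1). So for c > 1 the natural choice p = c
  fails against a competitor that goes farther out, and it is exact on the geodesic only up to its
  own turning point. The remedy is to take the p whose turning radius is the competitor's maximal
  |w|: then 2 F_p(R) = pi (p - sqrt (p^2 - 1)) in closed form, and everything reduces to one
  inequality about the return times of closed geodesics. Working with |Arg z| instead of a
  continuous argument keeps the estimate valid because |Arg| is subadditive, and its ceiling pi is
  the second stopping condition. For the shorter curves, the family arriving at a fixed |w| is
  ordered by (1 - c^2) t^2: the arrival time is strictly monotone in it, while for the argument
  continuity suffices.\<close>

text \<open>\<open>sn k\<close> and \<open>cs k\<close> are the solutions of \<open>f'' = k f\<close> with the initial values of
  \<open>sin\<close> and \<open>cos\<close>.\<close>

definition sn :: "real \<Rightarrow> real \<Rightarrow> real" where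
  "sn k t = (if k > 0 then sinh (sqrt k * t) / sqrt k
             else if k < 0 then sin (sqrt (-k) * t) / sqrt (-k) else t)"

definition cs :: "real \<Rightarrow> real \<Rightarrow> real" where
  "cs k t = (if k > 0 then cosh (sqrt k * t) else if k < 0 then cos (sqrt (-k) * t) else 1)"

lemma sn_0 [simp]: "sn k 0 = 0" and cs_0 [simp]: "cs k 0 = 1"
  by (auto simp: sn_def cs_def)

lemma sn_zero_param [simp]: "sn 0 t = t" and cs_zero_param [simp]: "cs 0 t = 1"
  by (auto simp: sn_def cs_def)

lemma DERIV_sn [derivative_intros]:
  assumes "(g has_real_derivative g') (at x within A)"
  shows "((\<lambda>x. sn k (g x)) has_real_derivative (cs k (g x) * g')) (at x within A)"
proof -
  consider "k > 0" | "k < 0" | "k = 0" by linarith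
  then have "(sn k has_real_derivative cs k t) (at t)" for t
  proof cases
    case 1
    then have "((\<lambda>t. sinh (sqrt k * t) / sqrt k) has_real_derivative
        cosh (sqrt k * t) * sqrt k / sqrt k) (at t)"
      by (intro DERIV_cdivide) (auto intro!: derivative_eq_intros)
    moreover have "sn k = (\<lambda>t. sinh (sqrt k * t) / sqrt k)" using 1 by (auto simp: sn_def)
    ultimately show ?thesis using 1 by (simp add: cs_def)
  next
    case 2
    then have "((\<lambda>t. sin (sqrt (-k) * t) / sqrt (-k)) has_real_derivative
        cos (sqrt (-k) * t) * sqrt (-k) / sqrt (-k)) (at t)"
      by (intro DERIV_cdivide) (auto intro!: derivative_eq_intros)
    moreover have "sn k = (\<lambda>t. sin (sqrt (-k) * t) / sqrt (-k))" using 2 by (auto simp: sn_def)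
    ultimately show ?thesis using 2 by (simp add: cs_def)
  next
    case 3
    then show ?thesis unfolding sn_def cs_def by (auto intro!: derivative_eq_intros)
  qed
  from DERIV_chain2[OF this assms] show ?thesis .
qed

lemma DERIV_cs [derivative_intros]:
  assumes "(g has_real_derivative g') (at x within A)"
  shows "((\<lambda>x. cs k (g x)) has_real_derivative (k * sn k (g x) * g')) (at x within A)"
proof -
  consider "k > 0" | "k < 0" | "k = 0" by linarith
  then have "(cs k has_real_derivative k * sn k t) (at t)" for t
  proof cases
    case 1
    then have "k * (sinh (sqrt k * t) / sqrt k) = sinh (sqrt k * t) * sqrt k"
      by (metis less_imp_le mult.commute real_div_sqrt times_divide_eq_left times_divide_eq_right)
    with 1 have "((\<lambda>t. cosh (sqrt k * t)) has_real_derivative k * (sinh (sqrt k * t) / sqrt k)) (at t)"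
      by (auto intro!: derivative_eq_intros)
    moreover have "cs k = (\<lambda>t. cosh (sqrt k * t))" using 1 by (auto simp: cs_def)
    ultimately show ?thesis using 1 by (simp add: sn_def)
  next
    case 2
    then have "(-k) * (sin (sqrt (-k) * t) / sqrt (-k)) = sin (sqrt (-k) * t) * sqrt (-k)"
      by (metis less_imp_le mult.commute neg_0_less_iff_less real_div_sqrt times_divide_eq_left times_divide_eq_right)
    with 2 have "((\<lambda>t. cos (sqrt (-k) * t)) has_real_derivative k * (sin (sqrt (-k) * t) / sqrt (-k))) (at t)"
      by (auto intro!: derivative_eq_intros)
    moreover have "cs k = (\<lambda>t. cos (sqrt (-k) * t))" using 2 by (auto simp: cs_def)
    ultimately show ?thesis using 2 by (simp add: sn_def)
  next
    case 3
    then show ?thesis unfolding sn_def cs_def by (auto intro!: derivative_eq_intros)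
  qed
  from DERIV_chain2[OF this assms] show ?thesis .
qed

lemma continuous_on_sn [continuous_intros]:
  "continuous_on A g \<Longrightarrow> continuous_on A (\<lambda>x. sn k (g x))"
proof -
  have "continuous_on UNIV (sn k)"
    by (auto intro!: DERIV_continuous_on derivative_eq_intros)
  then show "continuous_on A g \<Longrightarrow> continuous_on A (\<lambda>x. sn k (g x))"
    by (rule continuous_on_compose2) auto
qed

lemma continuous_on_cs [continuous_intros]:
  "continuous_on A g \<Longrightarrow> continuous_on A (\<lambda>x. cs k (g x))"
proof -
  have "continuous_on UNIV (cs k)"
    by (auto intro!: DERIV_continuous_on derivative_eq_intros)
  then show "continuous_on A g \<Longrightarrow> continuous_on A (\<lambda>x. cs k (g x))"
    by (rule continuous_on_compose2) auto
qed

lemma cs_squared: "(cs k t)\<^sup>2 = 1 + k * (sn k t)\<^sup>2"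
proof -
  consider "k > 0" | "k < 0" | "k = 0" by linarith
  then show ?thesis
  proof cases
    case 1 then show ?thesis by (simp add: sn_def cs_def cosh_square_eq field_simps)
  next
    case 2 then show ?thesis by (simp add: sn_def cs_def cos_squared_eq field_simps)
  qed auto
qed

text \<open>The equation f'' = k f is invariant under scaling time by s and k by 1 / s^2, so up to
  the factor \<open>t\<close> in \<open>sn\<close> only the product k t^2 matters.\<close>

lemma sn_rescale: "t \<noteq> 0 \<Longrightarrow> sn (m / t\<^sup>2) t = t * sn m 1"
  and cs_rescale: "t \<noteq> 0 \<Longrightarrow> cs (m / t\<^sup>2) t = cs m 1"
proof -
  have pos: "sn (m / t\<^sup>2) t = t * sn m 1" "cs (m / t\<^sup>2) t = cs m 1" if "t > 0" for t
    using that by (auto simp: sn_def cs_def zero_less_divide_iff divide_less_0_iff real_sqrt_divide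
        simp flip: divide_minus_left)
  have odd: "sn k (- t) = - sn k t" "cs k (- t) = cs k t" for k by (simp_all add: sn_def cs_def)
  show "t \<noteq> 0 \<Longrightarrow> sn (m / t\<^sup>2) t = t * sn m 1" "t \<noteq> 0 \<Longrightarrow> cs (m / t\<^sup>2) t = cs m 1"
    using pos[of t] pos[of "- t"] odd by (cases "t > 0"; simp)+
qed

lemma sn_neg: "k < 0 \<Longrightarrow> sn k t = sin (sqrt (-k) * t) / sqrt (-k)"
  and cs_neg: "k < 0 \<Longrightarrow> cs k t = cos (sqrt (-k) * t)"
  by (auto simp: sn_def cs_def)

lemma before_half_period_iff:
  assumes "k < 0" "t \<ge> 0"
  shows "- pi\<^sup>2 \<le> k * t\<^sup>2 \<longleftrightarrow> sqrt (-k) * t \<le> pi" "- pi\<^sup>2 < k * t\<^sup>2 \<longleftrightarrow> sqrt (-k) * t < pi"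
proof -
  have *: "(sqrt (-k) * t)\<^sup>2 = - (k * t\<^sup>2)" using assms by (simp add: power_mult_distrib)
  have "sqrt (-k) * t \<le> pi \<longleftrightarrow> (sqrt (-k) * t)\<^sup>2 \<le> pi\<^sup>2"
    using assms by (intro power_mono_iff[symmetric]) auto
  with * show "- pi\<^sup>2 \<le> k * t\<^sup>2 \<longleftrightarrow> sqrt (-k) * t \<le> pi" by linarith
  have "sqrt (-k) * t < pi \<longleftrightarrow> (sqrt (-k) * t)\<^sup>2 < pi\<^sup>2"
    using assms power_mono_iff[of pi "sqrt (-k) * t" 2]
    by (simp add: not_le[symmetric] del: power_mono_iff)
  with * show "- pi\<^sup>2 < k * t\<^sup>2 \<longleftrightarrow> sqrt (-k) * t < pi" by linarith
qed

lemma sn_pos: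
  assumes "t > 0" "- pi\<^sup>2 < k * t\<^sup>2"
  shows "sn k t > 0"
proof -
  consider "k > 0" | "k < 0" | "k = 0" by linarith
  then show ?thesis
  proof cases
    case 2
    then have "sqrt (-k) * t < pi" using assms before_half_period_iff(2) by auto
    then show ?thesis using 2 assms by (auto simp: sn_neg intro!: divide_pos_pos sin_gt_zero)
  qed (use assms in \<open>auto simp: sn_def\<close>)
qed

lemma sn_nonneg:
  assumes "t \<ge> 0" "- pi\<^sup>2 \<le> k * t\<^sup>2"
  shows "sn k t \<ge> 0"
proof -
  consider "k > 0" | "k < 0" | "k = 0" by linarith
  then show ?thesis
  proof cases
    case 2
    then have "sqrt (-k) * t \<le> pi" using assms before_half_period_iff(1) by auto
    then show ?thesis using 2 assms by (auto simp: sn_neg intro!: divide_nonneg_pos sin_ge_zero)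
  qed (use assms in \<open>auto simp: sn_def\<close>)
qed

section \<open>Monotonicity of sin x / x and sinh x / x, and dependence of \<open>sn\<close> on its
  parameter\<close>

lemma x_cos_less_sin: "0 < x \<Longrightarrow> x < pi \<Longrightarrow> x * cos x < sin (x::real)"
proof -
  assume x: "0 < x" "x < pi"
  have "(\<lambda>x. sin x - x * cos x) 0 < (\<lambda>x. sin x - x * cos x) x"
  proof (rule DERIV_pos_imp_increasing_open[OF x(1)])
    show "\<exists>y. ((\<lambda>x. sin x - x * cos x) has_real_derivative y) (at t) \<and> 0 < y" if "0 < t" "t < x" for t
      by (rule exI[of _ "t * sin t"]) (use that x in \<open>auto intro!: derivative_eq_intros mult_pos_pos sin_gt_zero\<close>)
  qed (auto intro!: continuous_intros)
  then show ?thesis by simp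
qed

lemma sinh_less_x_cosh: "0 < x \<Longrightarrow> sinh x < x * cosh (x::real)"
proof -
  assume x: "0 < x"
  have "(\<lambda>x. x * cosh x - sinh x) 0 < (\<lambda>x. x * cosh x - sinh x) x"
  proof (rule DERIV_pos_imp_increasing_open[OF x(1)])
    show "\<exists>y. ((\<lambda>x. x * cosh x - sinh x) has_real_derivative y) (at t) \<and> 0 < y" if "0 < t" "t < x" for t
      by (rule exI[of _ "t * sinh t"]) (use that x in \<open>auto intro!: derivative_eq_intros\<close>)
  qed (auto intro!: continuous_intros)
  then show ?thesis by simp
qed

lemma sin_over_x_decreasing:
  assumes "0 < x" "x < y" "y \<le> pi"
  shows "sin y / y < sin x / (x::real)"
proof -
  have "(\<lambda>x. sin x / x) x > (\<lambda>x. sin x / x) y"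
  proof (rule DERIV_neg_imp_decreasing_open[OF assms(2)])
    show "\<exists>d. ((\<lambda>x. sin x / x) has_real_derivative d) (at t) \<and> d < 0" if "x < t" "t < y" for t
      by (rule exI[of _ "(cos t * t - sin t) / (t * t)"])
        (use that assms x_cos_less_sin[of t] in \<open>auto intro!: derivative_eq_intros divide_neg_pos simp: algebra_simps\<close>)
  qed (use assms in \<open>auto intro!: continuous_intros\<close>)
  then show ?thesis by simp
qed

lemma sinh_over_x_increasing:
  assumes "0 < x" "x < y"
  shows "sinh x / x < sinh y / (y::real)"
proof -
  have "(\<lambda>x. sinh x / x) x < (\<lambda>x. sinh x / x) y"
  proof (rule DERIV_pos_imp_increasing_open[OF assms(2)])
    show "\<exists>d. ((\<lambda>x. sinh x / x) has_real_derivative d) (at t) \<and> 0 < d" if "x < t" "t < y" for t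
      by (rule exI[of _ "(cosh t * t - sinh t) / (t * t)"])
        (use that assms sinh_less_x_cosh[of t] in \<open>auto intro!: derivative_eq_intros divide_pos_pos simp: algebra_simps\<close>)
  qed (use assms in \<open>auto intro!: continuous_intros\<close>)
  then show ?thesis by simp
qed

lemma sinh_gt_self: "0 < x \<Longrightarrow> x < sinh (x::real)"
proof -
  assume x: "0 < x"
  have "(\<lambda>x. sinh x - x) 0 < (\<lambda>x. sinh x - x) x"
  proof (rule DERIV_pos_imp_increasing_open[OF x(1)])
    show "\<exists>y. ((\<lambda>x. sinh x - x) has_real_derivative y) (at t) \<and> 0 < y" if "0 < t" "t < x" for t
      by (rule exI[of _ "cosh t - 1"]) (use that cosh_real_ge_1[of t] cosh_real_one_iff[of t] in
          \<open>auto intro!: derivative_eq_intros simp: less_le simp del: cosh_real_ge_1\<close>)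
  qed (auto intro!: continuous_intros)
  then show ?thesis by simp
qed

lemma sin_less_self: "0 < x \<Longrightarrow> x \<le> pi \<Longrightarrow> sin x < (x::real)"
proof -
  assume x: "0 < x" "x \<le> pi"
  have "(\<lambda>x. x - sin x) 0 < (\<lambda>x. x - sin x) x"
  proof (rule DERIV_pos_imp_increasing_open[OF x(1)])
    show "\<exists>y. ((\<lambda>x. x - sin x) has_real_derivative y) (at t) \<and> 0 < y" if "0 < t" "t < x" for t
      by (rule exI[of _ "1 - cos t"])
        (use that x cos_monotone_0_pi[of 0 t] in \<open>auto intro!: derivative_eq_intros\<close>)
  qed (auto intro!: continuous_intros)
  then show ?thesis by simp
qed

text \<open>With x = sqrt |m| the value is sin x / x, 1 or sinh x / x according to the sign of
  \<open>m\<close>, and these pieces join increasingly at 1. The lower bound on \<open>m\<close>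
  keeps x at most pi on the trigonometric side. This makes the arrival time at a given level
  strictly decreasing in \<open>m\<close>.\<close>

lemma sn_strict_mono_param:
  assumes "- pi\<^sup>2 \<le> m" "m < m'"
  shows "sn m 1 < sn m' 1"
proof -
  have "sqrt (-m) \<le> pi" using assms by (intro real_le_lsqrt) auto
  then have neg: "sn m 1 < 1" if "m < 0" using that sin_less_self[of "sqrt (-m)"] by (auto simp: sn_def)
  have pos: "1 < sn m' 1" if "m' > 0" using that sinh_gt_self[of "sqrt m'"] by (auto simp: sn_def)
  consider "m \<ge> 0" | "m < 0" "m' \<ge> 0" | "m' < 0" using assms by linarith
  then show ?thesis
  proof cases
    case 1
    show ?thesis
    proof (cases "m = 0")
      case True then show ?thesis using pos assms by auto
    next
      case False
      with 1 assms show ?thesis using sinh_over_x_increasing[of "sqrt m" "sqrt m'"] by (auto simp: sn_def)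
    qed
  next
    case 2
    then show ?thesis using neg pos by (cases "m' = 0") (auto intro: less_trans)
  next
    case 3
    have "sqrt (-m) \<le> pi" using assms by (intro real_le_lsqrt) auto
    then show ?thesis using 3 assms sin_over_x_decreasing[of "sqrt (-m')" "sqrt (-m)"]
      by (auto simp: sn_def)
  qed
qed

text \<open>Only m = 0 needs an argument: there sin h / h and sinh h / h tend to 1.\<close>

lemma continuous_on_sn_cs_param:
  "continuous_on UNIV (\<lambda>m. sn m 1)" "continuous_on UNIV (\<lambda>m. cs m 1)"
proof -
  have sq: "((\<lambda>m. sqrt m) \<longlongrightarrow> 0) (at_right 0)" "((\<lambda>m. sqrt (-m)) \<longlongrightarrow> 0) (at_left 0)"
    by (auto intro!: tendsto_eq_intros)
  have r: "filterlim (\<lambda>m. sqrt m) (at 0) (at_right 0)" "filterlim (\<lambda>m. sqrt (-m)) (at 0) (at_left 0)"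
    using sq by (auto simp: filterlim_at eventually_at_filter)
  have d: "(sinh has_real_derivative 1) (at 0)" "(sin has_real_derivative 1) (at 0)"
    by (auto intro!: derivative_eq_intros)
  have lim: "((\<lambda>h. sinh h / h) \<longlongrightarrow> 1) (at (0::real))" "((\<lambda>h. sin h / h) \<longlongrightarrow> 1) (at (0::real))"
    using d by (auto simp: DERIV_def)
  have ev: "eventually (\<lambda>m. P m) (at_left (0::real))" if "\<And>m. m < 0 \<Longrightarrow> P m" for P
    using that by (auto simp: eventually_at_filter)
  have ev': "eventually (\<lambda>m. P m) (at_right (0::real))" if "\<And>m. m > 0 \<Longrightarrow> P m" for P
    using that by (auto simp: eventually_at_filter)
  have "((\<lambda>m. sn m 1) \<longlongrightarrow> 1) (at_left 0)"
    by (rule Lim_transform_eventually[OF filterlim_compose[OF lim(2) r(2)] ev]) (auto simp: sn_def)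
  moreover have "((\<lambda>m. sn m 1) \<longlongrightarrow> 1) (at_right 0)"
    by (rule Lim_transform_eventually[OF filterlim_compose[OF lim(1) r(1)] ev']) (auto simp: sn_def)
  ultimately have sn0: "isCont (\<lambda>m. sn m 1) 0"
    by (auto simp: isCont_def filterlim_at_split)
  have "((\<lambda>m. cs m 1) \<longlongrightarrow> cos 0) (at_left 0)"
    by (rule Lim_transform_eventually[OF tendsto_cos[OF sq(2)] ev]) (auto simp: cs_def)
  moreover have "((\<lambda>m. cs m 1) \<longlongrightarrow> cosh 0) (at_right 0)"
    by (rule Lim_transform_eventually[OF tendsto_cosh[OF sq(1)] ev']) (auto simp: cs_def)
  ultimately have cs0: "isCont (\<lambda>m. cs m 1) 0"
    by (auto simp: isCont_def filterlim_at_split)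
  have "continuous_on {0<..} (\<lambda>m. sinh (sqrt m * 1) / sqrt m)"
    "continuous_on {0<..} (\<lambda>m. cosh (sqrt m * 1))"
    "continuous_on {..<0} (\<lambda>m. sin (sqrt (-m) * 1) / sqrt (-m))"
    "continuous_on {..<0} (\<lambda>m. cos (sqrt (-m) * 1))"
    by (auto intro!: continuous_intros)
  then have "continuous_on {0<..} (\<lambda>m. sn m 1)" "continuous_on {0<..} (\<lambda>m. cs m 1)"
    "continuous_on {..<0} (\<lambda>m. sn m 1)" "continuous_on {..<0} (\<lambda>m. cs m 1)"
    by (auto simp: sn_def cs_def cong: continuous_on_cong_simp)
  then have "isCont (\<lambda>m. sn m 1) m" "isCont (\<lambda>m. cs m 1) m" for m
    using sn0 cs0 by (cases m "0::real" rule: linorder_cases;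
      force simp: continuous_on_eq_continuous_at)+
  then show "continuous_on UNIV (\<lambda>m. sn m 1)" "continuous_on UNIV (\<lambda>m. cs m 1)"
    by (auto intro: continuous_at_imp_continuous_on)
qed

section \<open>Geodesics and calibrations in polar coordinates\<close>

text \<open>Geodesics are run with speed 2, i.e. \<open>t\<close> is half the arclength. \<open>theta c t\<close> is
  the continuous argument of \<open>z = exp (i c t) (cs - i c sn)\<close>, the position in the quotient, and
  \<open>gdom c t\<close> says that the geodesic has not passed its first return to the unit circle.\<close>

definition theta :: "real \<Rightarrow> real \<Rightarrow> real" where
  "theta c t = c * t - arccos (cs (1 - c\<^sup>2) t / sqrt (1 + (sn (1 - c\<^sup>2) t)\<^sup>2))"

definition gdom :: "real \<Rightarrow> real \<Rightarrow> bool" where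
  "gdom c t \<longleftrightarrow> 0 \<le> c \<and> 0 \<le> t \<and> - pi\<^sup>2 \<le> (1 - c\<^sup>2) * t\<^sup>2"

lemma cs_sn_sum: "(cs (1 - c\<^sup>2) t)\<^sup>2 + (c * sn (1 - c\<^sup>2) t)\<^sup>2 = 1 + (sn (1 - c\<^sup>2) t)\<^sup>2"
  by (simp add: cs_squared algebra_simps power_mult_distrib)

lemma cs_le_sqrt: "\<bar>cs (1 - c\<^sup>2) t\<bar> \<le> sqrt (1 + (sn (1 - c\<^sup>2) t)\<^sup>2)"
proof -
  have "(cs (1 - c\<^sup>2) t)\<^sup>2 \<le> 1 + (sn (1 - c\<^sup>2) t)\<^sup>2"
    using cs_sn_sum[of c t] zero_le_power2[of "c * sn (1 - c\<^sup>2) t"] by linarith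
  then show ?thesis by (intro real_le_rsqrt) simp
qed

lemma cs_ratio_bounds:
  "- 1 \<le> cs (1 - c\<^sup>2) t / sqrt (1 + (sn (1 - c\<^sup>2) t)\<^sup>2)" "cs (1 - c\<^sup>2) t / sqrt (1 + (sn (1 - c\<^sup>2) t)\<^sup>2) \<le> 1"
proof -
  have "0 < sqrt (1 + (sn (1 - c\<^sup>2) t)\<^sup>2)" by (simp add: add_pos_nonneg)
  with cs_le_sqrt[of c t] show
  "- 1 \<le> cs (1 - c\<^sup>2) t / sqrt (1 + (sn (1 - c\<^sup>2) t)\<^sup>2)" "cs (1 - c\<^sup>2) t / sqrt (1 + (sn (1 - c\<^sup>2) t)\<^sup>2) \<le> 1"
    by (auto simp: field_simps)
qed

lemma gdomD: "gdom c t \<Longrightarrow> 0 \<le> c" "gdom c t \<Longrightarrow> 0 \<le> t"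
  "gdom c t \<Longrightarrow> 0 \<le> sn (1 - c\<^sup>2) t"
  by (auto simp: gdom_def sn_nonneg)

lemma gdom_less:
  assumes "gdom c b" "0 \<le> a" "a < b"
  shows "gdom c a" "- pi\<^sup>2 < (1 - c\<^sup>2) * a\<^sup>2"
proof -
  show "- pi\<^sup>2 < (1 - c\<^sup>2) * a\<^sup>2"
  proof (cases "1 - c\<^sup>2 < 0")
    case True
    have "a\<^sup>2 < b\<^sup>2" using assms by (intro power_strict_mono) auto
    then have "(1 - c\<^sup>2) * b\<^sup>2 < (1 - c\<^sup>2) * a\<^sup>2" using True by simp
    then show ?thesis using assms by (auto simp: gdom_def)
  next
    case False
    then have "0 \<le> (1 - c\<^sup>2) * a\<^sup>2" by simp
    moreover have "- pi\<^sup>2 < 0" by simp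
    ultimately show ?thesis by linarith
  qed
  then show "gdom c a" using assms by (auto simp: gdom_def)
qed

lemma gdom_le: "gdom c b \<Longrightarrow> 0 \<le> a \<Longrightarrow> a \<le> b \<Longrightarrow> gdom c a"
  using gdom_less(1) by (cases "a = b") auto

lemma gdom_sn_pos: "gdom c b \<Longrightarrow> 0 < a \<Longrightarrow> a < b \<Longrightarrow> 0 < sn (1 - c\<^sup>2) a"
  using gdom_less sn_pos by auto

lemma theta_0 [simp]: "theta c 0 = 0"
  by (simp add: theta_def)

lemma theta_zero [simp]: "theta 0 t = 0"
proof -
  have "cs 1 t = sqrt (1 + (sn 1 t)\<^sup>2)"
    using cs_squared[of 1 t] by (intro real_sqrt_unique[symmetric]) (auto simp: cs_def)
  moreover have "1 + (sn 1 t)\<^sup>2 > 0" by (simp add: add_pos_nonneg)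
  ultimately show ?thesis by (simp add: theta_def)
qed

lemma continuous_on_theta: "continuous_on A (theta c)"
proof -
  have "sqrt (1 + (sn (1 - c\<^sup>2) x)\<^sup>2) \<noteq> 0" for x
    by (metis add_pos_nonneg less_irrefl real_sqrt_gt_zero zero_le_power2 zero_less_one)
  then show ?thesis unfolding theta_def[abs_def] using cs_ratio_bounds[of c]
    by (intro continuous_intros) auto
qed

text \<open>Clairaut's relation: (|z|^2 / |w|^2) times the angular velocity is the conserved
  momentum \<open>c\<close>. The case c = 0 is separate because \<open>arccos\<close> is then
  evaluated at 1, where it is not differentiable.\<close>

lemma DERIV_theta:
  assumes "c \<ge> 0" "sn (1 - c\<^sup>2) t > 0"
  shows "(theta c has_real_derivative c * (sn (1 - c\<^sup>2) t)\<^sup>2 / (1 + (sn (1 - c\<^sup>2) t)\<^sup>2)) (at t)"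
proof (cases "c = 0")
  case True
  have "theta 0 = (\<lambda>_. 0)" by auto
  with True show ?thesis by simp
next
  case False
  then have c: "c > 0" using assms by simp
  define k where "k = 1 - c\<^sup>2"
  define S where "S = sn k t"
  define C where "C = cs k t"
  define N where "N = sqrt (1 + S\<^sup>2)"
  have S: "S > 0" using assms by (simp add: S_def k_def)
  have N2: "N\<^sup>2 = 1 + S\<^sup>2" by (simp add: N_def add_nonneg_nonneg)
  have N: "N > 0" by (simp add: N_def add_pos_nonneg)
  have sum: "C\<^sup>2 + (c * S)\<^sup>2 = N\<^sup>2" unfolding N2 C_def S_def k_def by (rule cs_sn_sum)
  have lt: "\<bar>C\<bar> < N"
  proof -
    have "0 < (c * S)\<^sup>2" using c S by simp
    then have "C\<^sup>2 < N\<^sup>2" using sum by linarith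
    then show ?thesis using N by (metis abs_of_pos power2_less_imp_less power2_abs less_imp_le)
  qed
  have r: "- 1 < C / N" "C / N < 1" using lt N by (auto simp: field_simps)
  have "1 - (C / N)\<^sup>2 = (c * S / N)\<^sup>2"
    using sum N by (simp add: power_divide field_simps)
  then have sq: "sqrt (1 - (C / N)\<^sup>2) = c * S / N" using c S N by simp
  have dN: "((\<lambda>t. sqrt (1 + (sn k t)\<^sup>2)) has_real_derivative (S * C / N)) (at t)"
    using N2 N unfolding N_def S_def C_def
    by (auto intro!: derivative_eq_intros simp: field_simps)
  have dr: "((\<lambda>t. cs k t / sqrt (1 + (sn k t)\<^sup>2)) has_real_derivative
     ((k * S) * N - C * (S * C / N)) / (N * N)) (at t)"
    using DERIV_divide[OF DERIV_cs[OF DERIV_ident, of k] dN] N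
    by (simp add: S_def C_def N_def)
  have "((\<lambda>t. arccos (cs k t / sqrt (1 + (sn k t)\<^sup>2))) has_real_derivative
     inverse (- sqrt (1 - (C / N)\<^sup>2)) * (((k * S) * N - C * (S * C / N)) / (N * N))) (at t)"
    using DERIV_chain2[OF _ dr, of arccos "inverse (- sqrt (1 - (C / N)\<^sup>2))"] DERIV_arccos[OF r]
    by (simp add: C_def N_def S_def)
  moreover have "inverse (- sqrt (1 - (C / N)\<^sup>2)) * (((k * S) * N - C * (S * C / N)) / (N * N)) = c / N\<^sup>2"
  proof -
    have C2: "C\<^sup>2 = N\<^sup>2 - (c * S)\<^sup>2" using sum by simp
    have num: "k * S * N - C * (S * C / N) = - c\<^sup>2 * S / N"
    proof -
      have "(k * S * N - C * (S * C / N)) * N = S * (k * N\<^sup>2 - C\<^sup>2)"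
        using N by (simp add: field_simps power2_eq_square)
      also have "\<dots> = S * (k * N\<^sup>2 - N\<^sup>2 + (c * S)\<^sup>2)" unfolding C2 by simp
      also have "\<dots> = - c\<^sup>2 * S" unfolding N2 k_def by (simp add: algebra_simps power2_eq_square)
      finally show ?thesis using N by (simp add: field_simps)
    qed
    show ?thesis unfolding num sq using c S N by (simp add: field_simps power2_eq_square)
  qed
  ultimately have "((\<lambda>t. arccos (cs k t / sqrt (1 + (sn k t)\<^sup>2))) has_real_derivative c / N\<^sup>2) (at t)"
    by simp
  then have "((\<lambda>t. c * t - arccos (cs k t / sqrt (1 + (sn k t)\<^sup>2))) has_real_derivative c - c / N\<^sup>2) (at t)"
    by (intro DERIV_diff DERIV_cmult_Id)
  moreover have "c - c / N\<^sup>2 = c * S\<^sup>2 / (1 + S\<^sup>2)"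
    using N by (simp add: N2[symmetric] field_simps) (simp add: N2 algebra_simps)
  ultimately show ?thesis by (simp add: theta_def[abs_def] k_def S_def)
qed

lemma theta_strict_mono:
  assumes "gdom c b" "c > 0" "0 \<le> a" "a < b"
  shows "theta c a < theta c b"
proof (rule DERIV_pos_imp_increasing_open[OF assms(4)])
  fix x assume x: "a < x" "x < b"
  then have s: "sn (1 - c\<^sup>2) x > 0" using assms by (intro gdom_sn_pos) auto
  then show "\<exists>y. (theta c has_real_derivative y) (at x) \<and> 0 < y"
    using DERIV_theta[of c x] assms
    by (intro exI[of _ "c * (sn (1 - c\<^sup>2) x)\<^sup>2 / (1 + (sn (1 - c\<^sup>2) x)\<^sup>2)"])
      (auto intro!: divide_pos_pos mult_pos_pos add_pos_nonneg)
qed (rule continuous_on_theta)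

lemma theta_nonneg: "gdom c t \<Longrightarrow> 0 \<le> theta c t"
  using theta_strict_mono[of c t 0] by (cases "c = 0"; cases "t = 0") (auto simp: gdom_def)

lemma theta_pos: "gdom c t \<Longrightarrow> 0 < c \<Longrightarrow> 0 < t \<Longrightarrow> 0 < theta c t"
  using theta_strict_mono[of c t 0] by auto

text \<open>On \<open>gdom\<close> the value of \<open>sn\<close> is nonnegative, so cs - i c sn
  lies in the closed lower half plane and its argument is minus the \<open>arccos\<close> occurring
  in \<open>theta\<close>.\<close>

lemma polar_form:
  assumes "gdom c t"
  shows "cis (c * t) * (complex_of_real (cs (1 - c\<^sup>2) t) - \<i> * complex_of_real (c * sn (1 - c\<^sup>2) t)) =
    complex_of_real (sqrt (1 + (sn (1 - c\<^sup>2) t)\<^sup>2)) * cis (theta c t)"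
proof -
  define S where "S = sn (1 - c\<^sup>2) t"
  define C where "C = cs (1 - c\<^sup>2) t"
  define N where "N = sqrt (1 + S\<^sup>2)"
  have N2: "N\<^sup>2 = 1 + S\<^sup>2" by (simp add: N_def add_nonneg_nonneg)
  have N: "N > 0" by (simp add: N_def add_pos_nonneg)
  have sum: "C\<^sup>2 + (c * S)\<^sup>2 = N\<^sup>2" unfolding N2 C_def S_def by (rule cs_sn_sum)
  have cS: "c * S \<ge> 0" using gdomD[OF assms] by (simp add: S_def)
  have b: "- 1 \<le> C / N" "C / N \<le> 1" using cs_ratio_bounds[of c t] by (auto simp: C_def N_def S_def)
  define a where "a = arccos (C / N)"
  have "cos a = C / N" unfolding a_def using b by simp
  moreover have "sin a = c * S / N"
  proof -
    have "1 - (C / N)\<^sup>2 = (c * S / N)\<^sup>2" using sum N by (simp add: power_divide field_simps)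
    then show ?thesis unfolding a_def using b cS N by (simp add: sin_arccos)
  qed
  ultimately have "complex_of_real C - \<i> * complex_of_real (c * S) = complex_of_real N * cis (- a)"
    using N by (simp add: complex_eq_iff)
  then have "cis (c * t) * (complex_of_real C - \<i> * complex_of_real (c * S)) = complex_of_real N * cis (c * t - a)"
    by (simp add: cis_mult mult.left_commute)
  then show ?thesis by (simp add: theta_def a_def C_def N_def S_def)
qed

text \<open>The radicand is negative, and \<open>sqrt\<close> then too, unless \<open>(p\<^sup>2 - 1) x\<^sup>2 \<le> 1\<close>; this
  condition accompanies every use of \<open>prim\<close>.\<close>

definition slope :: "real \<Rightarrow> real \<Rightarrow> real" where
  "slope p x = sqrt (1 + (1 - p\<^sup>2) * x\<^sup>2) / (1 + x\<^sup>2)"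

definition prim :: "real \<Rightarrow> real \<Rightarrow> real" where
  "prim p = (SOME F. F 0 = 0 \<and> (\<forall>x. (F has_real_derivative slope p x) (at x)))"

text \<open>The total function \<open>sqrt\<close> is continuous, so \<open>slope p\<close> is
  continuous on the whole line and has a primitive even across the turning radius.\<close>

lemma prim_props: "prim p 0 = 0 \<and> (\<forall>x. (prim p has_real_derivative slope p x) (at x))"
proof -
  have nz: "1 + x\<^sup>2 \<noteq> (0::real)" for x by (metis add_pos_nonneg less_irrefl zero_le_power2 zero_less_one)
  have "isCont (slope p) x" for x unfolding slope_def using nz by (intro continuous_intros) auto
  then obtain F where F: "\<And>x. (F has_vector_derivative slope p x) (at x)"
    using einterval_antiderivative[of "-\<infinity>" \<infinity> "slope p"] by auto
  then have "(\<lambda>x. F x - F 0) 0 = 0 \<and> (\<forall>x. ((\<lambda>x. F x - F 0) has_real_derivative slope p x) (at x))"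
    by (auto intro!: derivative_eq_intros simp: has_real_derivative_iff_has_vector_derivative)
  then show ?thesis unfolding prim_def by (rule someI[where P = "\<lambda>F. F 0 = 0 \<and> (\<forall>x. (F has_real_derivative slope p x) (at x))"])
qed

lemma prim_0 [simp]: "prim p 0 = 0" using prim_props by blast

lemma DERIV_prim: "(prim p has_real_derivative slope p x) (at x)" using prim_props by blast

lemma continuous_on_prim: "continuous_on A (prim p)"
  using DERIV_prim by (meson DERIV_isCont continuous_at_imp_continuous_on)

lemma slope_nonneg:
  assumes "(p\<^sup>2 - 1) * x\<^sup>2 \<le> 1"
  shows "0 \<le> slope p x"
proof -
  have "(1 - p\<^sup>2) * x\<^sup>2 = - ((p\<^sup>2 - 1) * x\<^sup>2)" by algebra
  then show ?thesis using assms unfolding slope_def by (intro divide_nonneg_nonneg) auto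
qed

lemma admissible_mono:
  fixes x y p :: real
  assumes "0 \<le> x" "x \<le> y" "(p\<^sup>2 - 1) * y\<^sup>2 \<le> 1"
  shows "(p\<^sup>2 - 1) * x\<^sup>2 \<le> 1"
proof (cases "p\<^sup>2 \<ge> 1")
  case True
  then have "(p\<^sup>2 - 1) * x\<^sup>2 \<le> (p\<^sup>2 - 1) * y\<^sup>2" using assms by (intro mult_left_mono power_mono) auto
  then show ?thesis using assms by linarith
next
  case False
  then have "(p\<^sup>2 - 1) * x\<^sup>2 \<le> 0" by (intro mult_nonpos_nonneg) auto
  then show ?thesis by linarith
qed

lemma prim_mono:
  assumes "0 \<le> x" "x \<le> y" "(p\<^sup>2 - 1) * y\<^sup>2 \<le> 1"
  shows "prim p x \<le> prim p y"
proof (rule DERIV_nonneg_imp_nondecreasing[OF assms(2)])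
  fix t assume t: "x \<le> t" "t \<le> y"
  then have "(p\<^sup>2 - 1) * t\<^sup>2 \<le> 1" using assms by (intro admissible_mono[of t y]) auto
  then show "\<exists>y. (prim p has_real_derivative y) (at t) \<and> 0 \<le> y"
    using DERIV_prim slope_nonneg by blast
qed

lemma prim_nonneg: "0 \<le> x \<Longrightarrow> (p\<^sup>2 - 1) * x\<^sup>2 \<le> 1 \<Longrightarrow> 0 \<le> prim p x"
  using prim_mono[of 0 x p] by simp

lemma DERIV_calibration:
  assumes "c \<ge> 0" "sn (1 - c\<^sup>2) t > 0"
  shows "((\<lambda>t. t - p * theta c t + s * prim p (sn (1 - c\<^sup>2) t)) has_real_derivative
     1 - p * (c * (sn (1 - c\<^sup>2) t)\<^sup>2 / (1 + (sn (1 - c\<^sup>2) t)\<^sup>2))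
       + s * (slope p (sn (1 - c\<^sup>2) t) * cs (1 - c\<^sup>2) t)) (at t)"
  using DERIV_theta[OF assms] DERIV_chain2[where f = "prim p", OF DERIV_prim DERIV_sn[OF DERIV_ident]]
  by (auto intro!: derivative_eq_intros)

text \<open>Write S = sn, C = cs and q for the root in \<open>slope p S\<close>. The vectors (p S, s
  q) and (c S, -C) both have squared length 1 + S^2, and the derivative times 1 + S^2 is half the
  squared distance between them.\<close>

lemma calibration_mono:
  assumes "gdom c b" "0 \<le> a" "a \<le> b" "s\<^sup>2 = 1"
    and "\<And>t. a \<le> t \<Longrightarrow> t \<le> b \<Longrightarrow> (p\<^sup>2 - 1) * (sn (1 - c\<^sup>2) t)\<^sup>2 \<le> 1"
  shows "a - p * theta c a + s * prim p (sn (1 - c\<^sup>2) a) \<le> b - p * theta c b + s * prim p (sn (1 - c\<^sup>2) b)"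
proof (rule DERIV_nonneg_imp_increasing_open[OF assms(3)])
  fix t assume t: "a < t" "t < b"
  then have s: "sn (1 - c\<^sup>2) t > 0" using assms by (intro gdom_sn_pos) auto
  define S where "S = sn (1 - c\<^sup>2) t"
  define C where "C = cs (1 - c\<^sup>2) t"
  define q where "q = sqrt (1 + (1 - p\<^sup>2) * S\<^sup>2)"
  have "(1 - p\<^sup>2) * S\<^sup>2 = - ((p\<^sup>2 - 1) * S\<^sup>2)" by algebra
  then have "1 + (1 - p\<^sup>2) * S\<^sup>2 \<ge> 0" using assms(5)[of t] t by (simp add: S_def)
  then have q2: "q\<^sup>2 = 1 + (1 - p\<^sup>2) * S\<^sup>2" by (simp add: q_def)
  have N: "1 + S\<^sup>2 > 0" by (simp add: add_pos_nonneg)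
  have sum: "C\<^sup>2 + (c * S)\<^sup>2 = 1 + S\<^sup>2" unfolding C_def S_def by (rule cs_sn_sum)
  have "0 \<le> (p * S - c * S)\<^sup>2 + (s * q + C)\<^sup>2" by simp
  also have "\<dots> = p\<^sup>2 * S\<^sup>2 + s\<^sup>2 * q\<^sup>2 + (C\<^sup>2 + (c * S)\<^sup>2) - 2 * (p * c * S\<^sup>2) + 2 * (s * q * C)"
    by (simp add: algebra_simps power2_eq_square)
  also have "\<dots> = 2 * (1 + S\<^sup>2 - p * c * S\<^sup>2 + s * q * C)"
    unfolding sum q2 assms(4) by (simp add: algebra_simps)
  finally have "0 \<le> (1 + S\<^sup>2 - p * c * S\<^sup>2 + s * q * C) / (1 + S\<^sup>2)" using N by simp
  also have "\<dots> = 1 - p * (c * S\<^sup>2 / (1 + S\<^sup>2)) + s * (slope p S * C)"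
    using N unfolding slope_def q_def[symmetric] by (simp add: add_divide_distrib diff_divide_distrib)
  finally show "\<exists>y. ((\<lambda>t. t - p * theta c t + s * prim p (sn (1 - c\<^sup>2) t)) has_real_derivative y) (at t) \<and> 0 \<le> y"
    using DERIV_calibration[OF gdomD(1)[OF assms(1)] s, of p s] unfolding S_def C_def by blast
next
  show "continuous_on {a..b} (\<lambda>t. t - p * theta c t + s * prim p (sn (1 - c\<^sup>2) t))"
    by (intro continuous_intros continuous_on_theta continuous_on_compose2[OF continuous_on_prim[of UNIV]]) auto
qed

text \<open>For p = c and s = -1 the two vectors behind \<open>calibration_mono\<close> coincide as
  long as \<open>cs\<close> is nonnegative, since the root in \<open>slope c\<close> is then
  \<open>cs\<close> itself. This stops at the turning point.\<close>

lemma calibration_exact: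
  assumes "gdom c b" "\<And>t. 0 \<le> t \<Longrightarrow> t \<le> b \<Longrightarrow> 0 \<le> cs (1 - c\<^sup>2) t"
  shows "b = c * theta c b + prim c (sn (1 - c\<^sup>2) b)"
proof (cases "b = 0")
  case False
  then have "0 < b" using gdomD[OF assms(1)] by simp
  then have "b - c * theta c b + (-1) * prim c (sn (1 - c\<^sup>2) b) = 0 - c * theta c 0 + (-1) * prim c (sn (1 - c\<^sup>2) 0)"
  proof (rule DERIV_isconst_end)
    show "continuous_on {0..b} (\<lambda>t. t - c * theta c t + (-1) * prim c (sn (1 - c\<^sup>2) t))"
      by (intro continuous_intros continuous_on_theta continuous_on_compose2[OF continuous_on_prim[of UNIV]]) auto
    fix t assume t: "0 < t" "t < b"
    then have s: "sn (1 - c\<^sup>2) t > 0" using assms by (intro gdom_sn_pos) auto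
    define S where "S = sn (1 - c\<^sup>2) t"
    define C where "C = cs (1 - c\<^sup>2) t"
    have C: "0 \<le> C" using assms(2)[of t] t by (simp add: C_def)
    have q: "sqrt (1 + (1 - c\<^sup>2) * S\<^sup>2) = C"
      using C cs_squared[of "1 - c\<^sup>2" t] by (intro real_sqrt_unique) (auto simp: C_def S_def)
    have N: "1 + S\<^sup>2 > 0" by (simp add: add_pos_nonneg)
    have sum: "C\<^sup>2 + (c * S)\<^sup>2 = 1 + S\<^sup>2" unfolding C_def S_def by (rule cs_sn_sum)
    have "1 - c * (c * S\<^sup>2 / (1 + S\<^sup>2)) + (-1) * (slope c S * C) = (1 + S\<^sup>2 - (C\<^sup>2 + (c * S)\<^sup>2)) / (1 + S\<^sup>2)"
      using N unfolding slope_def q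
      by (simp add: add_divide_distrib diff_divide_distrib power2_eq_square mult_ac)
    also have "\<dots> = 0" using sum by simp
    finally show "((\<lambda>t. t - c * theta c t + (-1) * prim c (sn (1 - c\<^sup>2) t)) has_real_derivative 0) (at t)"
      using DERIV_calibration[OF gdomD(1)[OF assms(1)] s, of c "-1"] unfolding S_def C_def by simp
  qed
  then show ?thesis by simp
qed auto

section \<open>Geodesics with c > 1 and their first return to the unit circle\<close>

definition ret :: "real \<Rightarrow> real" where
  "ret c = pi / sqrt (c\<^sup>2 - 1)"

context
  fixes c :: real
  assumes c1: "1 < c"
begin

lemma omega_pos: "0 < sqrt (c\<^sup>2 - 1)"
  using c1 by (simp add: power2_eq_square less_1_mult)

lemma sn_cs_trig:
  "sn (1 - c\<^sup>2) t = sin (sqrt (c\<^sup>2 - 1) * t) / sqrt (c\<^sup>2 - 1)"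
  "cs (1 - c\<^sup>2) t = cos (sqrt (c\<^sup>2 - 1) * t)"
proof -
  have "1 - c\<^sup>2 < 0" using omega_pos by simp
  then show "sn (1 - c\<^sup>2) t = sin (sqrt (c\<^sup>2 - 1) * t) / sqrt (c\<^sup>2 - 1)"
  "cs (1 - c\<^sup>2) t = cos (sqrt (c\<^sup>2 - 1) * t)"
    by (simp_all add: sn_neg cs_neg)
qed

lemma ret_pos: "0 < ret c" and omega_ret: "sqrt (c\<^sup>2 - 1) * ret c = pi"
  using omega_pos by (auto simp: ret_def)

lemma gdom_iff: "gdom c t \<longleftrightarrow> 0 \<le> t \<and> t \<le> ret c"
proof -
  have "1 - c\<^sup>2 < 0" using omega_pos by simp
  then have "gdom c t \<longleftrightarrow> 0 \<le> t \<and> sqrt (c\<^sup>2 - 1) * t \<le> pi"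
    using c1 before_half_period_iff(1)[of "1 - c\<^sup>2" t] by (auto simp: gdom_def)
  then show ?thesis using omega_pos by (auto simp: ret_def field_simps)
qed

lemma sn_ret: "sn (1 - c\<^sup>2) (ret c) = 0" and cs_ret: "cs (1 - c\<^sup>2) (ret c) = -1"
  by (simp_all add: sn_cs_trig omega_ret)

lemma theta_ret: "theta c (ret c) = pi * (c / sqrt (c\<^sup>2 - 1) - 1)"
  by (simp add: theta_def sn_ret cs_ret) (simp add: ret_def algebra_simps)

lemma sn_le: "sn (1 - c\<^sup>2) t \<le> 1 / sqrt (c\<^sup>2 - 1)"
  using omega_pos by (simp add: sn_cs_trig divide_right_mono)

lemma sn_antimono:
  assumes "ret c / 2 \<le> s" "s \<le> t" "t \<le> ret c"
  shows "sn (1 - c\<^sup>2) t \<le> sn (1 - c\<^sup>2) s"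
proof -
  let ?w = "sqrt (c\<^sup>2 - 1)"
  have "?w * t \<le> ?w * ret c" "?w * s \<le> ?w * t" "?w * (ret c / 2) \<le> ?w * s"
    using assms omega_pos by (intro mult_left_mono; simp)+
  moreover have "?w * (ret c / 2) = pi / 2" using omega_ret by simp
  ultimately have b: "?w * t \<le> pi" "?w * s \<le> ?w * t" "pi / 2 \<le> ?w * s" using omega_ret by simp_all
  have "sin (pi - ?w * t) \<le> sin (pi - ?w * s)"
    by (rule sin_monotone_2pi_le) (use b in auto)
  then show ?thesis using omega_pos by (simp add: sn_cs_trig divide_right_mono)
qed

lemma cs_nonneg_half:
  assumes "0 \<le> t" "t \<le> ret c / 2"
  shows "0 \<le> cs (1 - c\<^sup>2) t"
proof -
  let ?w = "sqrt (c\<^sup>2 - 1)"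
  have "?w * t \<le> ?w * (ret c / 2)" using assms omega_pos by (intro mult_left_mono) auto
  moreover have "?w * (ret c / 2) = pi / 2" using omega_ret by simp
  moreover have "0 \<le> ?w * t" using assms omega_pos by simp
  ultimately show ?thesis by (auto simp: sn_cs_trig intro!: cos_ge_zero)
qed

text \<open>At half the return time the geodesic is at its turning radius, \<open>cs\<close>
  vanishes and the \<open>arccos\<close> in \<open>theta\<close> is pi / 2. There
  \<open>calibration_exact\<close> is a linear equation for the value of
  \<open>prim\<close>.\<close>

lemma prim_turn: "2 * prim c (1 / sqrt (c\<^sup>2 - 1)) = pi * (c - sqrt (c\<^sup>2 - 1))"
proof -
  let ?w = "sqrt (c\<^sup>2 - 1)"
  have w: "?w * (ret c / 2) = pi / 2" using omega_ret by simp
  have "gdom c (ret c / 2)" using ret_pos by (simp add: gdom_iff)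
  then have "ret c / 2 = c * theta c (ret c / 2) + prim c (sn (1 - c\<^sup>2) (ret c / 2))"
    by (rule calibration_exact) (rule cs_nonneg_half)
  moreover have "sn (1 - c\<^sup>2) (ret c / 2) = 1 / ?w" "cs (1 - c\<^sup>2) (ret c / 2) = 0"
    unfolding sn_cs_trig w by auto
  moreover from this have "theta c (ret c / 2) = c * ret c / 2 - pi / 2" by (simp add: theta_def)
  ultimately have "2 * prim c (1 / ?w) = ret c - c * (c * ret c - pi)" by (simp add: algebra_simps)
  also have "\<dots> = pi * c - (c\<^sup>2 - 1) * ret c" by (simp add: algebra_simps power2_eq_square)
  also have "(c\<^sup>2 - 1) * ret c = ?w * (?w * ret c)" using omega_pos
    by (metis less_imp_le mult.assoc real_sqrt_gt_0_iff real_sqrt_mult_self abs_of_pos)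
  finally show ?thesis unfolding omega_ret by (simp add: algebra_simps)
qed

text \<open>Elimination of \<open>c\<close>: with w = sqrt (c^2 - 1) one has pi + theta = pi c / w,
  and c^2 - w^2 = 1. In this form the return time is visibly increasing in the return angle.\<close>

lemma ret_eq: "ret c = sqrt ((pi + theta c (ret c))\<^sup>2 - pi\<^sup>2)"
proof -
  have "(pi + theta c (ret c))\<^sup>2 - pi\<^sup>2 = (pi * c / sqrt (c\<^sup>2 - 1))\<^sup>2 - pi\<^sup>2"
    by (simp add: theta_ret algebra_simps)
  also have "\<dots> = (ret c)\<^sup>2" using omega_pos
    by (simp add: ret_def power_divide power_mult_distrib field_simps)
  finally show ?thesis using ret_pos by simp
qed

text \<open>The right hand side is a lower bound for the duration of loops that just reach the turning radius
  of the geodesic \<open>p\<close>; by the reverse Cauchy-Schwarz inequality it is least at \<open>p = c\<close>.\<close>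

lemma ret_le:
  assumes "1 < p"
  shows "ret c \<le> p * theta c (ret c) + pi * (p - sqrt (p\<^sup>2 - 1))"
proof -
  let ?w = "sqrt (c\<^sup>2 - 1)" and ?v = "sqrt (p\<^sup>2 - 1)"
  have v: "?v > 0" using assms by (simp add: power2_eq_square less_1_mult)
  have v2: "?v\<^sup>2 = p\<^sup>2 - 1" and w2: "?w\<^sup>2 = c\<^sup>2 - 1" using v omega_pos by (auto simp: less_imp_le)
  have "(1 + ?v * ?w)\<^sup>2 \<le> (p * c)\<^sup>2"
  proof -
    have "(p * c)\<^sup>2 = (1 + ?v\<^sup>2) * (1 + ?w\<^sup>2)" unfolding v2 w2 by (simp add: power_mult_distrib)
    also have "\<dots> = (1 + ?v * ?w)\<^sup>2 + (?v - ?w)\<^sup>2" by (simp add: algebra_simps power2_eq_square)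
    finally show ?thesis by simp
  qed
  then have "1 + ?v * ?w \<le> p * c" by (rule power2_le_imp_le) (use assms c1 in auto)
  then have "(1 + ?v * ?w) / ?w \<le> p * c / ?w" using omega_pos by (intro divide_right_mono) auto
  moreover have "(1 + ?v * ?w) / ?w = 1 / ?w + ?v" using omega_pos by (simp add: add_divide_distrib)
  ultimately have "1 / ?w \<le> p * c / ?w - ?v" by simp
  then have "pi * (1 / ?w) \<le> pi * (p * c / ?w - ?v)" by (intro mult_left_mono) auto
  then show ?thesis unfolding theta_ret by (simp add: ret_def algebra_simps)
qed

text \<open>\<open>calibration_mono\<close> with s = 1 on the remaining arc compares
  \<open>t\<close> with the return, where \<open>prim\<close> vanishes and \<open>ret_le\<close>
  applies. By \<open>prim_turn\<close> the right hand side is the lower bound for a competitor whose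
  maximal |w| is the turning radius of \<open>p\<close>.\<close>

lemma closing_up:
  assumes "1 < p" "0 \<le> t" "t \<le> ret c"
    and "\<And>s. t \<le> s \<Longrightarrow> s \<le> ret c \<Longrightarrow> (p\<^sup>2 - 1) * (sn (1 - c\<^sup>2) s)\<^sup>2 \<le> 1"
  shows "t \<le> p * theta c t + pi * (p - sqrt (p\<^sup>2 - 1)) - prim p (sn (1 - c\<^sup>2) t)"
proof -
  have "t - p * theta c t + 1 * prim p (sn (1 - c\<^sup>2) t) \<le> ret c - p * theta c (ret c) + 1 * prim p (sn (1 - c\<^sup>2) (ret c))"
    by (rule calibration_mono) (use assms ret_pos in \<open>auto simp: gdom_iff\<close>)
  with ret_le[OF assms(1)] show ?thesis by (simp add: sn_ret)
qed

end

lemma exists_closed_geodesic: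
  assumes "0 < \<psi>"
  obtains c where "1 < c" "theta c (ret c) = \<psi>"
proof -
  \<comment> \<open>By \<open>theta_ret\<close> the goal is c / w = h with w = sqrt (c^2 - 1).
    Together with c^2 - w^2 = 1 this gives w = 1 / sqrt (h^2 - 1) and c = h w.\<close>
  define h where "h = 1 + \<psi> / pi"
  define w where "w = 1 / sqrt (h\<^sup>2 - 1)"
  have h: "h > 1" using assms by (simp add: h_def)
  then have h2: "h\<^sup>2 - 1 > 0" by (simp add: power2_eq_square less_1_mult)
  then have w: "w > 0" by (simp add: w_def)
  have w2: "w\<^sup>2 = 1 / (h\<^sup>2 - 1)" using h2 by (simp add: w_def power_divide)
  have "(h * w)\<^sup>2 - 1 = w\<^sup>2" using h2 unfolding power_mult_distrib w2 by (simp add: field_simps)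
  then have s: "sqrt ((h * w)\<^sup>2 - 1) = w" using w by simp
  have "(h * w)\<^sup>2 > 1\<^sup>2" using \<open>(h * w)\<^sup>2 - 1 = w\<^sup>2\<close> w by (simp add: algebra_simps)
  then have c: "1 < h * w" by (rule power2_less_imp_less) (use h w in auto)
  have "theta (h * w) (ret (h * w)) = pi * (h - 1)" using w by (simp add: theta_ret[OF c] s)
  also have "\<dots> = \<psi>" by (simp add: h_def)
  finally show ?thesis using that c by blast
qed

section \<open>Geodesics with prescribed endpoint\<close>

text \<open>The geodesics arriving at a fixed level \<open>\<bar>w\<bar> = r\<close> are parametrized by
  \<open>m = (1 - c\<^sup>2) t\<^sup>2\<close>, on which everything depends continuously, also through \<open>c = 1\<close> and
  through the turning point.\<close>

definition level_time :: "real \<Rightarrow> real \<Rightarrow> real" where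
  "level_time r m = r / sn m 1"

text \<open>This is \<open>theta\<close> with \<open>c\<close> eliminated, since (c t)^2 = t^2 - m
  and the rescaled cosine is \<open>cs m 1\<close>. The condition m <= t^2 attached to its uses says
  that \<open>c\<close> is real.\<close>

definition level_angle :: "real \<Rightarrow> real \<Rightarrow> real" where
  "level_angle r m = sqrt ((level_time r m)\<^sup>2 - m) - arccos (cs m 1 / sqrt (1 + r\<^sup>2))"

lemma sn1_pos: "- pi\<^sup>2 < m \<Longrightarrow> 0 < sn m 1"
  using sn_pos[of 1 m] by simp

lemma level_time_pos: "0 < r \<Longrightarrow> - pi\<^sup>2 < m \<Longrightarrow> 0 < level_time r m"
  by (simp add: level_time_def sn1_pos)

lemma level_time_strict_antimono:
  assumes "0 < r" "- pi\<^sup>2 < m" "m < m'"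
  shows "level_time r m' < level_time r m"
  unfolding level_time_def
  using assms sn_strict_mono_param[of m m'] sn1_pos[of m] by (intro divide_strict_left_mono) auto

lemma level_geodesic:
  assumes "0 < r" "- pi\<^sup>2 < m" "m \<le> (level_time r m)\<^sup>2"
  defines "t \<equiv> level_time r m" and "c \<equiv> sqrt (1 - m / (level_time r m)\<^sup>2)"
  shows "gdom c t" "sn (1 - c\<^sup>2) t = r" "theta c t = level_angle r m" "(1 - c\<^sup>2) * t\<^sup>2 = m"
proof -
  have t: "t > 0" using assms(1,2) by (simp add: t_def level_time_pos)
  have m1: "m / t\<^sup>2 \<le> 1" using assms(3) level_time_pos[OF assms(1,2)]
    unfolding t_def by (simp add: divide_le_eq)
  then have c2: "1 - c\<^sup>2 = m / t\<^sup>2" by (simp add: c_def t_def)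
  then show m: "(1 - c\<^sup>2) * t\<^sup>2 = m" using t by simp
  show "gdom c t" unfolding gdom_def m using t assms(2) m1[unfolded t_def] by (simp add: c_def)
  show sn: "sn (1 - c\<^sup>2) t = r" unfolding c2 using t sn1_pos[OF assms(2)] sn_rescale[OF less_imp_neq[OF t, symmetric], of m]
    by (simp add: t_def level_time_def)
  have "0 \<le> c" using m1 by (simp add: c_def t_def)
  then have "c * t = sqrt ((c * t)\<^sup>2)" using t by simp
  also have "(c * t)\<^sup>2 = t\<^sup>2 - m" using m by (simp add: power_mult_distrib algebra_simps)
  finally have "c * t = sqrt (t\<^sup>2 - m)" .
  then show "theta c t = level_angle r m"
    unfolding theta_def level_angle_def sn unfolding c2 cs_rescale[OF less_imp_neq[OF t, symmetric]] by (simp add: t_def)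
qed

lemma geodesic_level:
  assumes "gdom c t" "sn (1 - c\<^sup>2) t = r" "0 < r"
  defines "m \<equiv> (1 - c\<^sup>2) * t\<^sup>2"
  shows "- pi\<^sup>2 < m" "t = level_time r m" "theta c t = level_angle r m" "m \<le> t\<^sup>2" "c = sqrt (1 - m / t\<^sup>2)"
proof -
  have t: "t > 0" using assms gdomD[OF assms(1)] by (cases "t = 0") auto
  have c2: "1 - c\<^sup>2 = m / t\<^sup>2" using t by (simp add: m_def)
  have sn: "t * sn m 1 = r" using assms(2) unfolding c2 sn_rescale[OF less_imp_neq[OF t, symmetric]] .
  then have s1: "sn m 1 > 0" using t assms(3) by (metis zero_less_mult_pos)
  show m: "- pi\<^sup>2 < m"
  proof (rule ccontr)
    assume "\<not> - pi\<^sup>2 < m"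
    then have "m = - pi\<^sup>2" using assms(1) by (simp add: gdom_def m_def)
    then have "sn m 1 = 0" by (simp add: sn_def)
    then show False using s1 by simp
  qed
  show tt: "t = level_time r m" using sn s1 by (simp add: level_time_def field_simps)
  show mt: "m \<le> t\<^sup>2" unfolding m_def by (simp add: algebra_simps)
  have "1 - m / t\<^sup>2 = c\<^sup>2" using c2 by simp
  then show c: "c = sqrt (1 - m / t\<^sup>2)" using gdomD[OF assms(1)] by simp
  show "theta c t = level_angle r m"
    using level_geodesic(3)[OF assms(3) m] mt c unfolding tt[symmetric] by simp
qed

lemma continuous_on_level_angle:
  assumes "0 < r" "A \<subseteq> {- pi\<^sup>2<..}" "\<And>m. m \<in> A \<Longrightarrow> m \<le> (level_time r m)\<^sup>2"
  shows "continuous_on A (level_angle r)"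
proof -
  have s: "sn m 1 \<noteq> 0" if "m \<in> A" for m using sn1_pos[of m] that assms(2) by force
  have b: "- 1 \<le> cs m 1 / sqrt (1 + r\<^sup>2)" "cs m 1 / sqrt (1 + r\<^sup>2) \<le> 1" if "m \<in> A" for m
  proof -
    have m: "- pi\<^sup>2 < m" "m \<le> (level_time r m)\<^sup>2" using that assms by auto
    have t: "level_time r m > 0" using m assms by (simp add: level_time_pos)
    define c where "c = sqrt (1 - m / (level_time r m)\<^sup>2)"
    have "m / (level_time r m)\<^sup>2 \<le> 1" using m t by simp
    then have c2: "1 - c\<^sup>2 = m / (level_time r m)\<^sup>2" by (simp add: c_def)
    have "sn (1 - c\<^sup>2) (level_time r m) = r" using level_geodesic(2)[OF assms(1) m] by (simp add: c_def)
    moreover have "cs (1 - c\<^sup>2) (level_time r m) = cs m 1" unfolding c2 by (rule cs_rescale[OF less_imp_neq[OF t, symmetric]])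
    ultimately show "- 1 \<le> cs m 1 / sqrt (1 + r\<^sup>2)" "cs m 1 / sqrt (1 + r\<^sup>2) \<le> 1"
      using cs_ratio_bounds[of c "level_time r m"] by auto
  qed
  have r: "sqrt (1 + r\<^sup>2) \<noteq> 0" by (metis add_pos_nonneg less_irrefl real_sqrt_gt_zero zero_le_power2 zero_less_one)
  show ?thesis unfolding level_angle_def level_time_def
    by (intro continuous_intros continuous_on_subset[OF continuous_on_sn_cs_param(1)]
        continuous_on_subset[OF continuous_on_sn_cs_param(2)]) (use s b r in auto)
qed

text \<open>Intermediate value theorem in \<open>m\<close>. Arrival times decrease in
  \<open>m\<close>, which gives the bound by the first time. It also keeps every intermediate
  \<open>m\<close> below the square of its arrival time, because this holds at the right
  end.\<close>

lemma geodesic_between: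
  assumes "gdom c\<^sub>1 t\<^sub>1" "sn (1 - c\<^sub>1\<^sup>2) t\<^sub>1 = r" "gdom c\<^sub>2 t\<^sub>2" "sn (1 - c\<^sub>2\<^sup>2) t\<^sub>2 = r" "0 < r"
    and "(1 - c\<^sub>1\<^sup>2) * t\<^sub>1\<^sup>2 \<le> (1 - c\<^sub>2\<^sup>2) * t\<^sub>2\<^sup>2" "theta c\<^sub>2 t\<^sub>2 \<le> \<psi>" "\<psi> \<le> theta c\<^sub>1 t\<^sub>1"
  obtains c t where "gdom c t" "sn (1 - c\<^sup>2) t = r" "theta c t = \<psi>"
    "(1 - c\<^sub>1\<^sup>2) * t\<^sub>1\<^sup>2 \<le> (1 - c\<^sup>2) * t\<^sup>2" "(1 - c\<^sup>2) * t\<^sup>2 \<le> (1 - c\<^sub>2\<^sup>2) * t\<^sub>2\<^sup>2" "t \<le> t\<^sub>1"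
proof -
  define m\<^sub>1 where "m\<^sub>1 = (1 - c\<^sub>1\<^sup>2) * t\<^sub>1\<^sup>2"
  define m\<^sub>2 where "m\<^sub>2 = (1 - c\<^sub>2\<^sup>2) * t\<^sub>2\<^sup>2"
  note g1 = geodesic_level[OF assms(1,2,5), folded m\<^sub>1_def]
  note g2 = geodesic_level[OF assms(3,4,5), folded m\<^sub>2_def]
  have le: "m\<^sub>1 \<le> m\<^sub>2" using assms by (simp add: m\<^sub>1_def m\<^sub>2_def)
  have valid: "m \<le> (level_time r m)\<^sup>2" if "m\<^sub>1 \<le> m" "m \<le> m\<^sub>2" for m
  proof -
    have "level_time r m\<^sub>2 \<le> level_time r m"
      using level_time_strict_antimono[OF assms(5), of m m\<^sub>2] that g1(1) by (cases "m = m\<^sub>2") auto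
    moreover have "0 < level_time r m\<^sub>2" using level_time_pos assms(5) g2(1) by simp
    ultimately have "(level_time r m\<^sub>2)\<^sup>2 \<le> (level_time r m)\<^sup>2" by (intro power_mono) auto
    then show ?thesis using that g2(2,4) by simp
  qed
  have "continuous_on {m\<^sub>1..m\<^sub>2} (level_angle r)"
    by (rule continuous_on_level_angle) (use assms(5) g1(1) valid in auto)
  then obtain m where m: "m\<^sub>1 \<le> m" "m \<le> m\<^sub>2" "level_angle r m = \<psi>"
    using IVT2'[of "level_angle r" m\<^sub>2 \<psi> m\<^sub>1] le assms(7,8) g1(3) g2(3) by auto
  have mp: "- pi\<^sup>2 < m" using m g1(1) by simp
  note g = level_geodesic[OF assms(5) mp valid[OF m(1,2)]]
  have "level_time r m \<le> t\<^sub>1"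
    using level_time_strict_antimono[OF assms(5) g1(1), of m] m g1(2) by (cases "m = m\<^sub>1") auto
  then show ?thesis using that[OF g(1,2)] g(3,4) m by (simp add: m\<^sub>1_def m\<^sub>2_def)
qed

lemma straight_geodesic:
  assumes "0 < r"
  shows "gdom 0 (arsinh r)" "sn (1 - 0\<^sup>2) (arsinh r) = r"
proof -
  show "sn (1 - 0\<^sup>2) (arsinh r) = r" by (simp add: sn_def)
  have "- pi\<^sup>2 \<le> (arsinh r)\<^sup>2" by (rule order_trans[of _ 0]) auto
  moreover have "0 < arsinh r" using assms by simp
  ultimately show "gdom 0 (arsinh r)" by (simp add: gdom_def less_imp_le)
qed

text \<open>The straight geodesic c = 0 has m = t^2. A larger \<open>m\<close> would arrive earlier,
  contradicting m <= t^2, which holds for every geodesic. So the straight one is the right end of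
  the family at its level.\<close>

lemma geodesic_level_le_straight:
  assumes "gdom c t" "sn (1 - c\<^sup>2) t = r" "0 < r"
  shows "(1 - c\<^sup>2) * t\<^sup>2 \<le> (1 - 0\<^sup>2) * (arsinh r)\<^sup>2"
proof (rule ccontr)
  assume "\<not> (1 - c\<^sup>2) * t\<^sup>2 \<le> (1 - 0\<^sup>2) * (arsinh r)\<^sup>2"
  then have lt: "(1 - 0\<^sup>2) * (arsinh r)\<^sup>2 < (1 - c\<^sup>2) * t\<^sup>2" by simp
  note g0 = geodesic_level[OF straight_geodesic[OF assms(3)] assms(3)]
  note g = geodesic_level[OF assms]
  have "t < arsinh r" using level_time_strict_antimono[OF assms(3) g0(1) lt] g0(2) g(2) by simp
  then have "t\<^sup>2 < (arsinh r)\<^sup>2" using gdomD(2)[OF assms(1)] by (intro power_strict_mono) auto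
  then show False using lt g(4) by simp
qed

lemma geodesic_smaller_angle:
  assumes "gdom c\<^sub>1 t\<^sub>1" "sn (1 - c\<^sub>1\<^sup>2) t\<^sub>1 = r" "0 < r" "0 \<le> \<psi>" "\<psi> \<le> theta c\<^sub>1 t\<^sub>1"
  obtains c t where "gdom c t" "sn (1 - c\<^sup>2) t = r" "theta c t = \<psi>" "t \<le> t\<^sub>1"
proof (rule geodesic_between[OF assms(1,2) straight_geodesic[OF assms(3)] assms(3)
      geodesic_level_le_straight[OF assms(1-3)], of \<psi>])
qed (use assms(4,5) that in auto)

text \<open>As \<open>m\<close> decreases to - pi^2 the arrival time grows without bound, and with
  it the angle. This provides the left end for the intermediate value argument.\<close>

lemma exists_wide_geodesic:
  assumes "0 < r" "- pi\<^sup>2 < m"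
  obtains c t where "gdom c t" "sn (1 - c\<^sup>2) t = r" "pi \<le> theta c t" "(1 - c\<^sup>2) * t\<^sup>2 \<le> m"
proof -
  define y where "y = sqrt (max 0 (- m))"
  have "max 0 (- m) < pi\<^sup>2" using assms by simp
  then have y: "0 \<le> y" "y < pi" by (auto simp: y_def intro!: real_less_lsqrt)
  \<comment> \<open>The parameter used is - x^2 with x = pi - d. From d <= r / 4 and x >= pi / 2 the
    arrival time r x / sin d is at least 2 pi, and \<open>arccos\<close> takes away at most pi. The
    bound d <= pi - y puts - x^2 below the given \<open>m\<close>.\<close>
  define d where "d = min (pi / 2) (min (r / 4) (pi - y))"
  have d: "0 < d" "d \<le> pi / 2" "d \<le> r / 4" "d \<le> pi - y" using y assms
    unfolding d_def by linarith+
  define x where "x = pi - d"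
  have x: "pi / 2 \<le> x" "x < pi" "y \<le> x" using d by (auto simp: x_def)
  have x0: "0 < x" using x pi_half_gt_zero by linarith
  have "- m \<le> y\<^sup>2" by (simp add: y_def)
  also have "y\<^sup>2 \<le> x\<^sup>2" using x y by (intro power_mono) auto
  finally have xm: "- x\<^sup>2 \<le> m" by simp
  have xp: "- pi\<^sup>2 < - x\<^sup>2" using x x0 by (simp add: power_strict_mono)
  have s: "sin x = sin d" "0 < sin d" "sin d \<le> r / 4"
    using d sin_gt_zero[of d] sin_x_le_x[of d] pi_half_less_two by (auto simp: x_def)
  have sn: "sn (- x\<^sup>2) 1 = sin d / x" using x0 s by (simp add: sn_def)
  have t: "level_time r (- x\<^sup>2) = r * x / sin d" unfolding level_time_def sn using s by simp
  have "2 * pi * sin d \<le> 2 * pi * (r / 4)" using s by (intro mult_left_mono) auto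
  also have "\<dots> = r * (pi / 2)" by simp
  also have "\<dots> \<le> r * x" using assms x by (intro mult_left_mono) auto
  finally have t2: "2 * pi \<le> level_time r (- x\<^sup>2)" unfolding t using s by (simp add: field_simps)
  have valid: "- x\<^sup>2 \<le> (level_time r (- x\<^sup>2))\<^sup>2" by (rule order_trans[of _ 0]) auto
  note g = level_geodesic[OF assms(1) xp valid]
  have b: "- 1 \<le> cs (- x\<^sup>2) 1 / sqrt (1 + r\<^sup>2)" "cs (- x\<^sup>2) 1 / sqrt (1 + r\<^sup>2) \<le> 1"
  proof -
    have "\<bar>cs (- x\<^sup>2) 1\<bar> \<le> 1" using x0 by (simp add: cs_def)
    moreover have "1 \<le> sqrt (1 + r\<^sup>2)" by simp
    ultimately have "\<bar>cs (- x\<^sup>2) 1\<bar> \<le> sqrt (1 + r\<^sup>2)" "0 < sqrt (1 + r\<^sup>2)" by linarith+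
    then have "\<bar>cs (- x\<^sup>2) 1 / sqrt (1 + r\<^sup>2)\<bar> \<le> 1" by (simp add: abs_divide)
    then show "- 1 \<le> cs (- x\<^sup>2) 1 / sqrt (1 + r\<^sup>2)" "cs (- x\<^sup>2) 1 / sqrt (1 + r\<^sup>2) \<le> 1"
      by linarith+
  qed
  have "pi \<le> level_time r (- x\<^sup>2) - pi" using t2 by simp
  also have "\<dots> \<le> sqrt ((level_time r (- x\<^sup>2))\<^sup>2 - (- x\<^sup>2)) - arccos (cs (- x\<^sup>2) 1 / sqrt (1 + r\<^sup>2))"
    using arccos_bounded[OF b] by (intro diff_mono real_le_rsqrt) auto
  finally have "pi \<le> level_angle r (- x\<^sup>2)" by (simp add: level_angle_def)
  then show ?thesis using that[OF g(1,2)] g(3,4) xm by simp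
qed

lemma geodesic_larger_angle:
  assumes "gdom c\<^sub>2 t\<^sub>2" "sn (1 - c\<^sub>2\<^sup>2) t\<^sub>2 = r" "0 < r" "theta c\<^sub>2 t\<^sub>2 \<le> \<psi>" "\<psi> \<le> pi"
  obtains c t where "gdom c t" "sn (1 - c\<^sup>2) t = r" "theta c t = \<psi>" "(1 - c\<^sup>2) * t\<^sup>2 \<le> (1 - c\<^sub>2\<^sup>2) * t\<^sub>2\<^sup>2"
proof -
  obtain c\<^sub>1 t\<^sub>1 where *: "gdom c\<^sub>1 t\<^sub>1" "sn (1 - c\<^sub>1\<^sup>2) t\<^sub>1 = r" "pi \<le> theta c\<^sub>1 t\<^sub>1"
    "(1 - c\<^sub>1\<^sup>2) * t\<^sub>1\<^sup>2 \<le> (1 - c\<^sub>2\<^sup>2) * t\<^sub>2\<^sup>2"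
    using exists_wide_geodesic[OF assms(3) geodesic_level(1)[OF assms(1-3)]] .
  show ?thesis
    by (rule geodesic_between[OF *(1,2) assms(1-3) *(4) assms(4), of thesis]) (use *(3) assms(5) that in auto)
qed

lemma exists_geodesic_angle:
  assumes "0 < r" "0 \<le> \<psi>" "\<psi> \<le> pi"
  obtains c t where "gdom c t" "sn (1 - c\<^sup>2) t = r" "theta c t = \<psi>"
  by (rule geodesic_larger_angle[OF straight_geodesic[OF assms(1)] assms(1), of \<psi>])
    (use assms that in auto)

text \<open>At a fixed positive level the arrival time is injective in \<open>m\<close>, and
  \<open>m\<close> together with \<open>t\<close> determines \<open>c\<close>.\<close>

lemma geodesic_unique_speed:
  assumes "gdom c t" "gdom c' t" "sn (1 - c\<^sup>2) t = sn (1 - c'\<^sup>2) t" "0 < sn (1 - c\<^sup>2) t"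
  shows "c = c'"
proof -
  note g = geodesic_level[OF assms(1) refl assms(4)]
  note g' = geodesic_level[OF assms(2) assms(3)[symmetric] assms(4)]
  have "(1 - c\<^sup>2) * t\<^sup>2 = (1 - c'\<^sup>2) * t\<^sup>2"
  proof (cases "(1 - c\<^sup>2) * t\<^sup>2" "(1 - c'\<^sup>2) * t\<^sup>2" rule: linorder_cases)
    case less
    then show ?thesis using level_time_strict_antimono[OF assms(4) g(1) less] g(2) g'(2) by simp
  next
    case greater
    then show ?thesis using level_time_strict_antimono[OF assms(4) g'(1) greater] g(2) g'(2) by simp
  qed
  then show ?thesis using g(5) g'(5) by (metis (full_types))
qed

lemma gdom_sn_zero:
  assumes "gdom c t" "0 < t" "sn (1 - c\<^sup>2) t = 0"
  shows "1 < c" "t = ret c"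
proof -
  have eq: "(1 - c\<^sup>2) * t\<^sup>2 = - pi\<^sup>2"
    using assms sn_pos[of t "1 - c\<^sup>2"] unfolding gdom_def by force
  show c1: "1 < c"
  proof (rule ccontr)
    assume "\<not> 1 < c"
    then have "c\<^sup>2 \<le> 1" using gdomD(1)[OF assms(1)] by (simp add: power_le_one)
    then have "0 \<le> (1 - c\<^sup>2) * t\<^sup>2" by simp
    with eq show False by simp
  qed
  show "t = ret c"
  proof (rule ccontr)
    assume "t \<noteq> ret c"
    then have "t < ret c" using assms(1) gdom_iff[OF c1] by simp
    then have "0 < sn (1 - c\<^sup>2) t"
      using gdom_sn_pos[of c "ret c" t] assms(2) ret_pos[OF c1] gdom_iff[OF c1] by simp
    with assms(3) show False by simp
  qed
qed

text \<open>Off level 0, equality of times would force equal speeds by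
  \<open>geodesic_unique_speed\<close> and then equal angles. At level 0 closed geodesics are
  compared by \<open>ret_eq\<close>. The last hypothesis excludes the identity as endpoint.\<close>

lemma shorter_geodesic_inside:
  assumes "gdom c t" "0 \<le> \<psi>" "\<psi> < theta c t" "sn (1 - c\<^sup>2) t \<noteq> 0 \<or> 0 < \<psi>"
  obtains c' t' where "gdom c' t'" "sn (1 - c'\<^sup>2) t' = sn (1 - c\<^sup>2) t" "theta c' t' = \<psi>" "t' < t"
proof (cases "sn (1 - c\<^sup>2) t = 0")
  case False
  then have r: "0 < sn (1 - c\<^sup>2) t" using gdomD(3)[OF assms(1)] by simp
  obtain c' t' where *: "gdom c' t'" "sn (1 - c'\<^sup>2) t' = sn (1 - c\<^sup>2) t" "theta c' t' = \<psi>" "t' \<le> t"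
    using geodesic_smaller_angle[OF assms(1) refl r assms(2)] assms(3) by auto
  have "t' \<noteq> t"
  proof
    assume "t' = t"
    then have "c' = c" using geodesic_unique_speed[of c' t c] * assms r by simp
    with \<open>t' = t\<close> * assms show False by simp
  qed
  then show ?thesis using that * by simp
next
  case True
  have t0: "0 < t" using assms gdomD(2)[OF assms(1)] by (cases "t = 0") auto
  note c1 = gdom_sn_zero[OF assms(1) t0 True]
  have "0 < \<psi>" using assms(4) True by simp
  then obtain c' where c': "1 < c'" "theta c' (ret c') = \<psi>" by (rule exists_closed_geodesic)
  have "(pi + \<psi>)\<^sup>2 < (pi + theta c t)\<^sup>2" using assms by (intro power_strict_mono) auto
  then have "ret c' < ret c"
    using ret_eq[OF c'(1)] ret_eq[OF c1(1)] c'(2) c1(2) by (metis diff_strict_right_mono real_sqrt_less_iff)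
  then show ?thesis using that[of c' "ret c'"] c' gdom_iff[OF c'(1)] ret_pos[OF c'(1)] True c1(2) sn_ret[OF c'(1)]
    by simp
qed

lemma admissible_self: "(c\<^sup>2 - 1) * (sn (1 - c\<^sup>2) t)\<^sup>2 \<le> 1"
proof -
  have "(c\<^sup>2 - 1) * (sn (1 - c\<^sup>2) t)\<^sup>2 = 1 - (cs (1 - c\<^sup>2) t)\<^sup>2"
    unfolding cs_squared by (simp add: algebra_simps)
  then show ?thesis by simp
qed

lemma prim_pos:
  assumes "0 < x" "(p\<^sup>2 - 1) * x\<^sup>2 \<le> 1"
  shows "0 < prim p x"
proof -
  have "prim p 0 < prim p x"
  proof (rule DERIV_pos_imp_increasing_open[OF assms(1) _ continuous_on_prim])
    fix t assume t: "0 < t" "t < x"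
    have "(p\<^sup>2 - 1) * t\<^sup>2 < 1"
    proof (cases "p\<^sup>2 > 1")
      case True
      have "t\<^sup>2 < x\<^sup>2" using t by (intro power_strict_mono) auto
      then have "(p\<^sup>2 - 1) * t\<^sup>2 < (p\<^sup>2 - 1) * x\<^sup>2" using True by (intro mult_strict_left_mono) auto
      then show ?thesis using assms by linarith
    next
      case False
      then have "(p\<^sup>2 - 1) * t\<^sup>2 \<le> 0" by (intro mult_nonpos_nonneg) auto
      then show ?thesis by linarith
    qed
    moreover have "(1 - p\<^sup>2) * t\<^sup>2 = - ((p\<^sup>2 - 1) * t\<^sup>2)" by algebra
    ultimately have "0 < slope p t" unfolding slope_def by (intro divide_pos_pos) (auto simp: add_pos_nonneg)
    then show "\<exists>y. (prim p has_real_derivative y) (at t) \<and> 0 < y" using DERIV_prim by blast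
  qed
  then show ?thesis by simp
qed

text \<open>\<open>calibration_mono\<close> with p = c and s = -1 remains valid past the turning
  point, and it leaves the surplus \<open>prim c\<close>, positive unless \<open>sn\<close>
  vanishes. At the return the explicit formulas reduce the claim to w < c for w = sqrt (c^2 -
  1).\<close>

lemma theta_excess_pos:
  assumes "gdom c t" "0 < t"
  shows "c * theta c t < t"
proof (cases "sn (1 - c\<^sup>2) t = 0")
  case True
  note c = gdom_sn_zero[OF assms True]
  define w where "w = sqrt (c\<^sup>2 - 1)"
  have w: "0 < w" "w\<^sup>2 = c\<^sup>2 - 1" using omega_pos[OF c(1)] by (auto simp: w_def)
  have "w\<^sup>2 < c\<^sup>2" using w by simp
  then have "w < c" by (rule power2_less_imp_less) (use c(1) in simp)
  have "w * w < c * w" using w \<open>w < c\<close> by simp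
  then have "c * (c - w) < 1" using w(2) by (simp add: algebra_simps power2_eq_square)
  then have "pi * (c * (c - w)) / w < pi * 1 / w"
    using w by (intro divide_strict_right_mono mult_strict_left_mono) auto
  moreover have "c * (pi * (c / w - 1)) = pi * (c * (c - w)) / w"
    using w(1) by (simp add: diff_divide_distrib right_diff_distrib)
  ultimately have "c * (pi * (c / w - 1)) < pi / w" by simp
  moreover have "theta c t = pi * (c / w - 1)" "t = pi / w"
    using theta_ret[OF c(1)] c(2) by (simp_all add: ret_def w_def)
  ultimately show ?thesis by (simp only:)
next
  case False
  then have s: "0 < sn (1 - c\<^sup>2) t" using gdomD(3)[OF assms(1)] by simp
  have "0 - c * theta c 0 + (-1) * prim c (sn (1 - c\<^sup>2) 0) \<le> t - c * theta c t + (-1) * prim c (sn (1 - c\<^sup>2) t)"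
    by (rule calibration_mono) (use assms admissible_self in auto)
  then show ?thesis using prim_pos[OF s admissible_self] by simp
qed

section \<open>Increments of Lipschitz curves\<close>

lemma has_vector_derivative_quotient:
  assumes "(f has_vector_derivative f') (at t within A)"
  shows "((\<lambda>s. (f s - f t) /\<^sub>R (s - t)) \<longlongrightarrow> f') (at t within A)"
proof (rule LIM_zero_cancel, rule tendsto_norm_zero_cancel)
  have "((\<lambda>s. norm ((1 / norm (s - t)) *\<^sub>R (f s - (f t + (s - t) *\<^sub>R f')))) \<longlongrightarrow> 0) (at t within A)"
    using assms unfolding has_vector_derivative_def has_derivative_within
    by (intro tendsto_norm_zero) blast
  moreover have "\<forall>\<^sub>F s in at t within A. norm ((1 / norm (s - t)) *\<^sub>R (f s - (f t + (s - t) *\<^sub>R f')))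
      = norm ((f s - f t) /\<^sub>R (s - t) - f')"
    unfolding eventually_at_filter
  proof (intro always_eventually allI impI)
    fix s assume "s \<noteq> t"
    then have "(f s - f t) /\<^sub>R (s - t) - f' = (1 / (s - t)) *\<^sub>R (f s - (f t + (s - t) *\<^sub>R f'))"
      by (simp add: scaleR_diff_right scaleR_add_right divide_inverse)
    then show "norm ((1 / norm (s - t)) *\<^sub>R (f s - (f t + (s - t) *\<^sub>R f'))) = norm ((f s - f t) /\<^sub>R (s - t) - f')"
      by simp
  qed
  ultimately show "((\<lambda>s. norm ((f s - f t) /\<^sub>R (s - t) - f')) \<longlongrightarrow> 0) (at t within A)"
    by (rule Lim_transform_eventually)
qed

text \<open>A one-sided bound on difference quotients off a null set suffices, so \<open>f\<close>
  may be built from norms and |Arg|. The integrals of difference quotients tend to the increment,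
  and the part of the quotients exceeding \<open>g\<close> vanishes in the limit by dominated
  convergence.\<close>

lemma increment_le_integral:
  fixes f g :: "real \<Rightarrow> real"
  assumes "a \<le> b" "M-lipschitz_on {a..b} f" "g integrable_on {a..b}" "\<And>t. t \<in> {a..b} \<Longrightarrow> 0 \<le> g t"
    and "negligible N"
    and slope: "\<And>t e. t \<in> {a<..<b} - N \<Longrightarrow> 0 < e \<Longrightarrow> \<forall>\<^sub>F s in at_right t. f s - f t \<le> (g t + e) * (s - t)"
  shows "f b - f a \<le> integral {a..b} g"
proof (cases "a = b")
  case False
  then have ab: "a < b" using assms by simp
  have M: "0 \<le> M" using assms(2) by (rule lipschitz_on_nonneg)
  define F where "F s = f (min s b)" for s
  have lip: "\<bar>F s - F t\<bar> \<le> M * \<bar>s - t\<bar>" if "a \<le> s" "a \<le> t" for s t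
  proof -
    have "\<bar>F s - F t\<bar> \<le> M * \<bar>min s b - min t b\<bar>"
      using lipschitz_onD[OF assms(2), of "min s b" "min t b"] that ab by (simp add: F_def dist_real_def)
    also have "\<dots> \<le> M * \<bar>s - t\<bar>" using M by (intro mult_left_mono) auto
    finally show ?thesis .
  qed
  have "M-lipschitz_on {a..} F" using M lip by (intro lipschitz_onI) (auto simp: dist_real_def)
  then have cont: "continuous_on {a..} F" by (rule lipschitz_on_continuous_on)
  define h where "h n = 1 / (real n + 1)" for n
  have h: "0 < h n" for n by (simp add: h_def)
  have h_lim: "h \<longlonglongrightarrow> 0" unfolding h_def using LIMSEQ_inverse_real_of_nat by (simp add: inverse_eq_divide add.commute)
  define dq where "dq n t = (F (t + h n) - F t) / h n" for n t
  have dq_cont: "continuous_on {a..b} (dq n)" for n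
    unfolding dq_def using h[of n]
    by (intro continuous_intros continuous_on_compose2[OF cont]) auto
  have dq_int: "dq n integrable_on {a..b}" for n
    by (rule integrable_continuous_real[OF dq_cont])
  have dq_bound: "\<bar>dq n t\<bar> \<le> M" if "t \<in> {a..b}" for n t
    using lip[of "t + h n" t] h[of n] that by (simp add: dq_def field_simps)
  have int_F: "F integrable_on {c..d}" if "a \<le> c" for c d
    by (rule integrable_continuous_real) (rule continuous_on_subset[OF cont], use that in auto)
  \<comment> \<open>The integral of the quotient is the mean of \<open>F\<close> over [b, b + h],
    where \<open>F\<close> is constantly f b, minus its mean over [a, a + h], which the Lipschitz
    bound keeps below f a + M h.\<close>
  have dq_ge: "f b - f a - M * h n \<le> integral {a..b} (dq n)" for n
  proof -
    have s: "integral {a..b} (\<lambda>t. F (t + h n)) = integral {a + h n..b + h n} F"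
      using integral_shift[of a "h n" b F] continuous_on_subset[OF cont, of "{a + h n..b + h n}"] h[of n]
      by (auto simp: o_def)
    have si: "(\<lambda>t. F (t + h n)) integrable_on {a..b}"
      by (intro integrable_continuous_real continuous_on_compose2[OF cont] continuous_intros) (use h[of n] in auto)
    have "integral {a..b} (dq n) = (integral {a..b} (\<lambda>t. F (t + h n)) - integral {a..b} F) / h n"
      unfolding dq_def by (simp add: integral_diff si int_F)
    also have "\<dots> = (integral {a + h n..b + h n} F - integral {a..b} F) / h n" by (simp add: s)
    also have "integral {a + h n..b + h n} F - integral {a..b} F = integral {b..b + h n} F - integral {a..a + h n} F"
    proof -
      have 1: "integral {a..a + h n} F + integral {a + h n..b + h n} F = integral {a..b + h n} F"
        by (rule Henstock_Kurzweil_Integration.integral_combine) (use h[of n] ab int_F in auto)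
      have 2: "integral {a..b} F + integral {b..b + h n} F = integral {a..b + h n} F"
        by (rule Henstock_Kurzweil_Integration.integral_combine) (use h[of n] ab int_F in auto)
      from 1 2 show ?thesis by linarith
    qed
    also have "integral {b..b + h n} F = integral {b..b + h n} (\<lambda>_. f b)"
      by (rule integral_cong) (auto simp: F_def min_def intro: arg_cong[where f = f])
    also have "\<dots> = h n * f b" using h[of n] by simp
    finally have eq: "integral {a..b} (dq n) = (h n * f b - integral {a..a + h n} F) / h n" .
    have "integral {a..a + h n} F \<le> integral {a..a + h n} (\<lambda>_. f a + M * h n)"
    proof (rule integral_le)
      fix t assume t: "t \<in> {a..a + h n}"
      then have "F t - F a \<le> M * \<bar>t - a\<bar>" using lip[of t a] by auto
      also have "\<dots> \<le> M * h n" using t M by (intro mult_left_mono) auto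
      finally show "F t \<le> f a + M * h n" using ab by (simp add: F_def)
    qed (use int_F in auto)
    also have "\<dots> = h n * (f a + M * h n)" using h[of n] by simp
    finally have "h n * f b - h n * (f a + M * h n) \<le> h n * f b - integral {a..a + h n} F" by simp
    then have "(h n * (f b - f a - M * h n)) / h n \<le> integral {a..b} (dq n)"
      unfolding eq using h[of n] by (intro divide_right_mono) (auto simp: algebra_simps)
    then show ?thesis using h[of n] by simp
  qed
  let ?N = "insert a (insert b N)"
  have negl: "negligible ?N" using assms(5) by simp
  \<comment> \<open>Since \<open>g\<close> is nonnegative, this positive part is at most
    \<open>M\<close>, so it is dominated even if \<open>g\<close> is unbounded.\<close>
  define e where "e n t = max (dq n t - g t) 0" for n t
  have g_abs: "g absolutely_integrable_on {a..b}"
    using assms(3,4) by (intro nonnegative_absolutely_integrable_1) auto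
  have e_int: "e n integrable_on {a..b}" for n
  proof -
    have "dq n absolutely_integrable_on {a..b}" by (rule absolutely_integrable_continuous_real[OF dq_cont])
    then have "(\<lambda>t. max (dq n t - g t) 0) absolutely_integrable_on {a..b}"
      using g_abs by (intro absolutely_integrable_max_1 set_integral_diff(1)) auto
    then show ?thesis unfolding e_def by (rule set_lebesgue_integral_eq_integral(1))
  qed
  define e' where "e' n t = (if t \<in> ?N then 0 else e n t)" for n t
  have e'_int: "e' n integrable_on {a..b}" for n
    by (rule integrable_spike[OF e_int negl]) (auto simp: e'_def)
  have e'_eq: "integral {a..b} (e' n) = integral {a..b} (e n)" for n
    by (rule integral_spike[OF negl]) (auto simp: e'_def)
  have "(\<lambda>n. integral {a..b} (e' n)) \<longlonglongrightarrow> integral {a..b} (\<lambda>_. 0::real)"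
  proof (rule dominated_convergence(2)[where h = "\<lambda>_. M"])
    show "norm (e' n t) \<le> M" if "t \<in> {a..b}" for n t
      using dq_bound[OF that, of n] assms(4)[OF that] M by (auto simp: e'_def e_def max_def)
    show "(\<lambda>n. e' n t) \<longlonglongrightarrow> 0" if "t \<in> {a..b}" for t
    proof (cases "t \<in> ?N")
      case True then show ?thesis by (simp add: e'_def)
    next
      case False
      then have t: "t \<in> {a<..<b} - N" using that by auto
      show ?thesis
      proof (rule LIMSEQ_I)
        fix r :: real assume r: "0 < r"
        have "\<forall>\<^sub>F s in at_right t. f s - f t \<le> (g t + r / 2) * (s - t)" using slope[OF t] r by simp
        then obtain d where d: "t < d" "\<And>s. t < s \<Longrightarrow> s < d \<Longrightarrow> f s - f t \<le> (g t + r / 2) * (s - t)"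
          unfolding eventually_at_right_field by auto
        have "\<forall>\<^sub>F n in sequentially. h n < min (d - t) (b - t)"
          using h_lim d t by (intro order_tendstoD(2)) auto
        then obtain n0 where n0: "\<And>n. n \<ge> n0 \<Longrightarrow> h n < min (d - t) (b - t)"
          unfolding eventually_sequentially by auto
        have "norm (e' n t - 0) < r" if "n \<ge> n0" for n
        proof -
          have hn: "t + h n < d" "t + h n < b" using n0[OF that] by auto
          have "F (t + h n) - F t = f (t + h n) - f t" using hn h[of n] by (simp add: F_def)
          also have "\<dots> \<le> (g t + r / 2) * h n" using d(2)[of "t + h n"] hn h[of n] by simp
          finally have "dq n t \<le> g t + r / 2" using h[of n] by (simp add: dq_def field_simps)
          then show ?thesis using r by (simp add: e'_def e_def)
        qed
        then show "\<exists>n0. \<forall>n\<ge>n0. norm (e' n t - 0) < r" by blast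
      qed
    qed
  qed (use e'_int in auto)
  then have "(\<lambda>n. integral {a..b} g + integral {a..b} (e' n) + M * h n) \<longlonglongrightarrow> integral {a..b} g + 0 + M * 0"
    by (intro tendsto_intros h_lim) simp
  moreover have "f b - f a \<le> integral {a..b} g + integral {a..b} (e' n) + M * h n" for n
  proof -
    have "integral {a..b} (dq n) \<le> integral {a..b} (\<lambda>t. g t + e n t)"
      by (rule integral_le) (auto simp: dq_int e_def assms(3) intro!: integrable_add e_int[unfolded e_def])
    also have "\<dots> = integral {a..b} g + integral {a..b} (e' n)"
      unfolding e'_eq by (intro integral_add assms(3) e_int)
    finally show ?thesis using dq_ge[of n] by linarith
  qed
  ultimately show ?thesis by (intro LIMSEQ_le_const) auto
qed simp

text \<open>The derivative is only given pointwise, so measurability has to come from the curve: off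
  a null set the integrand is a limit of continuous difference quotients with a common
  bound.\<close>

lemma lipschitz_speed_integrable:
  fixes w :: "real \<Rightarrow> 'a::real_normed_vector" and \<phi> :: "real \<Rightarrow> real"
  assumes "a \<le> b" "L-lipschitz_on {a..b} w" "continuous_on {a..b} \<phi>" "negligible N"
    and deriv: "\<And>t. t \<in> {a..b} - N \<Longrightarrow> (w has_vector_derivative w' t) (at t within {a..b})"
  shows "(\<lambda>t. \<phi> t * norm (w' t)) integrable_on {a..b}"
proof -
  have L: "0 \<le> L" using assms(2) by (rule lipschitz_on_nonneg)
  define W where "W s = w (min s b)" for s
  have lip: "norm (W s - W t) \<le> L * \<bar>s - t\<bar>" if "a \<le> s" "a \<le> t" for s t
  proof -
    have "norm (W s - W t) \<le> L * \<bar>min s b - min t b\<bar>"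
      using lipschitz_onD[OF assms(2), of "min s b" "min t b"] that assms(1)
      by (simp add: W_def dist_real_def dist_norm)
    also have "\<dots> \<le> L * \<bar>s - t\<bar>" using L by (intro mult_left_mono) auto
    finally show ?thesis .
  qed
  have "L-lipschitz_on {a..} W" using L lip by (intro lipschitz_onI) (auto simp: dist_real_def dist_norm)
  then have cont: "continuous_on {a..} W" by (rule lipschitz_on_continuous_on)
  define h where "h n = 1 / (real n + 1)" for n
  have h: "0 < h n" for n by (simp add: h_def)
  have h_lim: "h \<longlonglongrightarrow> 0" unfolding h_def using LIMSEQ_inverse_real_of_nat by (simp add: inverse_eq_divide add.commute)
  define dq where "dq n t = \<phi> t * (norm (W (t + h n) - W t) / h n)" for n t
  obtain B where B: "\<And>t. t \<in> {a..b} \<Longrightarrow> \<bar>\<phi> t\<bar> \<le> B"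
    using compact_imp_bounded[OF compact_continuous_image[OF assms(3)]] unfolding bounded_iff by (auto simp: real_norm_def) (metis atLeastAtMost_iff)
  have dq_int: "dq n integrable_on {a..b}" for n
    unfolding dq_def using h[of n]
    by (intro integrable_continuous_real continuous_intros continuous_on_compose2[OF cont] assms(3)) auto
  have dq_bound: "\<bar>dq n t\<bar> \<le> B * L" if t: "t \<in> {a..b}" for n t
  proof -
    have "norm (W (t + h n) - W t) / h n \<le> L"
      using lip[of "t + h n" t] h[of n] t by (simp add: field_simps)
    then show ?thesis unfolding dq_def abs_mult using B[OF t] h[of n]
      by (intro mult_mono) (auto intro: order_trans[OF _ B[OF t]])
  qed
  let ?N = "insert b N"
  have negl: "negligible ?N" using assms(4) by simp
  have "(\<lambda>t. if t \<in> ?N then 0 else \<phi> t * norm (w' t)) integrable_on {a..b}"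
  proof (rule dominated_convergence(1)[where h = "\<lambda>_. B * L" and f = "\<lambda>n t. if t \<in> ?N then 0 else dq n t"])
    show "(\<lambda>t. if t \<in> ?N then 0 else dq n t) integrable_on {a..b}" for n
      by (rule integrable_spike[OF dq_int negl]) auto
    show "norm (if t \<in> ?N then 0 else dq n t) \<le> B * L" if "t \<in> {a..b}" for n t
      using dq_bound[OF that, of n] by auto
    show "(\<lambda>n. if t \<in> ?N then 0 else dq n t) \<longlonglongrightarrow> (if t \<in> ?N then 0 else \<phi> t * norm (w' t))"
      if t: "t \<in> {a..b}" for t
    proof (cases "t \<in> ?N")
      case False
      then have tb: "t < b" "t \<in> {a..b} - N" using t by auto
      have "((\<lambda>s. norm ((w s - w t) /\<^sub>R (s - t))) \<longlongrightarrow> norm (w' t)) (at t within {a..b})"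
        by (intro tendsto_norm has_vector_derivative_quotient deriv tb(2))
      moreover have "filterlim (\<lambda>n. t + h n) (at t within {a..b}) sequentially"
      proof -
        have "\<forall>\<^sub>F n in sequentially. h n < b - t" using h_lim tb by (intro order_tendstoD(2)) auto
        then have "\<forall>\<^sub>F n in sequentially. t + h n \<in> {a..b} \<and> t + h n \<noteq> t"
        proof eventually_elim
          case (elim n)
          then show ?case using h[of n] t by auto
        qed
        moreover have "(\<lambda>n. t + h n) \<longlonglongrightarrow> t" using tendsto_add[OF tendsto_const h_lim, of t] by simp
        ultimately show ?thesis by (auto simp: filterlim_at)
      qed
      ultimately have lim: "(\<lambda>n. norm ((w (t + h n) - w t) /\<^sub>R (t + h n - t))) \<longlonglongrightarrow> norm (w' t)"
        by (rule filterlim_compose)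
      have "\<forall>\<^sub>F n in sequentially. h n < b - t" using h_lim tb by (intro order_tendstoD(2)) auto
      then have "\<forall>\<^sub>F n in sequentially. norm ((w (t + h n) - w t) /\<^sub>R (t + h n - t)) = norm (W (t + h n) - W t) / h n"
      proof eventually_elim
        case (elim n)
        then show ?case using h[of n] tb by (simp add: W_def divide_inverse mult.commute)
      qed
      from tendsto_mult_left[OF Lim_transform_eventually[OF lim this], of "\<phi> t"] show ?thesis
        using False by (simp add: dq_def)
    qed auto
  qed auto
  then show ?thesis by (rule integrable_spike[OF _ negl]) auto
qed

section \<open>Lower bounds for the length of horizontal curves\<close>

lemma abs_Arg_le:
  assumes "z = complex_of_real r * cis \<theta>" "0 < r"
  shows "\<bar>Arg z\<bar> \<le> \<bar>\<theta>\<bar>"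
proof (cases "\<bar>\<theta>\<bar> < pi")
  case True
  have "sgn z = cis \<theta>" using assms by (simp add: sgn_mult sgn_of_real)
  then have "Arg z = \<theta>" using True by (intro cis_Arg_unique) auto
  then show ?thesis by simp
next
  case False
  then show ?thesis using Arg_bounded[of z] by auto
qed

lemma polar_Arg: "z \<noteq> 0 \<Longrightarrow> z = complex_of_real (cmod z) * cis (Arg z)"
  by (simp add: cis_Arg sgn_eq)

text \<open>|Arg| is the distance from 1 on the circle, hence subadditive. This replaces a
  continuous choice of the argument along a curve.\<close>

lemma abs_Arg_mult_le:
  assumes "u \<noteq> 0" "v \<noteq> 0"
  shows "\<bar>Arg (u * v)\<bar> \<le> \<bar>Arg u\<bar> + \<bar>Arg v\<bar>"
proof -
  have "u * v = (complex_of_real (cmod u) * cis (Arg u)) * (complex_of_real (cmod v) * cis (Arg v))"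
    using polar_Arg assms by metis
  also have "\<dots> = complex_of_real (cmod u * cmod v) * cis (Arg u + Arg v)"
    by (simp add: cis_mult[symmetric] mult_ac)
  finally have "\<bar>Arg (u * v)\<bar> \<le> \<bar>Arg u + Arg v\<bar>" using assms
    by (intro abs_Arg_le[of _ "cmod u * cmod v"]) auto
  then show ?thesis by linarith
qed

lemma abs_Arg_diff_le:
  assumes "u \<noteq> 0" "v \<noteq> 0"
  shows "\<bar>Arg u\<bar> - \<bar>Arg v\<bar> \<le> \<bar>Arg (u / v)\<bar>"
  using abs_Arg_mult_le[of "u / v" v] assms by simp

text \<open>At distance 1 / 2 or more from 1 the bound |Arg u| <= pi is enough, which accounts for
  the constant; closer to 1 the estimate of \<open>Ln\<close> is better.\<close>

lemma abs_Arg_le_dist: "\<bar>Arg u\<bar> \<le> 2 * pi * cmod (u - 1)" if "u \<noteq> 0"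
proof (cases "cmod (u - 1) < 1 / 2")
  case True
  have "\<bar>Arg u\<bar> = \<bar>Im (Ln (1 + (u - 1)))\<bar>" using that by (simp add: Arg_eq_Im_Ln)
  also have "\<dots> \<le> 2 * cmod (u - 1)" using abs_Im_le_cmod norm_Ln_le[OF True] by (rule order_trans)
  also have "\<dots> \<le> 2 * pi * cmod (u - 1)" using pi_ge_two by (intro mult_right_mono) auto
  finally show ?thesis .
next
  case False
  then have "2 * pi * (1 / 2) \<le> 2 * pi * cmod (u - 1)" by (intro mult_left_mono) auto
  moreover have "\<bar>Arg u\<bar> \<le> pi" using Arg_bounded[of u] by linarith
  ultimately show ?thesis by linarith
qed

lemma slope_le_1:
  assumes "(p\<^sup>2 - 1) * x\<^sup>2 \<le> 1" shows "slope p x \<le> 1"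
proof -
  have "1 + (1 - p\<^sup>2) * x\<^sup>2 \<le> 1 + x\<^sup>2" by (simp add: algebra_simps)
  also have "\<dots> \<le> (1 + x\<^sup>2)\<^sup>2" by (rule self_le_power) auto
  finally have "sqrt (1 + (1 - p\<^sup>2) * x\<^sup>2) \<le> 1 + x\<^sup>2" by (intro real_le_lsqrt) (auto simp: add_nonneg_nonneg)
  then show ?thesis by (simp add: slope_def add_pos_nonneg)
qed

lemma prim_diff_le:
  assumes "0 \<le> x" "x \<le> R" "0 \<le> y" "y \<le> R" "(p\<^sup>2 - 1) * R\<^sup>2 \<le> 1"
  shows "\<bar>prim p x - prim p y\<bar> \<le> \<bar>x - y\<bar>"
proof -
  have "\<bar>prim p b - prim p a\<bar> \<le> \<bar>b - a\<bar>" if "0 \<le> a" "a \<le> b" "b \<le> R" for a b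
  proof -
    have adm: "(p\<^sup>2 - 1) * t\<^sup>2 \<le> 1" if "a \<le> t" "t \<le> b" for t
      using admissible_mono[of t R p] \<open>0 \<le> a\<close> \<open>b \<le> R\<close> that assms by auto
    have "a - prim p a \<le> b - prim p b"
    proof (rule DERIV_nonneg_imp_nondecreasing[OF that(2)])
      fix t assume "a \<le> t" "t \<le> b"
      then show "\<exists>y. ((\<lambda>t. t - prim p t) has_real_derivative y) (at t) \<and> 0 \<le> y"
        using slope_le_1[OF adm] by (intro exI[of _ "1 - slope p t"]) (auto intro!: derivative_eq_intros DERIV_prim)
    qed
    moreover have "prim p a \<le> prim p b" using that adm by (intro prim_mono) auto
    ultimately show ?thesis by linarith
  qed
  from this[of x y] this[of y x] show ?thesis using assms by (cases "x \<le> y") (auto simp: abs_minus_commute)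
qed

text \<open>Division by \<open>z t\<close> moves the base point to 1, where \<open>Ln\<close> is
  smooth, so the rate exists even where the curve crosses the branch cut of
  \<open>Arg\<close>.\<close>

lemma has_vector_derivative_Arg_quotient:
  assumes "(z has_vector_derivative z') (at t)" "z t \<noteq> 0"
  shows "((\<lambda>s. \<bar>Arg (z s / z t)\<bar> / \<bar>s - t\<bar>) \<longlongrightarrow> \<bar>Im (z' / z t)\<bar>) (at t)"
proof -
  have "((\<lambda>s. z s / z t) has_vector_derivative z' / z t) (at t)"
    using has_vector_derivative_mult_left[OF assms(1), of "1 / z t"] by simp
  then have "((Ln \<circ> (\<lambda>s. z s / z t)) has_vector_derivative (z' / z t * inverse (z t / z t))) (at t)"
    using assms(2) by (intro field_vector_diff_chain_at has_field_derivative_Ln) auto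
  then have "((\<lambda>s. Im (Ln (z s / z t))) has_vector_derivative Im (z' / z t)) (at t)"
    using assms(2) bounded_linear.has_vector_derivative[OF bounded_linear_Im] by (fastforce simp: o_def)
  then have "((\<lambda>s. (Im (Ln (z s / z t)) - Im (Ln (z t / z t))) /\<^sub>R (s - t)) \<longlongrightarrow> Im (z' / z t)) (at t)"
    by (rule has_vector_derivative_quotient)
  then have "((\<lambda>s. Im (Ln (z s / z t)) / (s - t)) \<longlongrightarrow> Im (z' / z t)) (at t)"
    using assms(2) by (simp add: divide_inverse mult.commute)
  then have lim: "((\<lambda>s. \<bar>Im (Ln (z s / z t)) / (s - t)\<bar>) \<longlongrightarrow> \<bar>Im (z' / z t)\<bar>) (at t)"
    by (rule tendsto_rabs)
  have "isCont z t" using assms(1) has_vector_derivative_continuous by blast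
  then have "\<forall>\<^sub>F s in at t. z s \<noteq> 0"
    unfolding isCont_def using assms(2) tendsto_imp_eventually_ne by blast
  then have "\<forall>\<^sub>F s in at t. \<bar>Im (Ln (z s / z t)) / (s - t)\<bar> = \<bar>Arg (z s / z t)\<bar> / \<bar>s - t\<bar>"
    by eventually_elim (use assms(2) in \<open>simp add: Arg_eq_Im_Ln abs_divide\<close>)
  from Lim_transform_eventually[OF lim this] show ?thesis .
qed

text \<open>One-sided, because \<open>\<bar>w\<bar>\<close> need not be differentiable at the zeros of \<open>w\<close>.\<close>

lemma norm_right_derivative:
  fixes w :: "real \<Rightarrow> 'a::real_inner"
  assumes "(w has_vector_derivative w') (at t)"
  shows "((\<lambda>s. norm (w s)) has_real_derivative (if w t = 0 then norm w' else inner w' (sgn (w t)))) (at_right t)"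
proof (cases "w t = 0")
  case True
  have "((\<lambda>s. norm ((w s - w t) /\<^sub>R (s - t))) \<longlongrightarrow> norm w') (at_right t)"
    by (intro tendsto_norm has_vector_derivative_quotient has_vector_derivative_at_within[OF assms])
  moreover have "\<forall>\<^sub>F s in at_right t. norm ((w s - w t) /\<^sub>R (s - t)) = (norm (w s) - norm (w t)) / (s - t)"
    unfolding eventually_at_filter using True by (auto simp: divide_inverse mult.commute)
  ultimately show ?thesis using True unfolding has_field_derivative_iff
    by (auto intro: Lim_transform_eventually)
next
  case False
  have "((\<lambda>s. norm (w s)) has_derivative (\<lambda>h. inner (h *\<^sub>R w') (sgn (w t)))) (at t)"
    using has_derivative_compose[OF assms[unfolded has_vector_derivative_def] has_derivative_norm[OF False]] by simp
  then have "((\<lambda>s. norm (w s)) has_derivative (*) (inner w' (sgn (w t)))) (at t)"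
    by (rule has_derivative_eq_rhs) auto
  then show ?thesis using False
    by (auto simp: has_field_derivative_def intro: has_derivative_at_withinI)
qed

text \<open>The eikonal equation as an inequality. With xi = q z cnj w, r = |w| and N = |z| the two
  rates are |Im xi| / N^2 and |Re xi| / r, and |xi| = |q| N r. Cauchy-Schwarz then applies because
  (p r)^2 plus the radicand of \<open>slope p r\<close> is N^2.\<close>

lemma calibration_bound:
  fixes q z w :: complex
  assumes nz: "(cmod z)\<^sup>2 = 1 + (cmod w)\<^sup>2" and p: "0 \<le> p" "(p\<^sup>2 - 1) * (cmod w)\<^sup>2 \<le> 1"
  shows "p * \<bar>Im (cnj q * w / z)\<bar>
    + slope p (cmod w) * \<bar>if w = 0 then cmod (q * z) else inner (q * z) (sgn w)\<bar> \<le> cmod q"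
proof -
  have "z \<noteq> 0"
  proof
    assume "z = 0"
    then have "1 + (cmod w)\<^sup>2 = 0" using nz by simp
    then show False using zero_le_power2[of "cmod w"] by linarith
  qed
  then have z: "cmod z > 0" by simp
  show ?thesis
  proof (cases "w = 0")
    case True
    then have "cmod z = 1 \<or> cmod z = - 1" using nz by (simp add: power2_eq_1_iff)
    then have "cmod z = 1" using z by linarith
    then show ?thesis using True by (simp add: slope_def norm_mult)
  next
    case False
    define r where "r = cmod w"
    define N where "N = cmod z"
    have r: "r > 0" using False by (simp add: r_def)
    have N: "N > 0" "N\<^sup>2 = 1 + r\<^sup>2" using z nz by (auto simp: N_def r_def)
    define \<xi> where "\<xi> = q * z * cnj w"
    have "cnj q * w / z = cnj \<xi> / complex_of_real (N\<^sup>2)"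
    proof -
      have "complex_of_real (N\<^sup>2) = z * cnj z" unfolding N_def by (rule complex_norm_square)
      then show ?thesis using z by (simp add: \<xi>_def field_simps)
    qed
    then have 1: "\<bar>Im (cnj q * w / z)\<bar> = \<bar>Im \<xi>\<bar> / N\<^sup>2" by (simp add: Im_divide_of_real)
    have 2: "inner (q * z) (sgn w) = Re \<xi> / r"
      by (simp add: sgn_eq r_def \<xi>_def inner_complex_def add_divide_distrib)
    define k where "k = sqrt (1 + (1 - p\<^sup>2) * r\<^sup>2)"
    have "(1 - p\<^sup>2) * r\<^sup>2 = - ((p\<^sup>2 - 1) * r\<^sup>2)" by algebra
    then have k: "k \<ge> 0" "k\<^sup>2 = 1 + (1 - p\<^sup>2) * r\<^sup>2" using p(2) by (auto simp: k_def r_def)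
    have "(p * r * \<bar>Im \<xi>\<bar> + k * \<bar>Re \<xi>\<bar>)\<^sup>2 \<le> ((p * r)\<^sup>2 + k\<^sup>2) * (\<bar>Im \<xi>\<bar>\<^sup>2 + \<bar>Re \<xi>\<bar>\<^sup>2)"
    proof -
      have "((p * r)\<^sup>2 + k\<^sup>2) * (\<bar>Im \<xi>\<bar>\<^sup>2 + \<bar>Re \<xi>\<bar>\<^sup>2) =
        (p * r * \<bar>Im \<xi>\<bar> + k * \<bar>Re \<xi>\<bar>)\<^sup>2 + (p * r * \<bar>Re \<xi>\<bar> - k * \<bar>Im \<xi>\<bar>)\<^sup>2"
        by (simp only: power2_eq_square) algebra
      then show ?thesis by simp
    qed
    also have "(p * r)\<^sup>2 + k\<^sup>2 = N\<^sup>2" unfolding k N by (simp add: algebra_simps power_mult_distrib)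
    also have "\<bar>Im \<xi>\<bar>\<^sup>2 + \<bar>Re \<xi>\<bar>\<^sup>2 = (cmod \<xi>)\<^sup>2" by (simp add: cmod_power2)
    also have "N\<^sup>2 * (cmod \<xi>)\<^sup>2 = (N * cmod \<xi>)\<^sup>2" by (simp add: power_mult_distrib)
    finally have "p * r * \<bar>Im \<xi>\<bar> + k * \<bar>Re \<xi>\<bar> \<le> N * cmod \<xi>"
      by (rule power2_le_imp_le) (use N in simp)
    also have "cmod \<xi> = cmod q * N * r" by (simp add: \<xi>_def norm_mult N_def r_def)
    finally have "p * r * \<bar>Im \<xi>\<bar> + k * \<bar>Re \<xi>\<bar> \<le> cmod q * (N\<^sup>2 * r)" by (simp add: power2_eq_square mult_ac)
    then have "(p * r * \<bar>Im \<xi>\<bar> + k * \<bar>Re \<xi>\<bar>) / (N\<^sup>2 * r) \<le> cmod q" using N(1) r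
      by (subst pos_divide_le_eq) auto
    also have "(p * r * \<bar>Im \<xi>\<bar> + k * \<bar>Re \<xi>\<bar>) / (N\<^sup>2 * r) = p * (\<bar>Im \<xi>\<bar> / N\<^sup>2) + k / N\<^sup>2 * (\<bar>Re \<xi>\<bar> / r)"
      using N(1) r by (simp add: add_divide_distrib)
    also have "k / N\<^sup>2 = slope p (cmod w)" by (simp add: slope_def k_def r_def N(2))
    finally show ?thesis using False r by (simp add: 1 2 abs_divide)
  qed
qed

locale horizontal_complex =
  fixes z w q :: "real \<Rightarrow> complex" and T L :: real and N :: "real set"
  assumes T: "0 \<le> T"
    and z_lip: "L-lipschitz_on {0..T} z" and w_lip: "L-lipschitz_on {0..T} w"
    and norm_z: "\<And>t. t \<in> {0..T} \<Longrightarrow> (cmod (z t))\<^sup>2 = 1 + (cmod (w t))\<^sup>2"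
    and N: "negligible N"
    and z_deriv: "\<And>t. t \<in> {0..T} - N \<Longrightarrow> (z has_vector_derivative cnj (q t) * w t) (at t within {0..T})"
    and w_deriv: "\<And>t. t \<in> {0..T} - N \<Longrightarrow> (w has_vector_derivative q t * z t) (at t within {0..T})"
begin

lemma norm_z_ge_1: "t \<in> {0..T} \<Longrightarrow> 1 \<le> cmod (z t)"
  using norm_z[of t] by (intro power2_le_imp_le[of 1]) auto

lemma z_nonzero: "t \<in> {0..T} \<Longrightarrow> z t \<noteq> 0"
  using norm_z_ge_1 by force

text \<open>|q| is the speed of \<open>w\<close> divided by |z|, and |z| is continuous and at least
  1.\<close>

lemma q_integrable: "(\<lambda>t. cmod (q t)) integrable_on {0..T}"
proof -
  have "(\<lambda>t. 1 / cmod (z t) * cmod (q t * z t)) integrable_on {0..T}"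
    by (rule lipschitz_speed_integrable[OF T w_lip _ N w_deriv])
      (auto intro!: continuous_intros lipschitz_on_continuous_on[OF z_lip] simp: z_nonzero)
  moreover have "1 / cmod (z t) * cmod (q t * z t) = cmod (q t)" if "t \<in> {0..T}" for t
    using z_nonzero[OF that] by (simp add: norm_mult)
  ultimately show ?thesis by (rule integrable_eq)
qed

text \<open>Increments of |Arg z| are majorized by |Arg (z s / z t)|, whose rate is known;
  \<open>increment_le_integral\<close> then integrates \<open>calibration_bound\<close>. The bound
  \<open>R\<close> makes \<open>p\<close> admissible along the whole curve.\<close>

lemma calibrated_increment:
  assumes ab: "0 \<le> a" "a \<le> b" "b \<le> T" and p: "0 \<le> p" "(p\<^sup>2 - 1) * R\<^sup>2 \<le> 1"
    and R: "\<And>t. t \<in> {0..T} \<Longrightarrow> cmod (w t) \<le> R" and \<sigma>: "\<bar>\<sigma>\<bar> = 1"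
  shows "(p * \<bar>Arg (z b)\<bar> + \<sigma> * prim p (cmod (w b))) - (p * \<bar>Arg (z a)\<bar> + \<sigma> * prim p (cmod (w a)))
    \<le> integral {a..b} (\<lambda>t. cmod (q t))"
proof -
  let ?f = "\<lambda>t. p * \<bar>Arg (z t)\<bar> + \<sigma> * prim p (cmod (w t))"
  have L: "0 \<le> L" using z_lip by (rule lipschitz_on_nonneg)
  have inc: "?f s - ?f t \<le> p * \<bar>Arg (z s / z t)\<bar> + \<bar>prim p (cmod (w s)) - prim p (cmod (w t))\<bar>"
    if "s \<in> {0..T}" "t \<in> {0..T}" for s t
  proof -
    have "p * (\<bar>Arg (z s)\<bar> - \<bar>Arg (z t)\<bar>) \<le> p * \<bar>Arg (z s / z t)\<bar>"
      using that p by (intro mult_left_mono abs_Arg_diff_le z_nonzero)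
    moreover have "\<sigma> * (prim p (cmod (w s)) - prim p (cmod (w t))) \<le> \<bar>prim p (cmod (w s)) - prim p (cmod (w t))\<bar>"
      using \<sigma> by (metis abs_ge_self abs_mult mult_1)
    ultimately show ?thesis by (simp add: right_diff_distrib)
  qed
  have lip1: "?f s - ?f t \<le> (p * (2 * pi * L) + L) * dist s t" if st: "s \<in> {0..T}" "t \<in> {0..T}" for s t
  proof -
    have "\<bar>Arg (z s / z t)\<bar> \<le> 2 * pi * cmod (z s / z t - 1)"
      using st z_nonzero by (intro abs_Arg_le_dist) auto
    also have "cmod (z s / z t - 1) = cmod (z s - z t) / cmod (z t)"
      using z_nonzero[OF st(2)] by (metis diff_divide_distrib divide_self norm_divide)
    also have "\<dots> \<le> cmod (z s - z t) / 1"
      using norm_z_ge_1[OF st(2)] by (intro divide_left_mono) auto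
    also have "\<dots> \<le> L * dist s t" using lipschitz_onD[OF z_lip st] by (simp add: dist_norm)
    finally have "\<bar>Arg (z s / z t)\<bar> \<le> 2 * pi * (L * dist s t)" by simp
    then have "p * \<bar>Arg (z s / z t)\<bar> \<le> p * (2 * pi * (L * dist s t))" using p by (intro mult_left_mono)
    moreover have "\<bar>prim p (cmod (w s)) - prim p (cmod (w t))\<bar> \<le> \<bar>cmod (w s) - cmod (w t)\<bar>"
      using R st p by (intro prim_diff_le) auto
    moreover have "\<bar>cmod (w s) - cmod (w t)\<bar> \<le> L * dist s t"
      using lipschitz_onD[OF w_lip st] norm_triangle_ineq3[of "w s" "w t"] by (simp add: dist_norm)
    ultimately show ?thesis using inc[OF st] by (simp add: algebra_simps)
  qed
  have lip: "(p * (2 * pi * L) + L)-lipschitz_on {a..b} ?f"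
  proof (rule lipschitz_onI)
    fix s t assume "s \<in> {a..b}" "t \<in> {a..b}"
    then show "dist (?f s) (?f t) \<le> (p * (2 * pi * L) + L) * dist s t"
      using lip1[of s t] lip1[of t s] ab dist_commute[of s t]
      by (simp add: dist_real_def[of "?f s"] abs_le_iff)
  qed (use p L in simp)
  show ?thesis
  proof (rule increment_le_integral[OF ab(2) lip _ _ N, where g = "\<lambda>t. cmod (q t)"])
    show "(\<lambda>t. cmod (q t)) integrable_on {a..b}"
      by (rule integrable_on_subinterval[OF q_integrable]) (use ab in auto)
    fix t e :: real assume t: "t \<in> {a<..<b} - N" and e: "0 < e"
    have "a < t" "t < b" "t \<notin> N" using t by auto
    then have tT: "t \<in> {0..T}" "t \<in> {0<..<T}" "t \<in> {0..T} - N" using ab by simp_all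
    have at: "at t within {0..T} = at t" by (rule at_within_Icc_at) (use tT(2) in auto)
    have dz: "(z has_vector_derivative cnj (q t) * w t) (at t)" using z_deriv[OF tT(3)] by (simp add: at)
    have dw: "(w has_vector_derivative q t * z t) (at t)" using w_deriv[OF tT(3)] by (simp add: at)
    let ?D = "if w t = 0 then cmod (q t * z t) else inner (q t * z t) (sgn (w t))"
    have 1: "((\<lambda>s. \<bar>Arg (z s / z t)\<bar> / \<bar>s - t\<bar>) \<longlongrightarrow> \<bar>Im (cnj (q t) * w t / z t)\<bar>) (at_right t)"
      using has_vector_derivative_Arg_quotient[OF dz z_nonzero[OF tT(1)]]
      by (rule tendsto_within_subset) simp
    have "((\<lambda>s. prim p (cmod (w s))) has_real_derivative slope p (cmod (w t)) * ?D) (at_right t)"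
      by (rule DERIV_chain2[OF DERIV_prim norm_right_derivative[OF dw]])
    then have "((\<lambda>s. \<bar>(prim p (cmod (w s)) - prim p (cmod (w t))) / (s - t)\<bar>) \<longlongrightarrow> \<bar>slope p (cmod (w t)) * ?D\<bar>) (at_right t)"
      unfolding has_field_derivative_iff by (rule tendsto_rabs)
    with 1 have "((\<lambda>s. p * (\<bar>Arg (z s / z t)\<bar> / \<bar>s - t\<bar>) + \<bar>(prim p (cmod (w s)) - prim p (cmod (w t))) / (s - t)\<bar>)
        \<longlongrightarrow> p * \<bar>Im (cnj (q t) * w t / z t)\<bar> + \<bar>slope p (cmod (w t)) * ?D\<bar>) (at_right t)"
      by (intro tendsto_add tendsto_mult_left)
    moreover have adm: "(p\<^sup>2 - 1) * (cmod (w t))\<^sup>2 \<le> 1"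
      using admissible_mono[of "cmod (w t)" R p] R[OF tT(1)] p by simp
    then have "p * \<bar>Im (cnj (q t) * w t / z t)\<bar> + \<bar>slope p (cmod (w t)) * ?D\<bar> < cmod (q t) + e"
      using calibration_bound[OF norm_z[OF tT(1)] p(1) adm, of "q t"] slope_nonneg[OF adm] e
      by (simp add: abs_mult)
    ultimately have "\<forall>\<^sub>F s in at_right t.
       p * (\<bar>Arg (z s / z t)\<bar> / \<bar>s - t\<bar>) + \<bar>(prim p (cmod (w s)) - prim p (cmod (w t))) / (s - t)\<bar> < cmod (q t) + e"
      by (rule order_tendstoD(2))
    moreover have "\<forall>\<^sub>F s in at_right t. s \<in> {t<..<b}" using t by (intro eventually_at_right_real) auto
    ultimately show "\<forall>\<^sub>F s in at_right t. ?f s - ?f t \<le> (cmod (q t) + e) * (s - t)"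
    proof eventually_elim
      case (elim s)
      have "?f s - ?f t \<le> p * \<bar>Arg (z s / z t)\<bar> + \<bar>prim p (cmod (w s)) - prim p (cmod (w t))\<bar>"
        using elim tT ab by (intro inc) auto
      also have "\<dots> = (p * (\<bar>Arg (z s / z t)\<bar> / \<bar>s - t\<bar>) + \<bar>(prim p (cmod (w s)) - prim p (cmod (w t))) / (s - t)\<bar>) * (s - t)"
        using elim by (simp add: abs_divide distrib_right)
      also have "\<dots> \<le> (cmod (q t) + e) * (s - t)" using elim by (intro mult_right_mono) auto
      finally show ?case .
    qed
  qed auto
qed

text \<open>Here \<open>R\<close> is the maximum of |w| and is fixed before \<open>p\<close>, so
  that \<open>p\<close> can afterwards be adapted to the competitor.\<close>

lemma length_lower_bound:
  assumes "z 0 = 1" "w 0 = 0"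
  obtains R where "cmod (w T) \<le> R"
    "\<And>p. 0 \<le> p \<Longrightarrow> (p\<^sup>2 - 1) * R\<^sup>2 \<le> 1 \<Longrightarrow>
      p * \<bar>Arg (z T)\<bar> + 2 * prim p R - prim p (cmod (w T)) \<le> integral {0..T} (\<lambda>t. cmod (q t))"
proof -
  have "continuous_on {0..T} (\<lambda>t. cmod (w t))"
    by (intro continuous_intros lipschitz_on_continuous_on[OF w_lip])
  then obtain m where m: "m \<in> {0..T}" "\<And>t. t \<in> {0..T} \<Longrightarrow> cmod (w t) \<le> cmod (w m)"
    using continuous_attains_sup[of "{0..T}" "\<lambda>t. cmod (w t)"] T by auto
  show ?thesis
  proof (rule that[of "cmod (w m)"])
    show "cmod (w T) \<le> cmod (w m)" using m T by simp
    fix p :: real assume p: "0 \<le> p" "(p\<^sup>2 - 1) * (cmod (w m))\<^sup>2 \<le> 1"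
    have "(p * \<bar>Arg (z m)\<bar> + 1 * prim p (cmod (w m))) - (p * \<bar>Arg (z 0)\<bar> + 1 * prim p (cmod (w 0)))
      \<le> integral {0..m} (\<lambda>t. cmod (q t))"
      by (rule calibrated_increment[OF _ _ _ p]) (use m in auto)
    moreover have "(p * \<bar>Arg (z T)\<bar> + (-1) * prim p (cmod (w T))) - (p * \<bar>Arg (z m)\<bar> + (-1) * prim p (cmod (w m)))
      \<le> integral {m..T} (\<lambda>t. cmod (q t))"
      by (rule calibrated_increment[OF _ _ _ p]) (use m in auto)
    moreover have "integral {0..m} (\<lambda>t. cmod (q t)) + integral {m..T} (\<lambda>t. cmod (q t)) = integral {0..T} (\<lambda>t. cmod (q t))"
      using m by (intro Henstock_Kurzweil_Integration.integral_combine q_integrable) auto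
    ultimately show "p * \<bar>Arg (z T)\<bar> + 2 * prim p (cmod (w m)) - prim p (cmod (w T)) \<le> integral {0..T} (\<lambda>t. cmod (q t))"
      using assms by simp
  qed
qed

end

section \<open>Complex coordinates on the matrices\<close>

definition cz :: "real^2^2 \<Rightarrow> complex" where
  "cz X = Complex ((X $ 1 $ 1 + X $ 2 $ 2) / 2) ((X $ 1 $ 2 - X $ 2 $ 1) / 2)"

definition cw :: "real^2^2 \<Rightarrow> complex" where
  "cw X = Complex ((X $ 1 $ 1 - X $ 2 $ 2) / 2) ((X $ 1 $ 2 + X $ 2 $ 1) / 2)"

definition mat_of :: "complex \<Rightarrow> complex \<Rightarrow> real^2^2" where
  "mat_of z w = vector [vector [Re z + Re w, Im z + Im w], vector [Im w - Im z, Re z - Re w]]"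

lemma mat2_eq_iff: "X = Y \<longleftrightarrow> X $ 1 $ 1 = Y $ 1 $ 1 \<and> X $ 1 $ 2 = Y $ 1 $ 2 \<and> X $ 2 $ 1 = Y $ 2 $ 1 \<and> X $ 2 $ 2 = Y $ 2 $ 2"
  for X Y :: "'a^2^2"
  by (auto simp: vec_eq_iff forall_2)

lemma cz_mat_of [simp]: "cz (mat_of z w) = z" and cw_mat_of [simp]: "cw (mat_of z w) = w"
  by (simp_all add: cz_def cw_def mat_of_def complex_eq_iff)

lemma mat_of_cz_cw [simp]: "mat_of (cz X) (cw X) = X"
  by (simp add: cz_def cw_def mat_of_def mat2_eq_iff field_simps)

lemma mat_eq_complex_iff: "X = Y \<longleftrightarrow> cz X = cz Y \<and> cw X = cw Y"
  by (metis mat_of_cz_cw)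

lemma cz_cw_one [simp]: "cz (mat 1) = 1" "cw (mat 1) = 0"
  by (simp_all add: cz_def cw_def mat_def complex_eq_iff)

text \<open>Under the identification of R^2 with the complex plane, \<open>X\<close> acts as u ->
  cnj (cz X) u + cw X cnj u; the formulas compose two such maps.\<close>

lemma cz_mult: "cz (X ** Y) = cz X * cz Y + cnj (cw X) * cw Y"
  and cw_mult: "cw (X ** Y) = cw X * cz Y + cnj (cz X) * cw Y"
  by (simp_all add: cz_def cw_def matrix_matrix_mult_def sum_2 complex_eq_iff field_simps)

lemma cz_add [simp]: "cz (X + Y) = cz X + cz Y" and cw_add [simp]: "cw (X + Y) = cw X + cw Y"
  and cz_scaleR [simp]: "cz (r *\<^sub>R X) = complex_of_real r * cz X"
  and cw_scaleR [simp]: "cw (r *\<^sub>R X) = complex_of_real r * cw X"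
  by (simp_all add: cz_def cw_def complex_eq_iff field_simps)

lemma cz_minus [simp]: "cz (- X) = - cz X" and cw_minus [simp]: "cw (- X) = - cw X"
  by (simp_all add: cz_def cw_def complex_eq_iff field_simps)

lemma det_complex: "det X = (cmod (cz X))\<^sup>2 - (cmod (cw X))\<^sup>2"
  unfolding cmod_power2 by (simp add: det_2 cz_def cw_def power2_eq_square field_simps)

lemma SL2_iff: "X \<in> SL2 \<longleftrightarrow> (cmod (cz X))\<^sup>2 = 1 + (cmod (cw X))\<^sup>2"
  by (auto simp: SL2_def det_complex)

lemma bounded_linear_cz: "bounded_linear cz" and bounded_linear_cw: "bounded_linear cw"
  by (auto intro!: linear_conv_bounded_linear[THEN iffD1] linearI simp: scaleR_conv_of_real[where 'a = complex])

lemma bounded_linear_mat_of: "bounded_linear (\<lambda>(z, w). mat_of z w)"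
  by (auto intro!: linear_conv_bounded_linear[THEN iffD1] linearI simp: mat_of_def mat2_eq_iff field_simps)

lemma has_vector_derivative_mat_of:
  assumes "(z has_vector_derivative z') (at t within A)" "(w has_vector_derivative w') (at t within A)"
  shows "((\<lambda>t. mat_of (z t) (w t)) has_vector_derivative mat_of z' w') (at t within A)"
  using bounded_linear.has_vector_derivative[OF bounded_linear_mat_of has_vector_derivative_Pair[OF assms]] by simp

lemma cz_cw_basis:
  "cz A0 = - \<i> / 2" "cw A0 = 0" "cz A1 = 0" "cw A1 = \<i> / 2" "cz A2 = 0" "cw A2 = 1 / 2"
  by (simp_all add: A0_def A1_def A2_def cz_def cw_def complex_eq_iff)

lemma span_pair: "V \<in> span {x, y} \<longleftrightarrow> (\<exists>u v. V = u *\<^sub>R x + v *\<^sub>R y)"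
proof -
  have "V \<in> span {x, y} \<longleftrightarrow> (\<exists>u v. V - u *\<^sub>R x - v *\<^sub>R y = 0)"
    by (simp add: span_breakdown_eq)
  then show ?thesis by (simp add: algebra_simps eq_diff_eq)
qed

text \<open>Membership means V = B X with B in the span of \<open>A1\<close> and \<open>A2\<close>,
  that is \<open>cz B = 0\<close> and \<open>cw B = q\<close>; the product formulas do the rest. The
  coefficients of \<open>A1\<close> and \<open>A2\<close> are 2 Im q and 2 Re q.\<close>

lemma distribution_iff:
  "V \<in> distribution X \<longleftrightarrow> (\<exists>q. cz V = cnj q * cw X \<and> cw V = q * cz X)"
proof
  assume "V \<in> distribution X"
  then obtain u v where V: "V = u *\<^sub>R (A1 ** X) + v *\<^sub>R (A2 ** X)"
    by (auto simp: distribution_def span_pair)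
  show "\<exists>q. cz V = cnj q * cw X \<and> cw V = q * cz X"
    by (rule exI[of _ "Complex (v / 2) (u / 2)"])
      (simp add: V cz_mult cw_mult cz_cw_basis complex_eq_iff field_simps)
next
  assume "\<exists>q. cz V = cnj q * cw X \<and> cw V = q * cz X"
  then obtain q where q: "cz V = cnj q * cw X" "cw V = q * cz X" by blast
  have "V = (2 * Im q) *\<^sub>R (A1 ** X) + (2 * Re q) *\<^sub>R (A2 ** X)"
    unfolding mat_eq_complex_iff
    by (simp add: q cz_mult cw_mult cz_cw_basis complex_eq_iff field_simps)
  then show "V \<in> distribution X" by (auto simp: distribution_def span_pair)
qed

lemma sr_metric_complex:
  assumes "X \<in> SL2" "cz V = cnj q * cw X" "cw V = q * cz X"
  shows "sr_metric X V V = (2 * cmod q)\<^sup>2"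
proof -
  define B where "B = mat_of 0 q"
  have "V = B ** X" by (simp add: mat_eq_complex_iff B_def cz_mult cw_mult assms)
  moreover have "invertible X" using assms(1) by (simp add: SL2_def invertible_det_nz)
  then have "X ** matrix_inv X = mat 1"
    unfolding invertible_def matrix_inv_def by (metis (mono_tags, lifting) someI_ex)
  ultimately have "V ** matrix_inv X = B" by (simp add: matrix_mul_assoc[symmetric])
  then show ?thesis
    by (simp add: sr_metric_def B_def mat_of_def trace_def sum_2 matrix_matrix_mult_def transpose_def
        cmod_power2 power_mult_distrib) (simp add: power2_eq_square)
qed

lemma sr_length_trivial: "sr_length \<gamma> 0 = 0"
  by (simp add: sr_length_def)

lemma horizontal_curve_complex:
  assumes "horizontal_curve \<gamma> T"
  obtains q L N where "horizontal_complex (cz \<circ> \<gamma>) (cw \<circ> \<gamma>) q T L N"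
    "sr_length \<gamma> T = 2 * integral {0..T} (\<lambda>t. cmod (q t))"
proof -
  have T: "0 \<le> T" and SL: "\<And>t. t \<in> {0..T} \<Longrightarrow> \<gamma> t \<in> SL2"
    using assms by (auto simp: horizontal_curve_def)
  obtain L where L: "L-lipschitz_on {0..T} \<gamma>" using assms by (auto simp: horizontal_curve_def)
  obtain K1 where K1: "\<And>X. norm (cz X) \<le> norm X * K1" "0 < K1" using bounded_linear.pos_bounded[OF bounded_linear_cz] by blast
  obtain K2 where K2: "\<And>X. norm (cw X) \<le> norm X * K2" "0 < K2" using bounded_linear.pos_bounded[OF bounded_linear_cw] by blast
  have L0: "0 \<le> L" using L by (rule lipschitz_on_nonneg)
  have "L * K1 \<ge> 0" "L * K2 \<ge> 0" using L0 K1 K2 by simp_all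
  have lip: "(L * K1 + L * K2)-lipschitz_on {0..T} (f \<circ> \<gamma>)"
    if f: "f = cz \<or> f = cw" for f :: "real^2^2 \<Rightarrow> complex"
  proof (rule lipschitz_onI)
    fix s t assume st: "s \<in> {0..T}" "t \<in> {0..T}"
    have "dist ((f \<circ> \<gamma>) s) ((f \<circ> \<gamma>) t) = norm (f (\<gamma> s - \<gamma> t))"
      using f bounded_linear_cz bounded_linear_cw by (auto simp: dist_norm bounded_linear.linear linear_diff)
    also have "\<dots> \<le> norm (\<gamma> s - \<gamma> t) * (K1 + K2)"
      using f K1 K2 by (auto simp: distrib_left add_increasing add_increasing2)
    also have "\<dots> \<le> L * dist s t * (K1 + K2)"
      using lipschitz_onD[OF L st] K1 K2 by (intro mult_right_mono) (auto simp: dist_norm)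
    finally show "dist ((f \<circ> \<gamma>) s) ((f \<circ> \<gamma>) t) \<le> (L * K1 + L * K2) * dist s t"
      by (simp add: algebra_simps)
  qed (use \<open>L * K1 \<ge> 0\<close> \<open>L * K2 \<ge> 0\<close> in simp)
  let ?P = "\<lambda>t. \<exists>V\<in>distribution (\<gamma> t). (\<gamma> has_vector_derivative V) (at t within {0..T})"
  have "AE t in lebesgue_on {0..T}. ?P t" using assms unfolding horizontal_curve_def by blast
  then obtain N where N: "{t \<in> space (lebesgue_on {0..T}). \<not> ?P t} \<subseteq> N" "emeasure (lebesgue_on {0..T}) N = 0"
    "N \<in> sets (lebesgue_on {0..T})"
    by (rule AE_E)
  then have "N \<in> null_sets (lebesgue_on {0..T})" by (intro null_setsI)
  then have negl: "negligible N" by (auto simp: negligible_iff_null_sets null_sets_restrict_space)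
  have "\<exists>q V. cz V = cnj q * cw (\<gamma> t) \<and> cw V = q * cz (\<gamma> t) \<and> (\<gamma> has_vector_derivative V) (at t within {0..T})"
    if "t \<in> {0..T} - N" for t
    using N(1) that by (fastforce simp: distribution_iff)
  then obtain q V where qV: "\<And>t. t \<in> {0..T} - N \<Longrightarrow> cz (V t) = cnj (q t) * cw (\<gamma> t)"
    "\<And>t. t \<in> {0..T} - N \<Longrightarrow> cw (V t) = q t * cz (\<gamma> t)"
    "\<And>t. t \<in> {0..T} - N \<Longrightarrow> (\<gamma> has_vector_derivative V t) (at t within {0..T})"
    by metis
  have "horizontal_complex (cz \<circ> \<gamma>) (cw \<circ> \<gamma>) q T (L * K1 + L * K2) N"
  proof
    show "((cz \<circ> \<gamma>) has_vector_derivative cnj (q t) * (cw \<circ> \<gamma>) t) (at t within {0..T})" if "t \<in> {0..T} - N" for t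
      using bounded_linear.has_vector_derivative[OF bounded_linear_cz qV(3)[OF that]] qV(1)[OF that] by (simp add: o_def)
    show "((cw \<circ> \<gamma>) has_vector_derivative q t * (cz \<circ> \<gamma>) t) (at t within {0..T})" if "t \<in> {0..T} - N" for t
      using bounded_linear.has_vector_derivative[OF bounded_linear_cw qV(3)[OF that]] qV(2)[OF that] by (simp add: o_def)
  qed (use T lip negl SL in \<open>auto simp: SL2_iff\<close>)
  moreover have "sr_length \<gamma> T = 2 * integral {0..T} (\<lambda>t. cmod (q t))"
  proof (cases "T = 0")
    case False
    then have T0: "0 < T" using T by simp
    have "sr_length \<gamma> T = integral {0..T} (\<lambda>t. 2 * cmod (q t))"
      unfolding sr_length_def
    proof (rule integral_spike[OF negl])
      fix t assume t: "t \<in> {0..T} - N"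
      have "vector_derivative \<gamma> (at t within {0..T}) = V t"
        using t by (intro vector_derivative_within_closed_interval[OF T0 _ qV(3)]) auto
      then show "2 * cmod (q t) = (let V = vector_derivative \<gamma> (at t within {0..T}) in sqrt (sr_metric (\<gamma> t) V V))"
        using sr_metric_complex[OF SL qV(1,2)[OF t]] t by (simp add: real_sqrt_mult)
    qed
    then show ?thesis by simp
  qed (simp add: sr_length_trivial)
  ultimately show ?thesis by (rule that)
qed

lemma sr_length_lower_bound:
  assumes "horizontal_curve \<gamma> T" "\<gamma> 0 = mat 1"
  obtains R where "cmod (cw (\<gamma> T)) \<le> R"
    "\<And>p. 0 \<le> p \<Longrightarrow> (p\<^sup>2 - 1) * R\<^sup>2 \<le> 1 \<Longrightarrow>
      p * \<bar>Arg (cz (\<gamma> T))\<bar> + 2 * prim p R - prim p (cmod (cw (\<gamma> T))) \<le> sr_length \<gamma> T / 2"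
proof -
  obtain q L N where h: "horizontal_complex (cz \<circ> \<gamma>) (cw \<circ> \<gamma>) q T L N"
    and len: "sr_length \<gamma> T = 2 * integral {0..T} (\<lambda>t. cmod (q t))"
    using horizontal_curve_complex[OF assms(1)] .
  show ?thesis
    by (rule horizontal_complex.length_lower_bound[OF h]) (use assms(2) len that in auto)
qed

lemma sr_length_nonneg: "horizontal_curve \<gamma> T \<Longrightarrow> 0 \<le> sr_length \<gamma> T"
  by (erule horizontal_curve_complex) (simp add: integral_nonneg horizontal_complex.q_integrable)

section \<open>The matrix exponential and closed formulas for the geodesics\<close>

lemma matrix_exp_eqI:
  fixes A :: "real^2^2" and a b :: "nat \<Rightarrow> real"
  assumes "A ** A = \<kappa> *\<^sub>R mat 1" "a 0 = 1" "b 0 = 0"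
    and "\<And>n. a (Suc n) = \<kappa> * b n" "\<And>n. b (Suc n) = a n"
    and "(\<lambda>n. a n / fact n) sums \<alpha>" "(\<lambda>n. b n / fact n) sums \<beta>"
  shows "matrix_exp A = \<alpha> *\<^sub>R mat 1 + \<beta> *\<^sub>R A"
proof -
  have pow: "(((**) A) ^^ n) (mat 1) = a n *\<^sub>R mat 1 + b n *\<^sub>R A" for n
  proof (induction n)
    case (Suc n)
    have "(((**) A) ^^ Suc n) (mat 1) = A ** (a n *\<^sub>R mat 1 + b n *\<^sub>R A)" using Suc by simp
    also have "\<dots> = a n *\<^sub>R A + b n *\<^sub>R (A ** A)"
      by (simp add: mat_eq_complex_iff cz_mult cw_mult algebra_simps)
    finally show ?case using assms by (simp add: mult.commute)
  qed (use assms in simp)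
  have "(\<lambda>n. (a n / fact n) *\<^sub>R mat 1 + (b n / fact n) *\<^sub>R A) sums (\<alpha> *\<^sub>R mat 1 + \<beta> *\<^sub>R A)"
    by (intro sums_add sums_scaleR_left assms)
  then have "(\<lambda>n. (1 / fact n) *\<^sub>R (((**) A) ^^ n) (mat 1)) sums (\<alpha> *\<^sub>R mat 1 + \<beta> *\<^sub>R A)"
    by (simp add: pow scaleR_add_right)
  then show ?thesis unfolding matrix_exp_def by (rule sums_unique[symmetric])
qed

text \<open>All powers of \<open>A\<close> lie in the span of 1 and \<open>A\<close>. The recursion
  of their coordinates is solved by the roots of x^2 = kappa, which are real for positive kappa and
  imaginary for negative kappa; for kappa = 0 the series stops after two terms.\<close>

lemma matrix_exp_square_scalar:
  fixes A :: "real^2^2"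
  assumes "A ** A = \<kappa> *\<^sub>R mat 1"
  shows "matrix_exp A = cs \<kappa> 1 *\<^sub>R mat 1 + sn \<kappa> 1 *\<^sub>R A"
proof -
  consider "\<kappa> > 0" | "\<kappa> < 0" | "\<kappa> = 0" by linarith
  then show ?thesis
  proof cases
    case 1
    define r where "r = sqrt \<kappa>"
    have r: "r > 0" "r * r = \<kappa>" using 1 by (auto simp: r_def)
    have s: "(\<lambda>n. r ^ n / fact n) sums exp r" "(\<lambda>n. (- r) ^ n / fact n) sums exp (- r)"
      using exp_converges[of r] exp_converges[of "- r"] by (auto simp: divide_inverse mult.commute)
    show ?thesis
    proof (rule matrix_exp_eqI[OF assms, of "\<lambda>n. (r ^ n + (- r) ^ n) / 2" "\<lambda>n. (r ^ n - (- r) ^ n) / (2 * r)"])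
      show "(\<lambda>n. (r ^ n + (- r) ^ n) / 2 / fact n) sums cs \<kappa> 1"
        using sums_divide[OF sums_add[OF s], of 2] 1
        by (simp add: cs_def cosh_def r_def[symmetric] add_divide_distrib divide_divide_eq_left mult.commute)
      show "(\<lambda>n. (r ^ n - (- r) ^ n) / (2 * r) / fact n) sums sn \<kappa> 1"
        using sums_divide[OF sums_diff[OF s], of "2 * r"] 1
        by (simp add: sn_def sinh_def r_def[symmetric] diff_divide_distrib divide_divide_eq_left mult.commute mult.left_commute)
    qed (use r in \<open>auto simp: field_simps\<close>)
  next
    case 2
    define r where "r = sqrt (- \<kappa>)"
    have r: "r > 0" "r * r = - \<kappa>" using 2 by (auto simp: r_def)
    have s: "(\<lambda>n. (\<i> * complex_of_real r) ^ n / fact n) sums exp (\<i> * complex_of_real r)"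
      using exp_converges[of "\<i> * complex_of_real r"] by (simp add: scaleR_conv_of_real divide_inverse mult.commute)
    have e: "exp (\<i> * complex_of_real r) = cis r" by (simp add: cis_conv_exp)
    have f: "Re (x / fact n) = Re x / fact n" "Im (x / fact n) = Im x / fact n" for x n
      by (metis Re_divide_of_real of_real_fact) (metis Im_divide_of_real of_real_fact)
    show ?thesis
    proof (rule matrix_exp_eqI[OF assms, of "\<lambda>n. Re ((\<i> * complex_of_real r) ^ n)" "\<lambda>n. Im ((\<i> * complex_of_real r) ^ n) / r"])
      show "(\<lambda>n. Re ((\<i> * complex_of_real r) ^ n) / fact n) sums cs \<kappa> 1"
        using sums_Re[OF s] 2 by (simp add: e f cs_def r_def[symmetric])
      show "(\<lambda>n. Im ((\<i> * complex_of_real r) ^ n) / r / fact n) sums sn \<kappa> 1"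
        using sums_divide[OF sums_Im[OF s], of r] 2
        by (simp add: e f sn_def r_def[symmetric] divide_divide_eq_left mult.commute)
      show "Re ((\<i> * complex_of_real r) ^ Suc n) = \<kappa> * (Im ((\<i> * complex_of_real r) ^ n) / r)" for n
      proof -
        have "\<kappa> = - (r * r)" using r by simp
        then show ?thesis using r(1) by simp
      qed
    qed (use r in \<open>auto simp: field_simps\<close>)
  next
    case 3
    show ?thesis
    proof (rule matrix_exp_eqI[OF assms, of "\<lambda>n. if n = 0 then 1 else 0" "\<lambda>n. if n = 1 then 1 else 0"])
      show "(\<lambda>n. (if n = 0 then 1 else 0) / fact n) sums cs \<kappa> 1"
      proof -
        have "(\<lambda>n. (if n = 0 then 1 else 0) / fact n) = (\<lambda>n. if n = 0 then 1 else 0 :: real)" by auto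
        then show ?thesis using sums_single[of 0 "\<lambda>_. 1::real"] 3 by simp
      qed
      show "(\<lambda>n. (if n = 1 then 1 else 0) / fact n) sums sn \<kappa> 1"
      proof -
        have "(\<lambda>n. (if n = 1 then 1 else 0) / fact n) = (\<lambda>n. if n = 1 then 1 else 0 :: real)" by auto
        then show ?thesis using sums_single[of 1 "\<lambda>_. 1::real"] 3 by simp
      qed
    qed (use 3 in auto)
  qed
qed

definition geo_z :: "real \<Rightarrow> real \<Rightarrow> complex" where
  "geo_z c t = cis (c * t) * (complex_of_real (cs (1 - c\<^sup>2) t) - \<i> * complex_of_real (c * sn (1 - c\<^sup>2) t))"

definition geo_w :: "real \<Rightarrow> complex \<Rightarrow> real \<Rightarrow> complex" where
  "geo_w c \<eta> t = cis (- (c * t)) * complex_of_real (sn (1 - c\<^sup>2) t) * \<eta>"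

text \<open>Here \<open>t\<close> is arclength again, hence the halves. The unit number \<eta> is
  the initial direction, twice the coordinate \<open>cw P\<close>.\<close>

definition geo :: "real \<Rightarrow> complex \<Rightarrow> real \<Rightarrow> real^2^2" where
  "geo c \<eta> t = mat_of (geo_z c (t / 2)) (geo_w c \<eta> (t / 2))"

text \<open>The exponent t (c A0 + P) squares to (1 - c^2) (t / 2)^2 times the identity, and the
  other factor is a rotation. Time 0 is treated apart because the rescaling divides by
  \<open>t\<close>.\<close>

lemma geodesic_curve_eq_geo:
  assumes "cmod \<eta> = 1"
  shows "geodesic_curve c (mat_of 0 (\<eta> / 2)) t = geo c \<eta> t"
proof (cases "t = 0")
  case True
  have "matrix_exp (0 :: real^2^2) = mat 1"
    using matrix_exp_square_scalar[of 0 0] by simp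
  then have "geodesic_curve c (mat_of 0 (\<eta> / 2)) t = mat 1"
    using True by (simp add: geodesic_curve_def)
  with True show ?thesis
    by (simp add: geo_def geo_z_def geo_w_def mat_eq_complex_iff)
next
  case False
  then have t: "t / 2 \<noteq> 0" by simp
  define k where "k = 1 - c\<^sup>2"
  define M where "M = t *\<^sub>R (c *\<^sub>R A0 + mat_of 0 (\<eta> / 2))"
  have M: "cz M = - \<i> * complex_of_real (c * (t / 2))" "cw M = complex_of_real (t / 2) * \<eta>"
    by (simp_all add: M_def cz_cw_basis mult.commute)
  have "cnj \<eta> * \<eta> = 1" using assms(1) by (metis complex_norm_square mult.commute of_real_1 one_power2)
  moreover have "cz (M ** M) = complex_of_real ((t / 2)\<^sup>2) * (cnj \<eta> * \<eta> - complex_of_real (c\<^sup>2))"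
    by (simp add: cz_mult M power2_eq_square algebra_simps)
  moreover have "cw (M ** M) = 0" by (simp add: cw_mult M)
  ultimately have "M ** M = (k * (t / 2)\<^sup>2) *\<^sub>R mat 1"
    by (simp add: mat_eq_complex_iff k_def mult.commute)
  from matrix_exp_square_scalar[OF this]
  have eM: "matrix_exp M = cs k (t / 2) *\<^sub>R mat 1 + (sn k (t / 2) / (t / 2)) *\<^sub>R M"
    using sn_rescale[OF t, of "k * (t / 2)\<^sup>2"] cs_rescale[OF t, of "k * (t / 2)\<^sup>2"] t by simp
  define D where "D = - (c * t) *\<^sub>R A0"
  have D: "cz D = \<i> * complex_of_real (c * (t / 2))" "cw D = 0"
    by (simp_all add: D_def cz_cw_basis mult.commute del: scaleR_minus_left)
  have "D ** D = (- (c * (t / 2))\<^sup>2) *\<^sub>R mat 1"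
    by (simp add: mat_eq_complex_iff cz_mult cw_mult D power2_eq_square algebra_simps)
  note eD' = matrix_exp_square_scalar[OF this]
  have eD: "cz (matrix_exp D) = cis (c * (t / 2))" "cw (matrix_exp D) = 0"
  proof -
    define x where "x = c * (t / 2)"
    have "cs (- x\<^sup>2) 1 = cos x" "sn (- x\<^sup>2) 1 * x = sin x"
      by (cases "0 \<le> x"; cases "x = 0"; simp add: cs_def sn_def)+
    then show "cz (matrix_exp D) = cis (c * (t / 2))" "cw (matrix_exp D) = 0"
      using eD' D unfolding x_def[symmetric] by (auto simp: complex_eq_iff)
  qed
  show ?thesis
    unfolding geodesic_curve_def geo_def mat_eq_complex_iff M_def[symmetric] D_def[symmetric]
    using t
    by (simp add: cz_mult cw_mult eD eM M geo_z_def geo_w_def k_def[symmetric] cis_cnj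
        algebra_simps)
qed

lemma cmod_geo_z: "(cmod (geo_z c t))\<^sup>2 = 1 + (sn (1 - c\<^sup>2) t)\<^sup>2"
proof -
  have "(cmod (geo_z c t))\<^sup>2 = (cs (1 - c\<^sup>2) t)\<^sup>2 + (c * sn (1 - c\<^sup>2) t)\<^sup>2"
    by (simp add: geo_z_def norm_mult power_mult_distrib cmod_power2)
  then show ?thesis by (simp add: cs_sn_sum)
qed

lemma cmod_geo_w: "cmod \<eta> = 1 \<Longrightarrow> cmod (geo_w c \<eta> t) = \<bar>sn (1 - c\<^sup>2) t\<bar>"
  by (simp add: geo_w_def norm_mult)

lemma has_vector_derivative_cis:
  "((\<lambda>t. cis (a * t)) has_vector_derivative (\<i> * complex_of_real a * cis (a * t))) (at t within A)"
proof -
  have "((\<lambda>t. exp (\<i> * complex_of_real a * complex_of_real t)) has_vector_derivative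
      (\<i> * complex_of_real a * exp (\<i> * complex_of_real a * complex_of_real t))) (at t within A)"
    by (rule has_vector_derivative_real_field) (auto intro!: derivative_eq_intros)
  then show ?thesis unfolding cis_conv_exp of_real_mult mult.assoc .
qed

lemma has_vector_derivative_geo_z:
  "(geo_z c has_vector_derivative cis (c * t) * complex_of_real (sn (1 - c\<^sup>2) t)) (at t within A)"
proof -
  let ?k = "1 - c\<^sup>2"
  have C: "((\<lambda>t. complex_of_real (cs ?k t)) has_vector_derivative complex_of_real (?k * sn ?k t)) (at t within A)"
    using DERIV_cs[OF DERIV_ident, of ?k t A]
    by (intro has_vector_derivative_of_real) (simp add: has_real_derivative_iff_has_vector_derivative)
  have S: "((\<lambda>t. \<i> * complex_of_real (c * sn ?k t)) has_vector_derivative \<i> * complex_of_real (c * cs ?k t)) (at t within A)"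
    using DERIV_cmult[OF DERIV_sn[OF DERIV_ident, of ?k t A], of c]
    by (intro has_vector_derivative_mult_right has_vector_derivative_of_real)
      (simp add: has_real_derivative_iff_has_vector_derivative)
  have "(geo_z c has_vector_derivative
      cis (c * t) * (complex_of_real (?k * sn ?k t) - \<i> * complex_of_real (c * cs ?k t))
      + \<i> * complex_of_real c * cis (c * t) * (complex_of_real (cs ?k t) - \<i> * complex_of_real (c * sn ?k t))) (at t within A)"
    unfolding geo_z_def[abs_def]
    by (intro has_vector_derivative_mult has_vector_derivative_diff C S has_vector_derivative_cis)
  moreover have "cis (c * t) * (complex_of_real (?k * sn ?k t) - \<i> * complex_of_real (c * cs ?k t))
      + \<i> * complex_of_real c * cis (c * t) * (complex_of_real (cs ?k t) - \<i> * complex_of_real (c * sn ?k t))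
      = cis (c * t) * complex_of_real (sn ?k t)"
    by (simp add: algebra_simps power2_eq_square)
  ultimately show ?thesis by simp
qed

lemma has_vector_derivative_geo_w:
  "(geo_w c \<eta> has_vector_derivative cis (- (2 * c * t)) * \<eta> * geo_z c t) (at t within A)"
proof -
  let ?k = "1 - c\<^sup>2"
  have S: "((\<lambda>t. complex_of_real (sn ?k t)) has_vector_derivative complex_of_real (cs ?k t)) (at t within A)"
    using DERIV_sn[OF DERIV_ident, of ?k t A]
    by (intro has_vector_derivative_of_real) (simp add: has_real_derivative_iff_has_vector_derivative)
  have d: "(geo_w c \<eta> has_vector_derivative
      (cis (- c * t) * complex_of_real (cs ?k t)
      + \<i> * complex_of_real (- c) * cis (- c * t) * complex_of_real (sn ?k t)) * \<eta>) (at t within A)"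
    unfolding geo_w_def[abs_def] mult_minus_left[symmetric]
    by (intro has_vector_derivative_mult_left has_vector_derivative_mult S has_vector_derivative_cis)
  have m: "cis (- (2 * c * t)) * geo_z c t
    = cis (- c * t) * (complex_of_real (cs ?k t) - \<i> * complex_of_real (c * sn ?k t))"
    unfolding geo_z_def mult.assoc[symmetric] cis_mult by simp
  have "cis (- (2 * c * t)) * \<eta> * geo_z c t = (cis (- (2 * c * t)) * geo_z c t) * \<eta>" by (simp only: mult_ac)
  also have "\<dots> = (cis (- c * t) * complex_of_real (cs ?k t)
      + \<i> * complex_of_real (- c) * cis (- c * t) * complex_of_real (sn ?k t)) * \<eta>"
    unfolding m by (simp add: algebra_simps)
  finally have "(cis (- c * t) * complex_of_real (cs ?k t)
      + \<i> * complex_of_real (- c) * cis (- c * t) * complex_of_real (sn ?k t)) * \<eta>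
    = cis (- (2 * c * t)) * \<eta> * geo_z c t" by (rule sym)
  with d show ?thesis by (simp only:)
qed

text \<open>The control rotates with constant modulus 1 / 2, which is unit speed.\<close>

lemma has_vector_derivative_geo:
  fixes c :: real
  assumes "cmod \<eta> = 1"
  defines "q \<equiv> \<lambda>t. cis (- (c * t)) * \<eta> / 2"
  shows "(geo c \<eta> has_vector_derivative mat_of (cnj (q t) * cw (geo c \<eta> t)) (q t * cz (geo c \<eta> t))) (at t within A)"
proof -
  have half: "((\<lambda>t. t / 2) has_vector_derivative 1 / 2) (at t within A)"
    by (simp add: has_real_derivative_iff_has_vector_derivative[symmetric]) (auto intro!: derivative_eq_intros)
  have "\<eta> * cnj \<eta> = 1" using assms(1) complex_norm_square[of \<eta>] by simp
  then have "cnj (q t) * geo_w c \<eta> (t / 2) = (cis (c * t) * cis (- (c * (t / 2)))) * complex_of_real (sn (1 - c\<^sup>2) (t / 2)) / 2"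
    by (simp add: q_def geo_w_def cis_cnj mult_ac)
  also have "cis (c * t) * cis (- (c * (t / 2))) = cis (c * (t / 2))" by (simp add: cis_mult)
  finally have zq: "(1 / 2) *\<^sub>R (cis (c * (t / 2)) * complex_of_real (sn (1 - c\<^sup>2) (t / 2))) = cnj (q t) * geo_w c \<eta> (t / 2)"
    by (simp add: scaleR_conv_of_real)
  have wq: "(1 / 2) *\<^sub>R (cis (- (2 * c * (t / 2))) * \<eta> * geo_z c (t / 2)) = q t * geo_z c (t / 2)"
    by (simp add: q_def scaleR_conv_of_real)
  have "((\<lambda>t. geo_z c (t / 2)) has_vector_derivative cnj (q t) * geo_w c \<eta> (t / 2)) (at t within A)"
    using vector_diff_chain_within[OF half has_vector_derivative_geo_z[of c "t / 2"]] unfolding zq by (simp add: o_def)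
  moreover have "((\<lambda>t. geo_w c \<eta> (t / 2)) has_vector_derivative q t * geo_z c (t / 2)) (at t within A)"
    using vector_diff_chain_within[OF half has_vector_derivative_geo_w[of c \<eta> "t / 2"]] unfolding wq by (simp add: o_def)
  ultimately show ?thesis unfolding geo_def[abs_def] cz_mat_of cw_mat_of by (rule has_vector_derivative_mat_of)
qed

lemma cz_geo [simp]: "cz (geo c \<eta> t) = geo_z c (t / 2)" and cw_geo [simp]: "cw (geo c \<eta> t) = geo_w c \<eta> (t / 2)"
  by (simp_all add: geo_def)

lemma geo_0 [simp]: "geo c \<eta> 0 = mat 1"
  by (simp add: mat_eq_complex_iff geo_z_def geo_w_def)

lemma geo_SL2: "cmod \<eta> = 1 \<Longrightarrow> geo c \<eta> t \<in> SL2"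
  by (simp add: SL2_iff cmod_geo_z cmod_geo_w)

lemma geo_horizontal:
  assumes "cmod \<eta> = 1" "0 \<le> T"
  shows "horizontal_curve (geo c \<eta>) T" "sr_length (geo c \<eta>) T = T"
proof -
  define q where "q = (\<lambda>t. cis (- (c * t)) * \<eta> / 2)"
  define V where "V t = mat_of (cnj (q t) * cw (geo c \<eta> t)) (q t * cz (geo c \<eta> t))" for t
  have d: "(geo c \<eta> has_vector_derivative V t) (at t within A)" for t A
    using has_vector_derivative_geo[OF assms(1)] unfolding V_def q_def .
  have nq: "cmod (q t) = 1 / 2" for t using assms(1) by (simp add: q_def norm_mult norm_divide)
  have contg: "continuous_on {0..T} (geo c \<eta>)"
    by (rule continuous_on_vector_derivative[OF d])
  have "continuous_on {0..T} q" unfolding q_def cis_conv_exp by (intro continuous_intros) auto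
  moreover have "continuous_on {0..T} (\<lambda>t. cz (geo c \<eta> t))" "continuous_on {0..T} (\<lambda>t. cw (geo c \<eta> t))"
    using bounded_linear.continuous_on[OF bounded_linear_cz contg] bounded_linear.continuous_on[OF bounded_linear_cw contg] .
  ultimately have "continuous_on {0..T} (\<lambda>t. (cnj (q t) * cw (geo c \<eta> t), q t * cz (geo c \<eta> t)))"
    by (intro continuous_on_Pair continuous_on_mult continuous_on_cnj)
  from bounded_linear.continuous_on[OF bounded_linear_mat_of this] have "continuous_on {0..T} V"
    by (simp add: V_def)
  then have "bounded (V ` {0..T})" by (intro compact_imp_bounded compact_continuous_image) auto
  then obtain B where "0 < B" "\<forall>x\<in>V ` {0..T}. norm x \<le> B" unfolding bounded_pos by blast
  then have B: "\<And>t. t \<in> {0..T} \<Longrightarrow> norm (V t) \<le> B" "0 < B" by blast+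
  have "B-lipschitz_on {0..T} (geo c \<eta>)"
  proof (rule bounded_derivative_imp_lipschitz[of _ _ "\<lambda>t h. h *\<^sub>R V t"])
    show "(geo c \<eta> has_derivative (\<lambda>h. h *\<^sub>R V t)) (at t within {0..T})" for t
      using d unfolding has_vector_derivative_def .
    show "onorm (\<lambda>h. h *\<^sub>R V t) \<le> B" if "t \<in> {0..T}" for t
      using B(1)[OF that] by (intro onorm_le) (simp add: mult.commute[of B] mult_left_mono)
  qed (use B in auto)
  moreover have "V t \<in> distribution (geo c \<eta> t)" for t
    unfolding distribution_iff V_def cz_mat_of cw_mat_of by blast
  ultimately show "horizontal_curve (geo c \<eta>) T"
    unfolding horizontal_curve_def using assms d geo_SL2 by blast
  show "sr_length (geo c \<eta>) T = T"
  proof (cases "T = 0")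
    case False
    then have T0: "0 < T" using assms by simp
    have "sr_length (geo c \<eta>) T = integral {0..T} (\<lambda>t. 1)"
      unfolding sr_length_def
    proof (rule integral_cong)
      fix t assume t: "t \<in> {0..T}"
      have "vector_derivative (geo c \<eta>) (at t within {0..T}) = V t"
        by (rule vector_derivative_within_closed_interval[OF T0 t d])
      moreover have "sr_metric (geo c \<eta> t) (V t) (V t) = (2 * cmod (q t))\<^sup>2"
        by (rule sr_metric_complex[OF geo_SL2[OF assms(1)]]) (simp_all add: V_def)
      ultimately show "(let V = vector_derivative (geo c \<eta>) (at t within {0..T}) in sqrt (sr_metric (geo c \<eta> t) V V)) = 1"
        by (simp add: nq)
    qed
    then show ?thesis using T0 by simp
  qed (simp add: sr_length_trivial)
qed

lemma geodesics_eq: "geodesics = {geo c \<eta> |c \<eta>. cmod \<eta> = 1}"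
proof (intro equalityI subsetI)
  fix \<gamma> assume "\<gamma> \<in> geodesics"
  then obtain c P where P: "\<gamma> = geodesic_curve c P" "P \<in> span {A1, A2}" "sr_metric (mat 1) P P = 1"
    by (auto simp: geodesics_def)
  then have "P \<in> distribution (mat 1)" by (simp add: distribution_def)
  then obtain q where q: "cz P = cnj q * cw (mat 1)" "cw P = q * cz (mat 1)" by (auto simp: distribution_iff)
  have "(2 * cmod q)\<^sup>2 = 1"
    using sr_metric_complex[OF _ q] P(3) by (simp add: SL2_iff)
  then have "2 * cmod q = 1 \<or> 2 * cmod q = - 1" by (simp only: power2_eq_1_iff)
  then have "cmod (2 * q) = 1" using norm_ge_zero[of q] by (simp add: norm_mult)
  moreover have "P = mat_of 0 ((2 * q) / 2)" using q by (simp add: mat_eq_complex_iff)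
  ultimately show "\<gamma> \<in> {geo c \<eta> |c \<eta>. cmod \<eta> = 1}"
    using geodesic_curve_eq_geo[of "2 * q" c] P(1) by (intro CollectI exI[of _ c] exI[of _ "2 * q"]) (auto simp: fun_eq_iff)
next
  fix \<gamma> assume "\<gamma> \<in> {geo c \<eta> |c \<eta>. cmod \<eta> = 1}"
  then obtain c \<eta> where \<eta>: "\<gamma> = geo c \<eta>" "cmod \<eta> = 1" by auto
  let ?P = "mat_of 0 (\<eta> / 2)"
  have "?P \<in> distribution (mat 1)" unfolding distribution_iff by (intro exI[of _ "\<eta> / 2"]) simp
  then have "?P \<in> span {A1, A2}" by (simp add: distribution_def)
  moreover have "sr_metric (mat 1) ?P ?P = (2 * cmod (\<eta> / 2))\<^sup>2"
    by (rule sr_metric_complex) (simp_all add: SL2_iff)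
  then have "sr_metric (mat 1) ?P ?P = 1" using \<eta> by (simp add: norm_divide)
  moreover have "\<gamma> = geodesic_curve c ?P" using geodesic_curve_eq_geo[OF \<eta>(2)] \<eta>(1) by auto
  ultimately show "\<gamma> \<in> geodesics" unfolding geodesics_def by blast
qed

section \<open>Minimizing geodesics\<close>

text \<open>Reversing \<open>c\<close> reflects the projected geodesic in the real axis, so mirror
  pairs meet there; this produces the cut points over the segment.\<close>

lemma geo_z_neg: "geo_z (- c) t = cnj (geo_z c t)"
  by (simp add: geo_z_def cis_cnj)

lemma geo_z_polar:
  "gdom c t \<Longrightarrow> geo_z c t = complex_of_real (sqrt (1 + (sn (1 - c\<^sup>2) t)\<^sup>2)) * cis (theta c t)"
  unfolding geo_z_def by (rule polar_form)

lemma abs_Arg_cnj: "\<bar>Arg (cnj z)\<bar> = \<bar>Arg z\<bar>"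
proof (cases "z = 0")
  case False
  have le: "\<bar>Arg (cnj u)\<bar> \<le> \<bar>Arg u\<bar>" if "u \<noteq> 0" for u
  proof -
    have "cnj u = complex_of_real (cmod u) * cis (- Arg u)"
      using arg_cong[OF polar_Arg[OF that], of cnj] by (simp add: cis_cnj)
    then show ?thesis using abs_Arg_le[of "cnj u" "cmod u" "- Arg u"] that by simp
  qed
  from le[of z] le[of "cnj z"] False show ?thesis by simp
qed simp

lemma sqrt_1_plus_pos: "0 < sqrt (1 + (x::real)\<^sup>2)"
  by (simp add: add_pos_nonneg)

lemma abs_Arg_geo_z:
  assumes "gdom \<bar>c\<bar> t" "theta \<bar>c\<bar> t \<le> pi"
  shows "\<bar>Arg (geo_z c t)\<bar> = theta \<bar>c\<bar> t"
proof -
  have "sgn (geo_z \<bar>c\<bar> t) = cis (theta \<bar>c\<bar> t)"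
    using geo_z_polar[OF assms(1)] sqrt_1_plus_pos[of "sn (1 - \<bar>c\<bar>\<^sup>2) t"]
    by (simp add: sgn_mult sgn_of_real)
  then have "Arg (geo_z \<bar>c\<bar> t) = theta \<bar>c\<bar> t"
    using theta_nonneg[OF assms(1)] assms(2) pi_gt_zero by (intro cis_Arg_unique) linarith+
  then have "\<bar>Arg (geo_z \<bar>c\<bar> t)\<bar> = theta \<bar>c\<bar> t" using theta_nonneg[OF assms(1)] by simp
  moreover have "geo_z c t = geo_z \<bar>c\<bar> t \<or> geo_z c t = cnj (geo_z \<bar>c\<bar> t)"
    using geo_z_neg[of "\<bar>c\<bar>" t] by (cases "c \<ge> 0") auto
  ultimately show ?thesis by (auto simp: abs_Arg_cnj)
qed

text \<open>|w| and |Arg z| determine a point up to the sign of the argument and the phase of w. The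
  sign of \<open>c\<close> matches the former, \<eta> the latter; where w vanishes any \<eta>
  does.\<close>

lemma reach:
  assumes "X \<in> SL2" "gdom C t" "sn (1 - C\<^sup>2) t = cmod (cw X)" "theta C t = \<bar>Arg (cz X)\<bar>"
  obtains c \<eta> where "\<bar>c\<bar> = C" "cmod \<eta> = 1" "geo c \<eta> (2 * t) = X"
proof -
  define c where "c = (if 0 \<le> Arg (cz X) then C else - C)"
  have c: "\<bar>c\<bar> = C" "c\<^sup>2 = C\<^sup>2" using gdomD(1)[OF assms(2)] by (auto simp: c_def)
  have nz: "(cmod (cz X))\<^sup>2 = 1 + (cmod (cw X))\<^sup>2" using assms(1) by (simp add: SL2_iff)
  then have nz': "cmod (cz X) = sqrt (1 + (sn (1 - C\<^sup>2) t)\<^sup>2)"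
    unfolding assms(3) by (intro real_sqrt_unique[symmetric]) auto
  then have z0: "cz X \<noteq> 0" using sqrt_1_plus_pos by (metis less_irrefl norm_zero)
  have "geo_z c t = cz X"
  proof (cases "0 \<le> Arg (cz X)")
    case True
    then show ?thesis using geo_z_polar[OF assms(2)] nz' polar_Arg[OF z0] assms(4) by (simp add: c_def)
  next
    case False
    then have "geo_z c t = cnj (complex_of_real (cmod (cz X)) * cis (- Arg (cz X)))"
      using geo_z_polar[OF assms(2)] nz' assms(4) by (simp add: c_def geo_z_neg)
    then show ?thesis using polar_Arg[OF z0] by (simp add: cis_cnj)
  qed
  define S where "S = sn (1 - c\<^sup>2) t"
  define \<eta> where "\<eta> = (if S = 0 then 1 else cis (c * t) * cw X / complex_of_real S)"
  have S: "S = cmod (cw X)" using assms(3) c by (simp add: S_def)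
  have "cmod \<eta> = 1" by (simp add: \<eta>_def norm_mult norm_divide S)
  moreover have "geo_w c \<eta> t = cw X"
  proof (cases "S = 0")
    case False
    have "cis (- (c * t)) * cis (c * t) = 1" by (simp add: cis_mult)
    then have "cis (- (c * t)) * (cis (c * t) * cw X) = cw X" by (simp flip: mult.assoc)
    then show ?thesis using False by (simp add: geo_w_def S_def[symmetric] \<eta>_def)
  qed (use S in \<open>simp add: geo_w_def S_def[symmetric]\<close>)
  ultimately show ?thesis using that[of c \<eta>] c(1) \<open>geo_z c t = cz X\<close> by (simp add: mat_eq_complex_iff)
qed

lemma sr_dist_le:
  assumes "horizontal_curve \<gamma> T" "\<gamma> 0 = X" "\<gamma> T = Y"
  shows "sr_dist X Y \<le> sr_length \<gamma> T"
  unfolding sr_dist_def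
  by (rule cInf_lower) (use assms sr_length_nonneg in \<open>auto intro!: bdd_belowI[of _ 0]\<close>)

lemma minimizing_geo_iff:
  assumes "cmod \<eta> = 1" "0 \<le> T"
  shows "minimizing (geo c \<eta>) T \<longleftrightarrow>
    (\<forall>\<delta> T'. horizontal_curve \<delta> T' \<and> \<delta> 0 = mat 1 \<and> \<delta> T' = geo c \<eta> T \<longrightarrow> T \<le> sr_length \<delta> T')"
proof
  assume "minimizing (geo c \<eta>) T"
  then have "sr_dist (mat 1) (geo c \<eta> T) = T" by (simp add: minimizing_def geo_horizontal[OF assms])
  then show "\<forall>\<delta> T'. horizontal_curve \<delta> T' \<and> \<delta> 0 = mat 1 \<and> \<delta> T' = geo c \<eta> T \<longrightarrow> T \<le> sr_length \<delta> T'"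
    using sr_dist_le by metis
next
  assume *: "\<forall>\<delta> T'. horizontal_curve \<delta> T' \<and> \<delta> 0 = mat 1 \<and> \<delta> T' = geo c \<eta> T \<longrightarrow> T \<le> sr_length \<delta> T'"
  have "T \<le> sr_dist (mat 1) (geo c \<eta> T)"
    unfolding sr_dist_def
  proof (rule cInf_greatest)
    show "{sr_length \<delta> T' |\<delta> T'. horizontal_curve \<delta> T' \<and> \<delta> 0 = mat 1 \<and> \<delta> T' = geo c \<eta> T} \<noteq> {}"
      using geo_horizontal(1)[OF assms, of c] geo_0[of c \<eta>] by blast
  qed (use * in blast)
  moreover have "sr_dist (mat 1) (geo c \<eta> T) \<le> T"
    using sr_dist_le[OF geo_horizontal(1)[OF assms] geo_0 refl] geo_horizontal(2)[OF assms] by simp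
  ultimately show "minimizing (geo c \<eta>) T" by (simp add: minimizing_def geo_horizontal[OF assms])
qed

text \<open>If the competitor stays inside the turning radius and the geodesic has not turned yet, the
  calibration with \<open>p = c\<close> is exact. Otherwise take the largest \<open>p\<close> admissible for the
  competitor and compare closed loops, both curves being continued by the rest of the geodesic.\<close>

lemma length_ge:
  assumes "gdom c t" and \<delta>: "horizontal_curve \<delta> T" "\<delta> 0 = mat 1"
    and end_pt: "cmod (cw (\<delta> T)) = sn (1 - c\<^sup>2) t" "\<bar>Arg (cz (\<delta> T))\<bar> = theta c t"
  shows "2 * t \<le> sr_length \<delta> T"
proof -
  let ?S = "sn (1 - c\<^sup>2) t"
  obtain R where R: "?S \<le> R" and bound: "\<And>p. 0 \<le> p \<Longrightarrow> (p\<^sup>2 - 1) * R\<^sup>2 \<le> 1 \<Longrightarrow>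
      p * theta c t + 2 * prim p R - prim p ?S \<le> sr_length \<delta> T / 2"
    using sr_length_lower_bound[OF \<delta>] unfolding end_pt by blast
  have c0: "0 \<le> c" and t0: "0 \<le> t" and S0: "0 \<le> ?S" using gdomD[OF assms(1)] .
  have first_branch: ?thesis
    if "(c\<^sup>2 - 1) * R\<^sup>2 \<le> 1" "\<And>s. 0 \<le> s \<Longrightarrow> s \<le> t \<Longrightarrow> 0 \<le> cs (1 - c\<^sup>2) s"
  proof -
    have "t = c * theta c t + prim c ?S" by (rule calibration_exact[OF assms(1) that(2)])
    also have "\<dots> \<le> c * theta c t + 2 * prim c R - prim c ?S" using prim_mono[OF S0 R that(1)] by simp
    also have "\<dots> \<le> sr_length \<delta> T / 2" by (rule bound[OF c0 that(1)])
    finally show ?thesis by simp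
  qed
  show ?thesis
  proof (cases "c \<le> 1")
    case True
    then have c2: "c\<^sup>2 \<le> 1" using c0 by (simp add: power_le_one)
    then have "(c\<^sup>2 - 1) * R\<^sup>2 \<le> 0" by (intro mult_nonpos_nonneg) auto
    then show ?thesis using c2 by (intro first_branch) (auto simp: cs_def)
  next
    case False
    then have c1: "1 < c" by simp
    define w where "w = sqrt (c\<^sup>2 - 1)"
    have w: "0 < w" "w\<^sup>2 = c\<^sup>2 - 1" using omega_pos[OF c1] by (auto simp: w_def)
    have t: "t \<le> ret c" using assms(1) gdom_iff[OF c1] by simp
    have "(w * R \<le> 1 \<and> t \<le> ret c / 2) \<or> (R = 0 \<and> ret c / 2 < t)
      \<or> (0 < R \<and> (1 < w * R \<or> ret c / 2 < t))"
      using R S0 by (cases "R = 0") auto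
    then consider "w * R \<le> 1" "t \<le> ret c / 2" | "R = 0" "ret c / 2 < t"
      | "0 < R" "1 < w * R \<or> ret c / 2 < t"
      by blast
    then show ?thesis
    proof cases
      case 1
      have "(w * R)\<^sup>2 \<le> 1" using 1(1) w R S0 by (simp add: power_le_one)
      then show ?thesis using cs_nonneg_half[OF c1] 1(2) by (intro first_branch) (auto simp: power_mult_distrib w)
    next
      case 2
      then have "?S = 0" using R S0 by simp
      have "0 < t" using 2 ret_pos[OF c1] by simp
      then have th: "0 < theta c t" using theta_pos[OF assms(1)] c1 by simp
      \<comment> \<open>For R = 0 every \<open>p\<close> is admissible and the \<open>prim\<close>
        terms vanish, so the bound is p times the angle; this \<open>p\<close> makes it equal to
        \<open>t\<close>.\<close>
      have "t / theta c t * theta c t + 2 * prim (t / theta c t) 0 - prim (t / theta c t) 0 \<le> sr_length \<delta> T / 2"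
        using bound[of "t / theta c t"] th t0 \<open>?S = 0\<close> 2(1) by simp
      then show ?thesis using th by simp
    next
      case 3
      \<comment> \<open>The turning radius of this \<open>p\<close> is exactly \<open>R\<close>, so
        \<open>prim_turn\<close> evaluates \<open>prim p R\<close>.\<close>
      define p where "p = sqrt (1 + 1 / R\<^sup>2)"
      have "1 < 1 + 1 / R\<^sup>2" using 3 by simp
      then have p1: "1 < p" unfolding p_def using real_sqrt_less_mono by fastforce
      have p2: "p\<^sup>2 - 1 = (1 / R)\<^sup>2" using \<open>1 < 1 + 1 / R\<^sup>2\<close> by (simp add: p_def power_divide)
      then have pR: "sqrt (p\<^sup>2 - 1) = 1 / R" using 3 by simp
      have pp: "2 * prim p R = pi * (p - sqrt (p\<^sup>2 - 1))" using prim_turn[OF p1] 3 by (simp add: pR)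
      have adm: "(p\<^sup>2 - 1) * R\<^sup>2 \<le> 1" unfolding p2 using 3 by (simp add: power_divide)
      have "t \<le> p * theta c t + pi * (p - sqrt (p\<^sup>2 - 1)) - prim p ?S"
      proof (rule closing_up[OF c1 p1 t0 t])
        fix s assume s: "t \<le> s" "s \<le> ret c"
        have "0 \<le> sn (1 - c\<^sup>2) s" using s t0 gdom_iff[OF c1] gdomD(3) by simp
        moreover have "sn (1 - c\<^sup>2) s \<le> R"
        proof (cases "1 < w * R")
          case True
          have "sn (1 - c\<^sup>2) s \<le> 1 / w" using sn_le[OF c1] by (simp add: w_def)
          also have "\<dots> \<le> R" using True w by (simp add: field_simps)
          finally show ?thesis .
        next
          case False
          then have "ret c / 2 \<le> t" using 3 by simp
          then have "sn (1 - c\<^sup>2) s \<le> ?S" using s by (intro sn_antimono[OF c1]) auto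
          then show ?thesis using R by simp
        qed
        ultimately show "(p\<^sup>2 - 1) * (sn (1 - c\<^sup>2) s)\<^sup>2 \<le> 1" using adm by (rule admissible_mono)
      qed
      also have "\<dots> \<le> sr_length \<delta> T / 2" using bound[OF _ adm] p1 pp by simp
      finally show ?thesis by simp
    qed
  qed
qed

lemma minimizing_geoI:
  assumes "cmod \<eta> = 1" "gdom \<bar>c\<bar> t" "theta \<bar>c\<bar> t \<le> pi"
  shows "minimizing (geo c \<eta>) (2 * t)"
proof -
  have "2 * t \<le> sr_length \<delta> T" if "horizontal_curve \<delta> T" "\<delta> 0 = mat 1" "\<delta> T = geo c \<eta> (2 * t)" for \<delta> T
    by (rule length_ge[OF assms(2) that(1,2)])
      (use that assms gdomD(3)[OF assms(2)] in \<open>simp_all add: cmod_geo_w abs_Arg_geo_z\<close>)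
  then show ?thesis using minimizing_geo_iff[of \<eta> "2 * t" c] assms gdomD(2)[OF assms(2)] by simp
qed

section \<open>Loss of optimality after the return or after argument pi\<close>

lemma not_minimizing_if_shorter:
  assumes "cmod \<eta> = 1" "0 \<le> t" "gdom c' t'" "sn (1 - c'\<^sup>2) t' = \<bar>sn (1 - c\<^sup>2) t\<bar>"
    "theta c' t' = \<bar>Arg (geo_z c t)\<bar>" "t' < t"
  shows "\<not> minimizing (geo c \<eta>) (2 * t)"
proof
  assume min: "minimizing (geo c \<eta>) (2 * t)"
  obtain d \<zeta> where d: "cmod \<zeta> = 1" "geo d \<zeta> (2 * t') = geo c \<eta> (2 * t)"
    by (rule reach[of "geo c \<eta> (2 * t)" c' t'])
      (use assms geo_SL2 in \<open>simp_all add: cmod_geo_w\<close>)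
  have t': "0 \<le> 2 * t'" using gdomD(2)[OF assms(3)] by simp
  have "2 * t \<le> sr_length (geo d \<zeta>) (2 * t')"
    using min geo_horizontal(1)[OF d(1) t', of d] d(2) minimizing_geo_iff[of \<eta> "2 * t" c] assms(1,2) by auto
  then show False using geo_horizontal(2)[OF d(1) t'] assms(6) by simp
qed

text \<open>Over one return both \<open>sn\<close> and \<open>cs\<close> change sign, and so does
  the rotation factor relative to \<open>cis (theta c (ret c))\<close>; in z the signs
  cancel.\<close>

lemma geo_z_periodic:
  assumes "1 < c" "gdom c u"
  shows "geo_z c (real n * ret c + u) =
    complex_of_real (sqrt (1 + (sn (1 - c\<^sup>2) u)\<^sup>2)) * cis (real n * theta c (ret c) + theta c u)"
    "\<bar>sn (1 - c\<^sup>2) (real n * ret c + u)\<bar> = \<bar>sn (1 - c\<^sup>2) u\<bar>"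
proof -
  let ?w = "sqrt (c\<^sup>2 - 1)"
  have step: "sn (1 - c\<^sup>2) (ret c + v) = - sn (1 - c\<^sup>2) v" "cs (1 - c\<^sup>2) (ret c + v) = - cs (1 - c\<^sup>2) v" for v
    unfolding sn_cs_trig[OF assms(1)] distrib_left omega_ret[OF assms(1)] by (simp_all add: sin_add cos_add)
  have th: "theta c (ret c) = c * ret c - pi"
    by (simp add: theta_def sn_ret[OF assms(1)] cs_ret[OF assms(1)])
  have "cis (c * ret c) = - cis (theta c (ret c))"
    unfolding th by (simp add: complex_eq_iff cos_diff sin_diff)
  then have zstep: "geo_z c (ret c + v) = cis (theta c (ret c)) * geo_z c v" for v
    unfolding geo_z_def step distrib_left cis_mult[symmetric] by (simp add: algebra_simps)
  have "geo_z c (real n * ret c + u) = cis (real n * theta c (ret c)) * geo_z c u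
    \<and> \<bar>sn (1 - c\<^sup>2) (real n * ret c + u)\<bar> = \<bar>sn (1 - c\<^sup>2) u\<bar>"
  proof (induction n)
    case (Suc n)
    have "real (Suc n) * ret c + u = ret c + (real n * ret c + u)" by (simp add: algebra_simps)
    then show ?case using Suc by (simp only: zstep step) (simp add: cis_mult distrib_right flip: mult.assoc)
  qed simp
  then show "geo_z c (real n * ret c + u) =
    complex_of_real (sqrt (1 + (sn (1 - c\<^sup>2) u)\<^sup>2)) * cis (real n * theta c (ret c) + theta c u)"
    "\<bar>sn (1 - c\<^sup>2) (real n * ret c + u)\<bar> = \<bar>sn (1 - c\<^sup>2) u\<bar>"
    using geo_z_polar[OF assms(2)] by (simp_all add: cis_mult[symmetric] mult_ac)
qed

text \<open>Half periods of \<open>z\<close> multiply it by \<open>cis (theta c (ret c))\<close>, so the argument gained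
  after \<open>n\<close> returns is at most \<open>n theta c (ret c) + theta c u\<close>.\<close>

lemma beyond_return_bound:
  assumes "1 < c" "ret c < t"
  obtains u where "0 \<le> u" "u < ret c" "\<bar>sn (1 - c\<^sup>2) t\<bar> = sn (1 - c\<^sup>2) u"
    "c * \<bar>Arg (geo_z c t)\<bar> + pi * (c - sqrt (c\<^sup>2 - 1)) < t"
proof -
  let ?T = "ret c"
  have T: "0 < ?T" by (rule ret_pos[OF assms(1)])
  define n where "n = nat \<lfloor>t / ?T\<rfloor>"
  define u where "u = t - real n * ?T"
  have "1 < t / ?T" using assms T by simp
  then have fl: "1 \<le> \<lfloor>t / ?T\<rfloor>" by linarith
  then have n1: "1 \<le> n" unfolding n_def by linarith
  have rn: "real n = of_int \<lfloor>t / ?T\<rfloor>" using fl by (simp add: n_def)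
  have "real n \<le> t / ?T" "t / ?T < real n + 1" unfolding rn by linarith+
  then have u: "0 \<le> u" "u < ?T" using T by (auto simp: u_def field_simps)
  have t: "t = real n * ?T + u" by (simp add: u_def)
  have gu: "gdom c u" using u gdom_iff[OF assms(1)] by simp
  let ?th = "theta c ?T"
  \<comment> \<open>The excess of the time over \<open>c\<close> times the angle in one return is
    the constant in the claim.\<close>
  have exc: "?T - c * ?th = pi * (c - sqrt (c\<^sup>2 - 1))"
  proof -
    define w where "w = sqrt (c\<^sup>2 - 1)"
    have w: "0 < w" "c\<^sup>2 = w\<^sup>2 + 1" using omega_pos[OF assms(1)] by (auto simp: w_def)
    have "?T - c * ?th = (pi - pi * c\<^sup>2 + pi * c * w) / w"
      unfolding theta_ret[OF assms(1)] unfolding ret_def w_def[symmetric] using w(1)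
      by (simp add: diff_divide_distrib add_divide_distrib right_diff_distrib power2_eq_square)
    also have "pi - pi * c\<^sup>2 + pi * c * w = pi * (c - w) * w" unfolding w(2) by (simp add: algebra_simps power2_eq_square)
    finally show ?thesis using w(1) by (simp add: w_def)
  qed
  have exc_pos: "0 < ?T - c * ?th"
    using theta_excess_pos[of c ?T] T gdom_iff[OF assms(1)] by simp
  have "\<bar>Arg (geo_z c t)\<bar> \<le> \<bar>real n * ?th + theta c u\<bar>"
    unfolding t by (rule abs_Arg_le[OF geo_z_periodic(1)[OF assms(1) gu] sqrt_1_plus_pos])
  also have "\<dots> = real n * ?th + theta c u"
    using theta_nonneg[OF gu] theta_nonneg[of c ?T] gdom_iff[OF assms(1)] T by simp
  finally have "c * \<bar>Arg (geo_z c t)\<bar> \<le> c * (real n * ?th + theta c u)"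
    using assms(1) by (intro mult_left_mono) auto
  also have "\<dots> = real n * (c * ?th) + c * theta c u" by (simp add: algebra_simps)
  finally have le: "c * \<bar>Arg (geo_z c t)\<bar> \<le> real n * (c * ?th) + c * theta c u" .
  have tt: "t = real n * (c * ?th) + real n * (?T - c * ?th) + u" unfolding t by (simp add: algebra_simps)
  have "c * \<bar>Arg (geo_z c t)\<bar> + (?T - c * ?th) < t"
  \<comment> \<open>The claim uses up the excess of one return. Strictness comes from a second
    complete return if u = 0, and from the excess of the begun arc otherwise.\<close>
  proof (cases "u = 0")
    case True
    then have "n \<noteq> 1" using assms(2) t by auto
    then have "2 \<le> real n" using n1 by simp
    then have "2 * (?T - c * ?th) \<le> real n * (?T - c * ?th)" using exc_pos by (intro mult_right_mono) auto
    then show ?thesis using le tt exc_pos True by simp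
  next
    case False
    then have "c * theta c u < u" using theta_excess_pos[OF gu] u by simp
    moreover have "1 * (?T - c * ?th) \<le> real n * (?T - c * ?th)" using exc_pos n1 by (intro mult_right_mono) auto
    moreover have "A + D < t" if "B < u" "1 * D \<le> F" "A \<le> E + B" "t = E + F + u" for A B D E F :: real
      using that by linarith
    ultimately show ?thesis using le tt by blast
  qed
  then show ?thesis using that[OF u] geo_z_periodic(2)[OF assms(1) gu, of n] gdomD(3)[OF gu]
    unfolding exc t[symmetric] by simp
qed

text \<open>The endpoint fixes a level r and an angle psi. At level 0 the trivial curve or a closed
  geodesic wins by \<open>ret_le\<close>. At a positive level the arc of the same geodesic past its
  turning point is the reference: smaller angles are reached no later than it, and larger ones are
  estimated by \<open>closing_up\<close> with p = c.\<close>

lemma shorter_beyond_return: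
  assumes "1 < c" "ret c < t"
  obtains c' t' where "gdom c' t'" "sn (1 - c'\<^sup>2) t' = \<bar>sn (1 - c\<^sup>2) t\<bar>"
    "theta c' t' = \<bar>Arg (geo_z c t)\<bar>" "t' < t"
proof -
  obtain u where u: "0 \<le> u" "u < ret c" "\<bar>sn (1 - c\<^sup>2) t\<bar> = sn (1 - c\<^sup>2) u"
    and bound: "c * \<bar>Arg (geo_z c t)\<bar> + pi * (c - sqrt (c\<^sup>2 - 1)) < t"
    by (rule beyond_return_bound[OF assms])
  define \<psi> where "\<psi> = \<bar>Arg (geo_z c t)\<bar>"
  define r where "r = sn (1 - c\<^sup>2) u"
  have \<psi>: "0 \<le> \<psi>" "\<psi> \<le> pi" using Arg_bounded[of "geo_z c t"] unfolding \<psi>_def by linarith+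
  have T: "0 < ret c" by (rule ret_pos[OF assms(1)])
  have gu: "gdom c u" using u gdom_iff[OF assms(1)] by simp
  have bound': "c * \<psi> + pi * (c - sqrt (c\<^sup>2 - 1)) < t" using bound by (simp add: \<psi>_def)
  have "0 \<le> r" using gdomD(3)[OF gu] by (simp add: r_def)
  then have "(r = 0 \<and> \<psi> = 0) \<or> (r = 0 \<and> 0 < \<psi>) \<or> 0 < r" using \<psi> by linarith
  then consider "r = 0" "\<psi> = 0" | "r = 0" "0 < \<psi>" | "0 < r" by blast
  then have "\<exists>c' t'. gdom c' t' \<and> sn (1 - c'\<^sup>2) t' = r \<and> theta c' t' = \<psi> \<and> t' < t"
  proof cases
    case 1
    have "0 < t" using assms T by simp
    then have "gdom 0 0 \<and> sn (1 - 0\<^sup>2) 0 = r \<and> theta 0 0 = \<psi> \<and> 0 < t"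
      using 1 by (simp add: gdom_def)
    then show ?thesis by blast
  next
    case 2
    obtain c' where c': "1 < c'" "theta c' (ret c') = \<psi>" by (rule exists_closed_geodesic[OF 2(2)])
    then have "ret c' < t" using ret_le[OF c'(1) assms(1)] bound' by simp
    then have "gdom c' (ret c') \<and> sn (1 - c'\<^sup>2) (ret c') = r \<and> theta c' (ret c') = \<psi> \<and> ret c' < t"
      using c' 2(1) sn_ret[OF c'(1)] ret_pos[OF c'(1)] gdom_iff[OF c'(1)] by simp
    then show ?thesis by blast
  next
    case 3
    \<comment> \<open>Reflection at half the return time keeps the level, as sin does around pi / 2,
      so a time past the turning point can be chosen.\<close>
    define v where "v = (if ret c / 2 \<le> u then u else ret c - u)"
    have v: "ret c / 2 \<le> v" "0 \<le> v" "v \<le> ret c" "v < t" using u T assms by (auto simp: v_def)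
    have "sn (1 - c\<^sup>2) (ret c - u) = sn (1 - c\<^sup>2) u"
      unfolding sn_cs_trig[OF assms(1)] right_diff_distrib omega_ret[OF assms(1)] by simp
    then have sv: "sn (1 - c\<^sup>2) v = r" by (simp add: v_def r_def)
    have gv: "gdom c v" using v gdom_iff[OF assms(1)] by simp
    show ?thesis
    proof (cases "\<psi> \<le> theta c v")
      case True
      obtain c' t' where "gdom c' t'" "sn (1 - c'\<^sup>2) t' = r" "theta c' t' = \<psi>" "t' \<le> v"
        by (rule geodesic_smaller_angle[OF gv sv 3 \<psi>(1) True])
      moreover from this have "t' < t" using v(4) by simp
      ultimately show ?thesis by blast
    next
      case False
      then have "theta c v \<le> \<psi>" by simp
      then obtain c' t' where *: "gdom c' t'" "sn (1 - c'\<^sup>2) t' = r" "theta c' t' = \<psi>"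
        "(1 - c'\<^sup>2) * t'\<^sup>2 \<le> (1 - c\<^sup>2) * v\<^sup>2"
        by (rule geodesic_larger_angle[OF gv sv 3 _ \<psi>(2)])
      \<comment> \<open>A smaller \<open>m\<close> means a larger phase. As \<open>v\<close> is past
        the phase pi / 2, so is the new geodesic at \<open>t'\<close>, and |w| decreases on its
        remaining arc. This is what makes \<open>p = c\<close> admissible there.\<close>
      have "sqrt (c\<^sup>2 - 1) * (ret c / 2) \<le> sqrt (c\<^sup>2 - 1) * v" using v omega_pos[OF assms(1)] by (intro mult_left_mono) auto
      then have "pi / 2 \<le> sqrt (c\<^sup>2 - 1) * v" using omega_ret[OF assms(1)] by simp
      then have "(pi / 2)\<^sup>2 \<le> (sqrt (c\<^sup>2 - 1) * v)\<^sup>2" by (intro power_mono) auto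
      also have "\<dots> = (c\<^sup>2 - 1) * v\<^sup>2" using omega_pos[OF assms(1)] by (simp add: power_mult_distrib)
      also have "\<dots> \<le> (c'\<^sup>2 - 1) * t'\<^sup>2" using *(4) by (simp add: algebra_simps)
      finally have q: "(pi / 2)\<^sup>2 \<le> (c'\<^sup>2 - 1) * t'\<^sup>2" .
      have "0 < (pi / 2)\<^sup>2" by simp
      then have "0 < (c'\<^sup>2 - 1) * t'\<^sup>2" using q by linarith
      then have "0 < c'\<^sup>2 - 1" by (simp add: zero_less_mult_iff)
      then have "1\<^sup>2 < c'\<^sup>2" by simp
      then have c': "1 < c'" by (rule power2_less_imp_less) (use gdomD(1)[OF *(1)] in simp)
      have "(c'\<^sup>2 - 1) * t'\<^sup>2 = (sqrt (c'\<^sup>2 - 1) * t')\<^sup>2" using omega_pos[OF c'] by (simp add: power_mult_distrib)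
      then have "pi / 2 \<le> sqrt (c'\<^sup>2 - 1) * t'"
        using q gdomD(2)[OF *(1)] omega_pos[OF c'] by (intro power2_le_imp_le[of "pi / 2"]) auto
      then have half: "ret c' / 2 \<le> t'" using omega_pos[OF c'] by (simp add: ret_def field_simps)
      have t': "0 \<le> t'" "t' \<le> ret c'" using *(1) gdom_iff[OF c'] by auto
      have adm: "(c\<^sup>2 - 1) * r\<^sup>2 \<le> 1" unfolding r_def by (rule admissible_self)
      have "t' \<le> c * theta c' t' + pi * (c - sqrt (c\<^sup>2 - 1)) - prim c (sn (1 - c'\<^sup>2) t')"
      proof (rule closing_up[OF c' assms(1) t'])
        fix s assume s: "t' \<le> s" "s \<le> ret c'"
        have "0 \<le> sn (1 - c'\<^sup>2) s" using s t' gdom_iff[OF c'] gdomD(3) by simp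
        moreover have "sn (1 - c'\<^sup>2) s \<le> r" using sn_antimono[OF c' half s] *(2) by simp
        ultimately show "(c\<^sup>2 - 1) * (sn (1 - c'\<^sup>2) s)\<^sup>2 \<le> 1" using adm by (rule admissible_mono)
      qed
      moreover have "0 \<le> prim c r" using 3 adm by (intro prim_nonneg) auto
      ultimately have "t' < t" using bound' *(2,3) by simp
      with * show ?thesis by blast
    qed
  qed
  then show ?thesis using that u(3) unfolding \<psi>_def r_def by metis
qed

text \<open>Necessity is by contraposition, with a strictly shorter geodesic to the same point:
  \<open>shorter_beyond_return\<close> past the return, and \<open>shorter_geodesic_inside\<close>
  if the angle exceeds pi, since |Arg| cannot.\<close>

lemma minimizing_geo:
  assumes "cmod \<eta> = 1" "0 \<le> t"
  shows "minimizing (geo c \<eta>) (2 * t) \<longleftrightarrow> gdom \<bar>c\<bar> t \<and> theta \<bar>c\<bar> t \<le> pi"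
proof
  assume min: "minimizing (geo c \<eta>) (2 * t)"
  have Arg_abs: "\<bar>Arg (geo_z c t)\<bar> = \<bar>Arg (geo_z \<bar>c\<bar> t)\<bar>"
    using geo_z_neg[of "\<bar>c\<bar>" t] by (cases "c \<ge> 0") (auto simp: abs_Arg_cnj)
  have shorter: False if "gdom c' t'" "sn (1 - c'\<^sup>2) t' = \<bar>sn (1 - \<bar>c\<bar>\<^sup>2) t\<bar>"
    "theta c' t' = \<bar>Arg (geo_z \<bar>c\<bar> t)\<bar>" "t' < t" for c' t'
    using not_minimizing_if_shorter[OF assms that(1), of c] that min by (simp add: Arg_abs)
  have g: "gdom \<bar>c\<bar> t"
  proof (rule ccontr)
    assume ng: "\<not> gdom \<bar>c\<bar> t"
    have c1: "1 < \<bar>c\<bar>"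
    proof (rule ccontr)
      assume "\<not> 1 < \<bar>c\<bar>"
      then have "\<bar>c\<bar>\<^sup>2 \<le> 1" by (intro power_le_one) auto
      then have "0 \<le> (1 - \<bar>c\<bar>\<^sup>2) * t\<^sup>2" by simp
      moreover have "- pi\<^sup>2 \<le> 0" by simp
      ultimately show False using ng assms(2) unfolding gdom_def by linarith
    qed
    then have "ret \<bar>c\<bar> < t" using ng assms(2) gdom_iff[OF c1] by simp
    then show False by (rule shorter_beyond_return[OF c1]) (use shorter in blast)
  qed
  moreover have "theta \<bar>c\<bar> t \<le> pi"
  proof (rule ccontr)
    assume nle: "\<not> theta \<bar>c\<bar> t \<le> pi"
    define \<psi> where "\<psi> = \<bar>Arg (geo_z \<bar>c\<bar> t)\<bar>"
    have \<psi>: "0 \<le> \<psi>" "\<psi> \<le> pi" using Arg_bounded[of "geo_z \<bar>c\<bar> t"] unfolding \<psi>_def by linarith+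
    have S: "0 \<le> sn (1 - \<bar>c\<bar>\<^sup>2) t" by (rule gdomD(3)[OF g])
    show False
    proof (cases "sn (1 - \<bar>c\<bar>\<^sup>2) t \<noteq> 0 \<or> 0 < \<psi>")
      case True
      have "\<psi> < theta \<bar>c\<bar> t" using nle \<psi> by simp
      show False
        by (rule shorter_geodesic_inside[OF g \<psi>(1) \<open>\<psi> < theta \<bar>c\<bar> t\<close> True])
          (use shorter S in \<open>auto simp: \<psi>_def\<close>)
    next
      case False
      \<comment> \<open>The endpoint is the identity here, and the geodesic of duration 0 is
        shorter.\<close>
      have "t \<noteq> 0" using nle pi_ge_zero by (metis theta_0)
      then show False using shorter[of 0 0] False \<psi> assms(2) by (simp add: \<psi>_def gdom_def)
    qed
  qed
  ultimately show "gdom \<bar>c\<bar> t \<and> theta \<bar>c\<bar> t \<le> pi" by blast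
qed (use minimizing_geoI[OF assms(1)] in blast)

section \<open>The critical locus and the cut locus\<close>

lemma cmod_geo_w_gdom: "gdom \<bar>c\<bar> t \<Longrightarrow> cmod \<eta> = 1 \<Longrightarrow> cmod (geo_w c \<eta> t) = sn (1 - \<bar>c\<bar>\<^sup>2) t"
  using gdomD(3)[of "\<bar>c\<bar>" t] by (simp add: cmod_geo_w)

text \<open>The optimal times are cut off by the return or by angle pi. For nonzero \<open>c\<close>
  the angle is strictly increasing, hence passes pi immediately; for c = 0 it stays 0. Before both
  events, continuity of \<open>theta\<close> leaves room to continue.\<close>

lemma last_minimizing_geo:
  assumes "cmod \<eta> = 1" "0 \<le> t"
  shows "minimizing (geo c \<eta>) (2 * t) \<and> (\<forall>s>2 * t. \<not> minimizing (geo c \<eta>) s) \<longleftrightarrow>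
    gdom \<bar>c\<bar> t \<and> theta \<bar>c\<bar> t \<le> pi \<and> (theta \<bar>c\<bar> t = pi \<or> 0 < t \<and> sn (1 - \<bar>c\<bar>\<^sup>2) t = 0)"
proof -
  let ?opt = "\<lambda>t. gdom \<bar>c\<bar> t \<and> theta \<bar>c\<bar> t \<le> pi"
  have "(\<forall>s>2 * t. \<not> minimizing (geo c \<eta>) s) \<longleftrightarrow> (\<forall>s>t. \<not> ?opt s)"
  proof -
    have "(\<forall>s>2 * t. \<not> minimizing (geo c \<eta>) s) \<longleftrightarrow> (\<forall>s>t. \<not> minimizing (geo c \<eta>) (2 * s))"
    proof (intro iffI allI impI)
      fix s assume "\<forall>s>t. \<not> minimizing (geo c \<eta>) (2 * s)" "2 * t < s"
      then show "\<not> minimizing (geo c \<eta>) s" by (auto dest: spec[of _ "s / 2"])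
    qed auto
    also have "\<dots> \<longleftrightarrow> (\<forall>s>t. \<not> ?opt s)" using minimizing_geo[OF assms(1), of _ c] assms(2) by auto
    finally show ?thesis .
  qed
  moreover have "(\<forall>s>t. \<not> ?opt s) \<longleftrightarrow> theta \<bar>c\<bar> t = pi \<or> 0 < t \<and> sn (1 - \<bar>c\<bar>\<^sup>2) t = 0" if opt: "?opt t"
  proof (intro iffI)
    assume "theta \<bar>c\<bar> t = pi \<or> 0 < t \<and> sn (1 - \<bar>c\<bar>\<^sup>2) t = 0"
    then show "\<forall>s>t. \<not> ?opt s"
    proof
      assume th: "theta \<bar>c\<bar> t = pi"
      then have "c \<noteq> 0" by auto
      then show ?thesis using theta_strict_mono[of "\<bar>c\<bar>" _ t] assms(2) th by fastforce
    next
      assume "0 < t \<and> sn (1 - \<bar>c\<bar>\<^sup>2) t = 0"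
      then have "1 < \<bar>c\<bar>" "t = ret \<bar>c\<bar>" using gdom_sn_zero[of "\<bar>c\<bar>" t] opt by blast+
      then show ?thesis using gdom_iff[of "\<bar>c\<bar>"] by auto
    qed
  next
    assume none: "\<forall>s>t. \<not> ?opt s"
    show "theta \<bar>c\<bar> t = pi \<or> 0 < t \<and> sn (1 - \<bar>c\<bar>\<^sup>2) t = 0"
    proof (rule ccontr)
      assume neg: "\<not> (theta \<bar>c\<bar> t = pi \<or> 0 < t \<and> sn (1 - \<bar>c\<bar>\<^sup>2) t = 0)"
      then have "theta \<bar>c\<bar> t < pi" using opt by auto
      moreover have "(theta \<bar>c\<bar> \<longlongrightarrow> theta \<bar>c\<bar> t) (at_right t)"
        using continuous_on_theta[of UNIV "\<bar>c\<bar>"]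
        by (auto simp: continuous_on_def intro: tendsto_within_subset)
      ultimately have "\<forall>\<^sub>F s in at_right t. theta \<bar>c\<bar> s < pi" by (intro order_tendstoD(2))
      moreover have "\<forall>\<^sub>F s in at_right t. gdom \<bar>c\<bar> s"
      proof (cases "1 < \<bar>c\<bar>")
        case True
        have "t \<noteq> ret \<bar>c\<bar>"
          using neg sn_ret[OF True] ret_pos[OF True] by auto
        then have "t < ret \<bar>c\<bar>" using opt gdom_iff[OF True] by simp
        then have "\<forall>\<^sub>F s in at_right t. s \<in> {t<..<ret \<bar>c\<bar>}" by (rule eventually_at_right_real)
        then show ?thesis using gdom_iff[OF True] assms(2) by (auto elim: eventually_mono)
      next
        case False
        then have "\<bar>c\<bar>\<^sup>2 \<le> 1" by (intro power_le_one) auto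
        then have "0 \<le> (1 - \<bar>c\<bar>\<^sup>2) * s\<^sup>2" for s by simp
        moreover have "- pi\<^sup>2 \<le> 0" by simp
        ultimately have "- pi\<^sup>2 \<le> (1 - \<bar>c\<bar>\<^sup>2) * s\<^sup>2" for s using order_trans by blast
        then have "gdom \<bar>c\<bar> s" if "t < s" for s using that assms(2) by (simp add: gdom_def)
        then show ?thesis by (auto simp: eventually_at_filter)
      qed
      moreover have "\<forall>\<^sub>F s in at_right t. t < s" by (simp add: eventually_at_filter)
      ultimately have "\<forall>\<^sub>F s in at_right t. False"
        by eventually_elim (use none in auto)
      then show False by (simp add: trivial_limit_at_right_real)
    qed
  qed
  ultimately show ?thesis using minimizing_geo[OF assms] by blast
qed

lemma Arg_eq_pi_iff: "Arg z = pi \<longleftrightarrow> Im z = 0 \<and> Re z < 0"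
proof
  assume "Arg z = pi"
  then have z: "z \<noteq> 0" by (auto simp: Arg_zero)
  have "z = complex_of_real (cmod z) * cis pi" using polar_Arg[OF z] \<open>Arg z = pi\<close> by simp
  then have "z = - complex_of_real (cmod z)" by simp
  then show "Im z = 0 \<and> Re z < 0" using z
    by (metis Im_complex_of_real Re_complex_of_real minus_complex.sel norm_le_zero_iff neg_less_0_iff_less not_le uminus_complex.sel neg_0_equal_iff_equal)
next
  assume "Im z = 0 \<and> Re z < 0"
  then have "sgn z = cis pi" by (auto simp: complex_eq_iff sgn_eq cmod_def)
  then show "Arg z = pi" by (intro cis_Arg_unique) auto
qed

lemma abs_Arg_eq_pi_iff: "\<bar>Arg z\<bar> = pi \<longleftrightarrow> Arg z = pi"
  using Arg_bounded[of z] by auto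

text \<open>The preimage in complex coordinates. The identity lies over the point (1, 0) of the unit
  circle but is removed: every geodesic stays optimal for a short time, and two geodesics cannot
  separate on an interval of length 0.\<close>

definition locus :: "(real^2^2) set" where
  "locus = {X \<in> SL2. (cw X = 0 \<or> Arg (cz X) = pi) \<and> X \<noteq> mat 1}"

lemma quotient_proj_complex: "quotient_proj X = (Re (cz X), Im (cz X))"
  by (simp add: quotient_proj_def cz_def)

text \<open>If w is nonzero then |z| > 1, so a negative real z lies in the open segment; z = -1
  belongs to the circle.\<close>

lemma preimage_iff:
  assumes "X \<in> SL2"
  shows "quotient_proj X \<in> {(x, y). x\<^sup>2 + y\<^sup>2 = 1} \<union> {(x, 0) |x. x < -1} \<longleftrightarrow> cw X = 0 \<or> Arg (cz X) = pi"
proof -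
  have nz: "(Re (cz X))\<^sup>2 + (Im (cz X))\<^sup>2 = 1 + (cmod (cw X))\<^sup>2"
    using assms by (simp add: SL2_iff cmod_power2)
  have "Re (cz X) < -1" if "Im (cz X) = 0" "Re (cz X) < 0" "cw X \<noteq> 0"
  proof -
    have "1\<^sup>2 < (- Re (cz X))\<^sup>2" using nz that by (simp add: add_pos_nonneg)
    then have "1 < - Re (cz X)" by (rule power2_less_imp_less) (use that in simp)
    then show ?thesis by simp
  qed
  then show ?thesis unfolding quotient_proj_complex Arg_eq_pi_iff using nz by auto
qed

lemma preimage_eq:
  "(SL2 \<inter> quotient_proj -` ({(x, y). x\<^sup>2 + y\<^sup>2 = 1} \<union> {(x, 0) |x. x < -1})) - {mat 1} = locus"
proof -
  have "(SL2 \<inter> quotient_proj -` D) - {mat 1} = locus"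
    if "\<And>X. X \<in> SL2 \<Longrightarrow> quotient_proj X \<in> D \<longleftrightarrow> cw X = 0 \<or> Arg (cz X) = pi" for D
    unfolding locus_def using that by blast
  from this[OF preimage_iff] show ?thesis .
qed

lemma eq_one_if_Arg_zero:
  assumes "X \<in> SL2" "cw X = 0" "Arg (cz X) = 0"
  shows "X = mat 1"
proof -
  have "(cmod (cz X))\<^sup>2 = 1" using assms by (simp add: SL2_iff)
  then have "cmod (cz X) = 1 \<or> cmod (cz X) = - 1" by (simp only: power2_eq_1_iff)
  then have n: "cmod (cz X) = 1" using norm_ge_zero[of "cz X"] by linarith
  then have "cz X \<noteq> 0" by auto
  then have "cz X = 1" using polar_Arg[of "cz X"] n assms(3) by simp
  then show ?thesis using assms(2) by (simp add: mat_eq_complex_iff)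
qed

text \<open>Over the circle a closed geodesic is used, whose angle is positive because the identity
  is excluded; elsewhere the geodesic arriving at level |w| with angle pi.\<close>

lemma locus_reached:
  assumes "X \<in> locus"
  obtains C t where "gdom C t" "0 < C" "0 < t" "sn (1 - C\<^sup>2) t = cmod (cw X)" "theta C t = \<bar>Arg (cz X)\<bar>"
    "cw X = 0 \<or> theta C t = pi"
proof (cases "cw X = 0")
  case True
  then have "Arg (cz X) \<noteq> 0" using assms eq_one_if_Arg_zero by (auto simp: locus_def)
  then obtain C where C: "1 < C" "theta C (ret C) = \<bar>Arg (cz X)\<bar>"
    using exists_closed_geodesic[of "\<bar>Arg (cz X)\<bar>"] by auto
  show ?thesis
    by (rule that[of C "ret C"]) (use C True gdom_iff[OF C(1)] ret_pos[OF C(1)] sn_ret[OF C(1)] in auto)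
next
  case False
  then have A: "\<bar>Arg (cz X)\<bar> = pi" using assms by (simp add: locus_def)
  have "0 < cmod (cw X)" using False by simp
  then obtain C t where C: "gdom C t" "sn (1 - C\<^sup>2) t = cmod (cw X)" "theta C t = pi"
    using exists_geodesic_angle[of "cmod (cw X)" pi] by auto
  have "C \<noteq> 0" "t \<noteq> 0" using C(3) by (auto intro: ccontr)
  then have "0 < C" "0 < t" using gdomD(1,2)[OF C(1)] by auto
  then show ?thesis using that[of C t] C A by simp
qed

lemma critical_locusI:
  "\<gamma> \<in> geodesics \<Longrightarrow> 0 \<le> T \<Longrightarrow> minimizing \<gamma> T \<Longrightarrow> \<forall>t>T. \<not> minimizing \<gamma> t \<Longrightarrow> \<gamma> T \<in> critical_locus"
  unfolding critical_locus_def by blast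

lemma critical_locus_eq: "critical_locus = locus"
proof (intro equalityI subsetI)
  fix X assume "X \<in> critical_locus"
  then obtain c \<eta> T where X: "X = geo c \<eta> T" "cmod \<eta> = 1" "0 \<le> T"
    "minimizing (geo c \<eta>) T" "\<forall>s>T. \<not> minimizing (geo c \<eta>) s"
    unfolding critical_locus_def geodesics_eq by blast
  define t where "t = T / 2"
  have t: "T = 2 * t" "0 \<le> t" using X(3) by (auto simp: t_def)
  have *: "gdom \<bar>c\<bar> t" "theta \<bar>c\<bar> t \<le> pi" "theta \<bar>c\<bar> t = pi \<or> 0 < t \<and> sn (1 - \<bar>c\<bar>\<^sup>2) t = 0"
    using last_minimizing_geo[OF X(2) t(2), of c] X(4,5) unfolding t(1) by blast+
  have A: "\<bar>Arg (cz X)\<bar> = theta \<bar>c\<bar> t" using abs_Arg_geo_z[OF *(1,2)] by (simp add: X(1) t(1))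
  have W: "cmod (cw X) = sn (1 - \<bar>c\<bar>\<^sup>2) t" using cmod_geo_w_gdom[OF *(1) X(2)] by (simp add: X(1) t(1))
  have "theta \<bar>c\<bar> t \<noteq> 0"
    using *(3)
  proof
    assume "0 < t \<and> sn (1 - \<bar>c\<bar>\<^sup>2) t = 0"
    then have "1 < \<bar>c\<bar>" using gdom_sn_zero(1)[OF *(1)] by blast
    then show ?thesis using theta_pos[OF *(1)] \<open>0 < t \<and> _\<close> by force
  qed simp
  then have "X \<noteq> mat 1" using A by auto
  moreover have "cw X = 0 \<or> Arg (cz X) = pi"
    using *(3)
  proof
    assume "theta \<bar>c\<bar> t = pi"
    then show ?thesis using A abs_Arg_eq_pi_iff by simp
  next
    assume "0 < t \<and> sn (1 - \<bar>c\<bar>\<^sup>2) t = 0"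
    then show ?thesis using W by (simp del: power2_abs)
  qed
  ultimately show "X \<in> locus" using geo_SL2[OF X(2)] by (simp add: locus_def X(1))
next
  fix X assume X: "X \<in> locus"
  then have SL: "X \<in> SL2" by (simp add: locus_def)
  obtain C t where C: "gdom C t" "0 < C" "0 < t" "sn (1 - C\<^sup>2) t = cmod (cw X)" "theta C t = \<bar>Arg (cz X)\<bar>"
    "cw X = 0 \<or> theta C t = pi"
    by (rule locus_reached[OF X])
  obtain c \<eta> where c: "\<bar>c\<bar> = C" "cmod \<eta> = 1" "geo c \<eta> (2 * t) = X"
    by (rule reach[OF SL C(1,4,5)])
  have "theta C t \<le> pi" using Arg_bounded[of "cz X"] unfolding C(5) by linarith
  moreover have "theta C t = pi \<or> 0 < t \<and> sn (1 - C\<^sup>2) t = 0" using C(3,4,6) by auto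
  ultimately have last: "minimizing (geo c \<eta>) (2 * t)" "\<forall>s>2 * t. \<not> minimizing (geo c \<eta>) s"
    using last_minimizing_geo[OF c(2), of t c] C(1,3) c(1) by simp_all
  have "geo c \<eta> \<in> geodesics" unfolding geodesics_eq using c(2) by blast
  moreover have "0 \<le> 2 * t" using C(3) by simp
  ultimately have "geo c \<eta> (2 * t) \<in> critical_locus" using last by (rule critical_locusI)
  then show "X \<in> critical_locus" by (simp only: c(3))
qed

lemma cut_locusI:
  assumes "\<gamma> \<in> geodesics" "\<delta> \<in> geodesics" "0 \<le> T" "minimizing \<gamma> T" "minimizing \<delta> T" "\<gamma> T = \<delta> T"
    and "t \<in> {0..T}" "\<gamma> t \<noteq> \<delta> t"
  shows "\<gamma> T \<in> cut_locus"
proof -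
  have "\<exists>s\<in>{0..T}. \<gamma> s \<noteq> \<delta> s" using assms(7,8) by blast
  then show ?thesis unfolding cut_locus_def
    by (intro CollectI bexI[OF _ assms(1)] bexI[OF _ assms(2)] exI[of _ T] conjI assms(3-6) refl assms(6)[symmetric])
qed

text \<open>When w is nonzero, equal times and levels force equal |c|. An angle strictly between 0
  and pi then excludes opposite signs, and the phase of w fixes \<eta>. Conversely \<eta> is free
  where w vanishes, and the sign of \<open>c\<close> is free where z is negative.\<close>

lemma cut_locus_eq: "cut_locus = locus"
proof (intro equalityI subsetI)
  fix X assume "X \<in> cut_locus"
  then obtain c \<eta> c' \<eta>' T s where X: "cmod \<eta> = 1" "cmod \<eta>' = 1" "0 \<le> T"
    "minimizing (geo c \<eta>) T" "minimizing (geo c' \<eta>') T" "geo c \<eta> T = X" "geo c' \<eta>' T = X"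
    and s: "s \<in> {0..T}" "geo c \<eta> s \<noteq> geo c' \<eta>' s"
    unfolding cut_locus_def geodesics_eq by blast
  define t where "t = T / 2"
  have "s \<noteq> 0" using s(2) by auto
  then have t: "T = 2 * t" "0 < t" using s(1) by (auto simp: t_def)
  have *: "gdom \<bar>c\<bar> t" "theta \<bar>c\<bar> t \<le> pi" and g': "gdom \<bar>c'\<bar> t" "theta \<bar>c'\<bar> t \<le> pi"
    using minimizing_geo[OF X(1), of t c] minimizing_geo[OF X(2), of t c'] X(4,5) t by auto
  have z: "geo_z c t = cz X" "geo_z c' t = cz X" and w: "geo_w c \<eta> t = cw X" "geo_w c' \<eta>' t = cw X"
    using X(6,7) unfolding t(1) by (auto simp: mat_eq_complex_iff)
  have A: "\<bar>Arg (cz X)\<bar> = theta \<bar>c\<bar> t" using abs_Arg_geo_z[OF *] z by simp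
  have W: "cmod (cw X) = sn (1 - \<bar>c\<bar>\<^sup>2) t" "cmod (cw X) = sn (1 - \<bar>c'\<bar>\<^sup>2) t"
    using cmod_geo_w_gdom[OF *(1) X(1)] cmod_geo_w_gdom[OF g'(1) X(2)] w by auto
  have SL: "X \<in> SL2" using geo_SL2[OF X(1)] X(6) by blast
  show "X \<in> locus"
  proof (cases "cw X = 0")
    case True
    then have "1 < \<bar>c\<bar>" using gdom_sn_zero(1)[OF *(1) t(2)] W by simp
    then have "0 < theta \<bar>c\<bar> t" using theta_pos[OF *(1)] t(2) by simp
    then have "X \<noteq> mat 1" using A by auto
    then show ?thesis using True SL by (simp add: locus_def)
  next
    case False
    then have sn0: "0 < sn (1 - \<bar>c\<bar>\<^sup>2) t" using W(1) by (metis zero_less_norm_iff)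
    have "Arg (cz X) = pi"
    proof (rule ccontr)
      assume "Arg (cz X) \<noteq> pi"
      then have lt: "theta \<bar>c\<bar> t < pi" using A *(2) abs_Arg_eq_pi_iff[of "cz X"] by auto
      have abs_eq: "\<bar>c\<bar> = \<bar>c'\<bar>" by (rule geodesic_unique_speed[OF *(1) g'(1)]) (use W sn0 in auto)
      have "c = c'"
      proof (rule ccontr)
        assume ne: "c \<noteq> c'"
        then have neg: "c' = - c" "c \<noteq> 0" using abs_eq by auto
        then have "cnj (cz X) = cz X" using z geo_z_neg[of c t] by simp
        then have "Im (cz X) = 0" by (simp add: complex_eq_iff)
        moreover have "geo_z \<bar>c\<bar> t = cz X" using z neg by (auto simp: abs_if)
        then have "Im (cz X) = sqrt (1 + (sn (1 - \<bar>c\<bar>\<^sup>2) t)\<^sup>2) * sin (theta \<bar>c\<bar> t)"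
          using geo_z_polar[OF *(1)] by (metis Im_complex_of_real Re_complex_of_real add_0 add.right_neutral mult_zero_left times_complex.sel(2) cis.sel(2))
        moreover have "0 < sin (theta \<bar>c\<bar> t)"
          using theta_pos[OF *(1) _ t(2)] neg lt by (intro sin_gt_zero) auto
        ultimately show False using sqrt_1_plus_pos[of "sn (1 - \<bar>c\<bar>\<^sup>2) t"] by simp
      qed
      moreover have "\<eta> = \<eta>'"
      proof -
        have "cis (- (c * t)) * complex_of_real (sn (1 - c\<^sup>2) t) * \<eta> = cis (- (c * t)) * complex_of_real (sn (1 - c\<^sup>2) t) * \<eta>'"
          using w \<open>c = c'\<close> by (simp add: geo_w_def)
        then show ?thesis using sn0 by simp
      qed
      ultimately show False using s(2) by simp
    qed
    moreover have "X \<noteq> mat 1" using False by auto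
    ultimately show ?thesis using SL by (simp add: locus_def)
  qed
next
  fix X assume X: "X \<in> locus"
  then have SL: "X \<in> SL2" by (simp add: locus_def)
  obtain C t where C: "gdom C t" "0 < C" "0 < t" "sn (1 - C\<^sup>2) t = cmod (cw X)" "theta C t = \<bar>Arg (cz X)\<bar>"
    "cw X = 0 \<or> theta C t = pi"
    by (rule locus_reached[OF X])
  obtain c \<eta> where c: "\<bar>c\<bar> = C" "cmod \<eta> = 1" "geo c \<eta> (2 * t) = X"
    by (rule reach[OF SL C(1,4,5)])
  have th: "theta C t \<le> pi" using Arg_bounded[of "cz X"] unfolding C(5) by linarith
  have z: "geo_z c t = cz X" and w: "geo_w c \<eta> t = cw X" using c(3) by (auto simp: mat_eq_complex_iff)
  \<comment> \<open>The two curves are told apart at the midpoint of [0, 2 t], where w is nonzero in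
    the first case and z is not real in the second.\<close>
  have "\<exists>c' \<eta>'. \<bar>c'\<bar> = C \<and> cmod \<eta>' = 1 \<and> geo c' \<eta>' (2 * t) = X \<and> geo c' \<eta>' t \<noteq> geo c \<eta> t"
  proof (cases "cw X = 0")
    case True
    have "geo_w c (- \<eta>) t = cw X" using w True by (simp add: geo_w_def)
    moreover have "0 < sn (1 - C\<^sup>2) (t / 2)" using gdom_sn_pos[OF C(1), of "t / 2"] C(3) by simp
    then have "sn (1 - c\<^sup>2) (t / 2) \<noteq> 0" using c(1) by auto
    then have "geo_w c (- \<eta>) (t / 2) \<noteq> geo_w c \<eta> (t / 2)"
      using c(2) by (auto simp: geo_w_def)
    ultimately show ?thesis using c z
      by (intro exI[of _ c] exI[of _ "- \<eta>"]) (auto simp: mat_eq_complex_iff)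
  next
    case False
    then have "theta C t = pi" using C(6) by simp
    then have "Arg (cz X) = pi" using C(5) abs_Arg_eq_pi_iff by simp
    then have "cnj (cz X) = cz X" by (simp add: Arg_eq_pi_iff complex_eq_iff)
    then have z': "geo_z (- c) t = cz X" using z by (simp add: geo_z_neg)
    \<comment> \<open>Changing \<open>c\<close> to \<open>-c\<close> turns the phase factor of
      \<open>geo_w\<close> from cis (-c t) into cis (c t); the factor in this direction compensates
      exactly at time \<open>t\<close>.\<close>
    define \<zeta> where "\<zeta> = cis (- (2 * c * t)) * \<eta>"
    have "geo_w (- c) \<zeta> t = (cis (c * t) * cis (- (2 * c * t))) * (complex_of_real (sn (1 - c\<^sup>2) t) * \<eta>)"
      by (simp add: geo_w_def \<zeta>_def mult_ac)
    also have "\<dots> = geo_w c \<eta> t" unfolding cis_mult by (simp add: geo_w_def mult.assoc)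
    finally have w': "geo_w (- c) \<zeta> t = cw X" using w by simp
    have h: "gdom C (t / 2)" using gdom_le[OF C(1), of "t / 2"] C(3) by simp
    have "0 < theta C (t / 2)" using theta_pos[OF h] C by simp
    moreover have "theta C (t / 2) < pi" using theta_strict_mono[OF C(1,2), of "t / 2"] C(3) th by simp
    ultimately have "0 < sin (theta C (t / 2))" by (rule sin_gt_zero)
    then have "Im (geo_z C (t / 2)) \<noteq> 0"
      using geo_z_polar[OF h] sqrt_1_plus_pos[of "sn (1 - C\<^sup>2) (t / 2)"] by simp
    then have "geo_z (- C) (t / 2) \<noteq> geo_z C (t / 2)" unfolding geo_z_neg by (simp add: complex_eq_iff)
    then have "geo_z (- c) (t / 2) \<noteq> geo_z c (t / 2)" using c(1) by (cases "c \<ge> 0") auto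
    then show ?thesis using c z' w'
      by (intro exI[of _ "- c"] exI[of _ \<zeta>]) (auto simp: mat_eq_complex_iff \<zeta>_def norm_mult)
  qed
  then obtain c' \<eta>' where c': "\<bar>c'\<bar> = C" "cmod \<eta>' = 1" "geo c' \<eta>' (2 * t) = X" "geo c' \<eta>' t \<noteq> geo c \<eta> t"
    by blast
  have "geo c \<eta> (2 * t) \<in> cut_locus"
  proof (rule cut_locusI[where \<gamma> = "geo c \<eta>" and \<delta> = "geo c' \<eta>'" and T = "2 * t" and t = t])
    show "geo c \<eta> \<in> geodesics" "geo c' \<eta>' \<in> geodesics" unfolding geodesics_eq using c(2) c'(2) by blast+
    show "minimizing (geo c \<eta>) (2 * t)" using minimizing_geoI[OF c(2), of c t] c(1) C(1) th by simp
    show "minimizing (geo c' \<eta>') (2 * t)" using minimizing_geoI[OF c'(2), of c' t] c'(1) C(1) th by simp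
    show "geo c \<eta> t \<noteq> geo c' \<eta>' t" using c'(4) by (rule not_sym)
    show "geo c \<eta> (2 * t) = geo c' \<eta>' (2 * t)" by (simp only: c(3) c'(3))
  qed (use C(3) in auto)
  then show "X \<in> cut_locus" by (simp only: c(3))
qed

text \<open>The symmetric matrices include the trace -2, although the segment is open: these points
  lie over (-1, 0), that is on the circle. Since the determinant is 1, a symmetric matrix of
  negative trace has trace at most -2.\<close>

lemma preimage_explicit:
  "SL2 \<inter> quotient_proj -` ({(x, y). x\<^sup>2 + y\<^sup>2 = 1} \<union> {(x, 0) |x. x < -1}) =
      {vector [vector [x, y], vector [- y, x]] |x y. x\<^sup>2 + y\<^sup>2 = 1} \<union>
      {X \<in> SL2. \<exists>a b d. X = vector [vector [a, b], vector [b, d]] \<and> (a + d) / 2 \<le> -1}"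
  (is "?L = ?R \<union> ?S")
proof (intro equalityI subsetI)
  fix X assume "X \<in> ?L"
  then have SL: "X \<in> SL2" and "cw X = 0 \<or> Arg (cz X) = pi" using preimage_iff[of X] by auto
  then consider "cw X = 0" | "Arg (cz X) = pi" by blast
  then show "X \<in> ?R \<union> ?S"
  proof cases
    case 1
    then have e: "X $ 2 $ 2 = X $ 1 $ 1" "X $ 2 $ 1 = - X $ 1 $ 2" by (auto simp: cw_def complex_eq_iff)
    then have "X = vector [vector [X $ 1 $ 1, X $ 1 $ 2], vector [- X $ 1 $ 2, X $ 1 $ 1]]" by (simp add: mat2_eq_iff)
    moreover have "(X $ 1 $ 1)\<^sup>2 + (X $ 1 $ 2)\<^sup>2 = 1" using SL e by (simp add: SL2_def det_2 power2_eq_square)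
    ultimately show ?thesis by (intro UnI1 CollectI exI conjI)
  next
    case 2
    then have e: "X $ 2 $ 1 = X $ 1 $ 2" "X $ 1 $ 1 + X $ 2 $ 2 < 0"
      by (auto simp: Arg_eq_pi_iff cz_def)
    then have "X = vector [vector [X $ 1 $ 1, X $ 1 $ 2], vector [X $ 1 $ 2, X $ 2 $ 2]]" by (simp add: mat2_eq_iff)
    moreover have "(X $ 1 $ 1 + X $ 2 $ 2) / 2 \<le> -1"
    proof -
      have "X $ 1 $ 1 * X $ 2 $ 2 = 1 + (X $ 1 $ 2)\<^sup>2" using SL e by (simp add: SL2_def det_2 power2_eq_square)
      then have "(- (X $ 1 $ 1 + X $ 2 $ 2))\<^sup>2 = 4 + 4 * (X $ 1 $ 2)\<^sup>2 + (X $ 1 $ 1 - X $ 2 $ 2)\<^sup>2"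
        by (simp add: power2_eq_square algebra_simps)
      then have "2\<^sup>2 \<le> (- (X $ 1 $ 1 + X $ 2 $ 2))\<^sup>2" by simp
      then have "2 \<le> - (X $ 1 $ 1 + X $ 2 $ 2)" by (rule power2_le_imp_le) (use e in simp)
      then show ?thesis by simp
    qed
    ultimately show ?thesis using SL by (intro UnI2 CollectI exI conjI)
  qed
next
  fix X assume "X \<in> ?R \<union> ?S"
  then have "X \<in> SL2 \<and> (cw X = 0 \<or> Arg (cz X) = pi)"
  proof
    assume "X \<in> ?R"
    then obtain x y where X: "X = vector [vector [x, y], vector [- y, x]]" and xy: "x\<^sup>2 + y\<^sup>2 = 1"
      by (elim CollectE exE conjE)
    have "det X = x\<^sup>2 + y\<^sup>2" by (simp add: X det_2 power2_eq_square)
    moreover have "cw X = 0" by (simp add: X cw_def complex_eq_iff)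
    ultimately show ?thesis using xy by (simp add: SL2_def)
  next
    assume "X \<in> ?S"
    then obtain a b d where X: "X = vector [vector [a, b], vector [b, d]]" and ad: "(a + d) / 2 \<le> -1" and SL: "X \<in> SL2"
      by (elim CollectE exE conjE)
    have "Im (cz X) = 0 \<and> Re (cz X) < 0" using ad by (simp add: X cz_def)
    then show ?thesis using SL by (simp only: Arg_eq_pi_iff simp_thms)
  qed
  then have X: "X \<in> SL2" "cw X = 0 \<or> Arg (cz X) = pi" by simp_all
  then have "quotient_proj X \<in> {(x, y). x\<^sup>2 + y\<^sup>2 = 1} \<union> {(x, 0) |x. x < -1}"
    by (subst preimage_iff)
  with X(1) show "X \<in> ?L" by (rule IntI[OF _ vimageI2])
qed

theorem proposition9p4:
  shows "critical_locus = cut_locus \<and>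
    cut_locus =
      (SL2 \<inter> quotient_proj -` ({(x, y). x\<^sup>2 + y\<^sup>2 = 1} \<union> {(x, 0) |x. x < -1})) - {mat 1} \<and>
    SL2 \<inter> quotient_proj -` ({(x, y). x\<^sup>2 + y\<^sup>2 = 1} \<union> {(x, 0) |x. x < -1}) =
      {vector [vector [x, y], vector [- y, x]] |x y. x\<^sup>2 + y\<^sup>2 = 1} \<union>
      {X \<in> SL2. \<exists>a b d. X = vector [vector [a, b], vector [b, d]] \<and> (a + d) / 2 \<le> -1}"
  unfolding critical_locus_eq cut_locus_eq preimage_eq by (intro conjI refl preimage_explicit)

end
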